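(* Let $\Omega$ be a bounded domain in $X$ whose boundary is Ahlfors codimension $1$ regular, i.e. there is $C_A\ge 1$ such that for all $x\in\partial\Omega$ and $0<r\le\operatorname{diam}(\Omega)$, $$C_A^{-1}\frac{\mu(B(x,r))}{r}\le \mathcal{H}(B(x,r)\cap\partial\Omega)\le C_A\frac{\mu(B(x,r))}{r}.$$ Then there is a bounded linear operator $E:B^0_{1,1}(\partial\Omega)\to BV(\Omega)$ such that $T\circ E$ is the identity operator on $B^0_{1,1}(\partial\Omega)$; that is, for each $f\in B^0_{1,1}(\partial\Omega)$ the trace $T(Ef)(z)$ exists and equals $f(z)$ for $\mathcal{H}$-a.e. $z\in\partial\Omega$.
   Context: Standing assumptions: $(X,d,\mu)$ is a complete metric space with a Borel regular (Radon) measure $\mu$ that is doubling: there is $C_D$ with $0<\mu(B(x,2r))\le C_D\,\mu(B(x,r))<\infty$ for all $x\in X$, $r>0$. A domain is a nonempty connected open set. No Poincaré inequality is assumed. Co-dimension $1$ Hausdorff measure: for $A\subset X$, $\mathcal{H}(A)=\lim_{\delta\to0^+}\inf\{\sum_i \mu(B_i)/\operatorname{rad}(B_i): B_i \text{ balls in } X,\ \operatorname{rad}(B_i)<\delta,\ A\subset\bigcup_i B_i\}$. The boundary $\partial\Omega$ is equipped with the restriction of $\mathcal{H}$, and $L^1(\partial\Omega)$ and integral averages over subsets of $\partial\Omega$ are taken with respect to it. Besov space: fix $R\in(0,\infty)$. $B^0_{1,1}(\partial\Omega)$ is the space of $u\in L^1(\partial\Omega)$ with finite norm $\|u\|_{L^1(\partial\Omega)}+\int_0^R\int_{\partial\Omega}\frac{1}{\mathcal{H}(B(x,t)\cap\partial\Omega)}\int_{B(x,t)\cap\partial\Omega}|u(y)-u(x)|\,d\mathcal{H}(y)\,d\mathcal{H}(x)\,\frac{dt}{t}$.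 (The space does not depend on $R$.) BV: a Borel function $g:U\to[0,\infty]$ is an upper gradient of $u$ in an open set $U$ if for every rectifiable curve $\gamma$ in $U$ with endpoints $x,y$ we have $|u(x)-u(y)|\le\int_\gamma g\,ds$ whenever $u(x),u(y)$ are finite, and $\int_\gamma g\,ds=\infty$ otherwise. Let $I(u:U)=\inf\int_U g\,d\mu$ over all upper gradients $g$ of $u$ in $U$, and $\|Du\|(U)=\inf\{\liminf_i I(u_i:U): u_i \text{ locally Lipschitz in } U,\ u_i\to u\text{ in }L^1(U)\}$. $BV(\Omega)$ is the space of $u\in L^1(\Omega)$ with $\|u\|_{BV(\Omega)}=\|u\|_{L^1(\Omega)}+\|Du\|(\Omega)<\infty$. Trace: for $u\in BV(\Omega)$ and $z\in\partial\Omega$, the trace $Tu(z)$ exists and is the number $Tu(z)\in\mathbb{R}$ if $\limsup_{r\to0^+}\frac{1}{\mu(B(z,r)\cap\Omega)}\int_{B(z,r)\cap\Omega}|u(y)-Tu(z)|\,d\mu(y)=0$. *)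

theory Defs
  imports "HOL-Analysis.Analysis"
begin

section \<open>Doubling measures\<close>

text \<open>A Borel regular outer measure is determined by its restriction to the Borel sets, so
  \<open>\<mu>\<close> is a measure on the Borel sigma-algebra of the ambient space.\<close>

definition doubling_measure :: "'a::metric_space measure \<Rightarrow> bool" where
  "doubling_measure M \<longleftrightarrow> sets M = sets borel \<and>
     (\<exists>C::real. \<forall>x r. 0 < r \<longrightarrow>
        0 < emeasure M (ball x (2 * r)) \<and>
        emeasure M (ball x (2 * r)) \<le> ennreal C * emeasure M (ball x r) \<and>
        ennreal C * emeasure M (ball x r) < \<infinity>)"


section \<open>Codimension one Hausdorff measure\<close>

text \<open>A ball is a pair of a centre and a radius. Coverings are finite or countably infinite,
  and integration against \<^term>\<open>count_space C\<close> is summation over \<^term>\<open>C\<close>.\<close>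

definition codim1_content :: "'a::metric_space measure \<Rightarrow> real \<Rightarrow> 'a set \<Rightarrow> ennreal" where
  "codim1_content M \<delta> A =
     (INF C\<in>{C. countable C \<and> (\<forall>(x, r)\<in>C. 0 < r \<and> r < \<delta>) \<and> A \<subseteq> (\<Union>(x, r)\<in>C. ball x r)}.
        \<integral>\<^sup>+(x, r). emeasure M (ball x r) / ennreal r \<partial>count_space C)"

definition codim1_hausdorff :: "'a::metric_space measure \<Rightarrow> 'a set \<Rightarrow> ennreal" where
  "codim1_hausdorff M A = Lim (at_right 0) (\<lambda>\<delta>. codim1_content M \<delta> A)"

text \<open>The restriction to \<^term>\<open>frontier \<Omega>\<close> of the Borel measure induced by
  \<^const>\<open>codim1_hausdorff\<close>. \<^const>\<open>measure_of\<close> returns the null measure on set functions that are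
  not countably additive; \<open>emeasure_boundary_measure\<close> below rules this out.\<close>

definition boundary_measure :: "'a::metric_space measure \<Rightarrow> 'a set \<Rightarrow> 'a measure" where
  "boundary_measure M \<Omega> =
     restrict_space (measure_of UNIV (sets borel) (codim1_hausdorff M)) (frontier \<Omega>)"

lemma codim1_content_antimono:
  assumes "\<delta> \<le> \<delta>'"
  shows "codim1_content M \<delta>' A \<le> codim1_content M \<delta> A"
  unfolding codim1_content_def
  by (rule INF_superset_mono) (use assms in fastforce)+

lemma tendsto_codim1_content:
  "((\<lambda>\<delta>. codim1_content M \<delta> A) \<longlongrightarrow> (SUP \<delta>\<in>{0<..}. codim1_content M \<delta> A)) (at_right 0)"
proof (rule order_tendstoI)
  fix y assume "y < (SUP \<delta>\<in>{0<..}. codim1_content M \<delta> A)"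
  then obtain d where d: "0 < d" "y < codim1_content M d A"
    by (auto simp: less_SUP_iff)
  have "\<forall>\<^sub>F x in at_right 0. x \<in> {0<..<d}"
    using d(1) eventually_at_right_real by blast
  then show "\<forall>\<^sub>F x in at_right 0. y < codim1_content M x A"
    by eventually_elim
      (use d(2) codim1_content_antimono in \<open>metis greaterThanLessThan_iff less_imp_le order_less_le_trans\<close>)
next
  fix y assume y: "(SUP \<delta>\<in>{0<..}. codim1_content M \<delta> A) < y"
  have "\<forall>\<^sub>F x in at_right (0::real). x \<in> {0<..}"
    by (simp add: eventually_at_right_less)
  then show "\<forall>\<^sub>F x in at_right 0. codim1_content M x A < y"
    by eventually_elim (use y in \<open>meson SUP_upper order_le_less_trans\<close>)
qed

lemma codim1_hausdorff_eq_SUP: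
  "codim1_hausdorff M A = (SUP \<delta>\<in>{0<..}. codim1_content M \<delta> A)"
  unfolding codim1_hausdorff_def
  by (rule tendsto_Lim[OF _ tendsto_codim1_content]) simp

lemma codim1_content_UN_le:
  "codim1_content M \<delta> (\<Union>i::nat. A i) \<le> (\<Sum>i. codim1_content M \<delta> (A i))"
proof (rule ennreal_le_epsilon)
  fix e :: real
  assume fin: "(\<Sum>i. codim1_content M \<delta> (A i)) < top" and e: "0 < e"
  define w where "w = (\<lambda>p::'a \<times> real. emeasure M (ball (fst p) (snd p)) / ennreal (snd p))"
  define K where "K = (\<lambda>A. {C. countable C \<and> (\<forall>(x::'a, r)\<in>C. 0 < r \<and> r < \<delta>) \<and> A \<subseteq> (\<Union>(x, r)\<in>C. ball x r)})"
  have content: "codim1_content M \<delta> B = (INF C\<in>K B. \<integral>\<^sup>+p. w p * indicator C p \<partial>count_space UNIV)" for B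
    unfolding codim1_content_def K_def w_def
    by (intro INF_cong refl) (simp add: nn_integral_count_space_indicator case_prod_beta)
  have finI: "codim1_content M \<delta> (A i) < top" for i
    using fin ennreal_suminf_lessD by blast
  have "\<exists>C\<in>K (A i). (\<integral>\<^sup>+p. w p * indicator C p \<partial>count_space UNIV)
      < codim1_content M \<delta> (A i) + ennreal (e * (1/2) ^ Suc i)" for i
  proof -
    have "codim1_content M \<delta> (A i) < codim1_content M \<delta> (A i) + ennreal (e * (1/2) ^ Suc i)"
      using finI[of i] e by (simp add: ennreal_add_left_cancel_less[where b = 0, simplified])
    then show ?thesis
      by (subst (asm) (1) content) (auto simp: INF_less_iff)
  qed
  then obtain C where C: "\<And>i. C i \<in> K (A i)"
    "\<And>i. (\<integral>\<^sup>+p. w p * indicator (C i) p \<partial>count_space UNIV)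
      < codim1_content M \<delta> (A i) + ennreal (e * (1/2) ^ Suc i)"
    by metis
  have U: "(\<Union>i. C i) \<in> K (\<Union>i. A i)"
  proof -
    have "countable (\<Union>i. C i)"
      using C(1) by (auto simp: K_def)
    moreover have "\<forall>(x, r)\<in>(\<Union>i. C i). 0 < r \<and> r < \<delta>"
      using C(1) unfolding K_def by blast
    moreover have "(\<Union>i. A i) \<subseteq> (\<Union>(x, r)\<in>(\<Union>i. C i). ball x r)"
      using C(1) unfolding K_def by blast
    ultimately show ?thesis
      unfolding K_def by blast
  qed
  have "codim1_content M \<delta> (\<Union>i. A i) \<le> (\<integral>\<^sup>+p. w p * indicator (\<Union>i. C i) p \<partial>count_space UNIV)"
    unfolding content by (rule INF_lower[OF U])
  also have "\<dots> \<le> (\<integral>\<^sup>+p. (\<Sum>i. w p * indicator (C i) p) \<partial>count_space UNIV)"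
  proof (rule nn_integral_mono)
    fix p
    show "w p * indicator (\<Union>i. C i) p \<le> (\<Sum>i. w p * indicator (C i) p)"
    proof (cases "p \<in> (\<Union>i. C i)")
      case True
      then obtain j where "p \<in> C j" by blast
      then have "w p = (\<Sum>i\<in>{j}. w p * indicator (C i) p)" by simp
      also have "\<dots> \<le> (\<Sum>i. w p * indicator (C i) p)"
        by (rule sum_le_suminf) auto
      finally show ?thesis using True by simp
    qed simp
  qed
  also have "\<dots> = (\<Sum>i. \<integral>\<^sup>+p. w p * indicator (C i) p \<partial>count_space UNIV)"
    by (rule nn_integral_suminf) simp
  also have "\<dots> \<le> (\<Sum>i. codim1_content M \<delta> (A i) + ennreal (e * (1/2) ^ Suc i))"
    by (intro suminf_le less_imp_le C(2)) auto
  also have "\<dots> = (\<Sum>i. codim1_content M \<delta> (A i)) + (\<Sum>i. ennreal (e * (1/2) ^ Suc i))"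
    by (rule suminf_add[symmetric]) auto
  also have "(\<Sum>i. ennreal (e * (1/2) ^ Suc i)) = ennreal e"
    using sums_mult[OF power_half_series, of e] e
    by (intro suminf_ennreal_eq) auto
  finally show "codim1_content M \<delta> (\<Union>i. A i) \<le> (\<Sum>i. codim1_content M \<delta> (A i)) + ennreal e" .
qed

lemma codim1_content_separated:
  assumes sep: "\<And>x y. x \<in> A \<Longrightarrow> y \<in> B \<Longrightarrow> 2 * \<delta> \<le> dist x y"
  shows "codim1_content M \<delta> A + codim1_content M \<delta> B \<le> codim1_content M \<delta> (A \<union> B)"
  unfolding codim1_content_def[of M \<delta> "A \<union> B"]
proof (rule INF_greatest, safe)
  fix C :: "('a \<times> real) set"
  assume C: "countable C" "\<forall>(x, r)\<in>C. 0 < r \<and> r < \<delta>" "A \<union> B \<subseteq> (\<Union>(x, r)\<in>C. ball x r)"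
  define w where "w = (\<lambda>(x::'a, r). emeasure M (ball x r) / ennreal r)"
  define CA where "CA = {p\<in>C. ball (fst p) (snd p) \<inter> A \<noteq> {}}"
  define CB where "CB = {p\<in>C. ball (fst p) (snd p) \<inter> B \<noteq> {}}"
  have disj: "CA \<inter> CB = {}"
  proof (rule ccontr)
    assume "CA \<inter> CB \<noteq> {}"
    then obtain x r a b where p: "(x, r) \<in> C" "a \<in> A" "b \<in> B" "dist x a < r" "dist x b < r"
      by (auto simp: CA_def CB_def)
    have "dist a b \<le> dist x a + dist x b"
      by (metis dist_commute dist_triangle)
    with p sep[of a b] C(2) show False
      by fastforce
  qed
  have "codim1_content M \<delta> A \<le> (\<integral>\<^sup>+p. w p \<partial>count_space CA)"
    unfolding codim1_content_def w_def
  proof (rule INF_lower, safe)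
    show "countable CA"
      using C(1) by (simp add: CA_def)
    show "0 < r" "r < \<delta>" if "(x, r) \<in> CA" for x r
      using that C(2) by (auto simp: CA_def)
    show "a \<in> (\<Union>(x, r)\<in>CA. ball x r)" if "a \<in> A" for a
    proof -
      obtain x r where "(x, r) \<in> C" "a \<in> ball x r"
        using C(3) \<open>a \<in> A\<close> by blast
      with that have "(x, r) \<in> CA"
        by (auto simp: CA_def)
      with \<open>a \<in> ball x r\<close> show ?thesis
        by blast
    qed
  qed
  moreover have "codim1_content M \<delta> B \<le> (\<integral>\<^sup>+p. w p \<partial>count_space CB)"
    unfolding codim1_content_def w_def
  proof (rule INF_lower, safe)
    show "countable CB"
      using C(1) by (simp add: CB_def)
    show "0 < r" "r < \<delta>" if "(x, r) \<in> CB" for x r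
      using that C(2) by (auto simp: CB_def)
    show "a \<in> (\<Union>(x, r)\<in>CB. ball x r)" if "a \<in> B" for a
    proof -
      obtain x r where "(x, r) \<in> C" "a \<in> ball x r"
        using C(3) \<open>a \<in> B\<close> by blast
      with that have "(x, r) \<in> CB"
        by (auto simp: CB_def)
      with \<open>a \<in> ball x r\<close> show ?thesis
        by blast
    qed
  qed
  ultimately have "codim1_content M \<delta> A + codim1_content M \<delta> B
      \<le> (\<integral>\<^sup>+p. w p \<partial>count_space CA) + (\<integral>\<^sup>+p. w p \<partial>count_space CB)"
    by (rule add_mono)
  also have "\<dots> = (\<integral>\<^sup>+p. w p * indicator CA p + w p * indicator CB p \<partial>count_space UNIV)"
    by (simp add: nn_integral_count_space_indicator nn_integral_add)
  also have "\<dots> \<le> (\<integral>\<^sup>+p. w p * indicator C p \<partial>count_space UNIV)"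
    using disj by (intro nn_integral_mono) (auto simp: CA_def CB_def indicator_def)
  also have "\<dots> = (\<integral>\<^sup>+(x, r). emeasure M (ball x r) / ennreal r \<partial>count_space C)"
    by (simp add: nn_integral_count_space_indicator w_def)
  finally show "codim1_content M \<delta> A + codim1_content M \<delta> B
      \<le> (\<integral>\<^sup>+(x, r). emeasure M (ball x r) / ennreal r \<partial>count_space C)" .
qed

lemma codim1_content_mono: "A \<subseteq> B \<Longrightarrow> codim1_content M \<delta> A \<le> codim1_content M \<delta> B"
  unfolding codim1_content_def by (rule INF_superset_mono) auto

lemma codim1_content_empty [simp]: "codim1_content M \<delta> {} = 0"
proof -
  have "codim1_content M \<delta> {} \<le> (\<integral>\<^sup>+(x, r). emeasure M (ball x r) / ennreal r \<partial>count_space {})"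
    unfolding codim1_content_def by (rule INF_lower) simp
  then show ?thesis
    by (simp add: nn_integral_empty)
qed

lemma codim1_hausdorff_mono: "A \<subseteq> B \<Longrightarrow> codim1_hausdorff M A \<le> codim1_hausdorff M B"
  unfolding codim1_hausdorff_eq_SUP by (intro SUP_mono) (use codim1_content_mono in blast)

lemma codim1_hausdorff_empty [simp]: "codim1_hausdorff M {} = 0"
  unfolding codim1_hausdorff_eq_SUP by simp

lemma codim1_hausdorff_UN_le:
  "codim1_hausdorff M (\<Union>i::nat. A i) \<le> (\<Sum>i. codim1_hausdorff M (A i))"
  unfolding codim1_hausdorff_eq_SUP
proof (rule SUP_least)
  fix d :: real assume d: "d \<in> {0<..}"
  have "codim1_content M d (\<Union>i. A i) \<le> (\<Sum>i. codim1_content M d (A i))"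
    by (rule codim1_content_UN_le)
  also have "\<dots> \<le> (\<Sum>i. SUP \<delta>\<in>{0<..}. codim1_content M \<delta> (A i))"
    by (intro suminf_le SUP_upper d) auto
  finally show "codim1_content M d (\<Union>i. A i) \<le> (\<Sum>i. SUP \<delta>\<in>{0<..}. codim1_content M \<delta> (A i))" .
qed

lemma outer_measure_space_codim1_hausdorff: "outer_measure_space UNIV (codim1_hausdorff M)"
  unfolding outer_measure_space_def positive_def increasing_def countably_subadditive_def
  by (auto simp: codim1_hausdorff_mono codim1_hausdorff_UN_le)

lemma codim1_hausdorff_Un_le:
  "codim1_hausdorff M (A \<union> B) \<le> codim1_hausdorff M A + codim1_hausdorff M B"
proof -
  define C where "C = (\<lambda>i::nat. if i = 0 then A else if i = 1 then B else {})"
  have "A \<union> B = (\<Union>i. C i)"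
    by (auto simp: C_def split: if_splits)
  then have "codim1_hausdorff M (A \<union> B) \<le> (\<Sum>i. codim1_hausdorff M (C i))"
    using codim1_hausdorff_UN_le[of M C] by simp
  also have "\<dots> = (\<Sum>i\<in>{0, 1}. codim1_hausdorff M (C i))"
    by (rule suminf_finite) (auto simp: C_def)
  finally show ?thesis
    by (simp add: C_def)
qed

lemma codim1_hausdorff_separated:
  assumes e: "0 < e" and sep: "\<And>x y. x \<in> A \<Longrightarrow> y \<in> B \<Longrightarrow> e \<le> dist x y"
  shows "codim1_hausdorff M A + codim1_hausdorff M B \<le> codim1_hausdorff M (A \<union> B)"
proof -
  have "((\<lambda>\<delta>. codim1_content M \<delta> A + codim1_content M \<delta> B)
      \<longlongrightarrow> codim1_hausdorff M A + codim1_hausdorff M B) (at_right 0)"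
    unfolding codim1_hausdorff_eq_SUP by (intro tendsto_add tendsto_codim1_content)
  moreover have "((\<lambda>\<delta>. codim1_content M \<delta> (A \<union> B)) \<longlongrightarrow> codim1_hausdorff M (A \<union> B)) (at_right 0)"
    unfolding codim1_hausdorff_eq_SUP by (rule tendsto_codim1_content)
  moreover have "\<forall>\<^sub>F \<delta> in at_right 0. codim1_content M \<delta> A + codim1_content M \<delta> B
      \<le> codim1_content M \<delta> (A \<union> B)"
  proof -
    have "\<forall>\<^sub>F \<delta> in at_right 0. \<delta> \<in> {0<..<e / 2}"
      using e eventually_at_right_real[of 0 "e / 2"] by simp
    then show ?thesis
    proof eventually_elim
      case (elim \<delta>)
      show ?case
        by (rule codim1_content_separated) (use sep elim in fastforce)
    qed
  qed
  ultimately show ?thesis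
    using tendsto_le[OF trivial_limit_at_right_real] by blast
qed

lemma closed_in_lambda_system_codim1_hausdorff:
  assumes F: "closed F"
  shows "F \<in> lambda_system UNIV UNIV (codim1_hausdorff M)"
proof -
  let ?H = "codim1_hausdorff M"
  have main: "?H (F \<inter> a) + ?H ((UNIV - F) \<inter> a) \<le> ?H a" if ne: "F \<noteq> {}" and fin: "?H a < top" for a
  proof -
    define T where "T n = {x\<in>a. 1 / real (n + 1) \<le> infdist x F}" for n :: nat
    define D where "D n = {x\<in>a. 1 / real (n + 2) \<le> infdist x F \<and> infdist x F < 1 / real (n + 1)}" for n :: nat
    have infd: "infdist x F \<le> infdist y F + dist x y" for x y
      by (rule infdist_triangle)
    have T: "?H (F \<inter> a) + ?H (T n) \<le> ?H a" for n
    proof -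
      have "?H (F \<inter> a) + ?H (T n) \<le> ?H (F \<inter> a \<union> T n)"
      proof (rule codim1_hausdorff_separated)
        show "0 < 1 / real (n + 1)" by simp
        fix x y assume "x \<in> F \<inter> a" "y \<in> T n"
        then show "1 / real (n + 1) \<le> dist x y"
          using infd[of y x] by (simp add: T_def dist_commute)
      qed
      also have "\<dots> \<le> ?H a"
        by (rule codim1_hausdorff_mono) (auto simp: T_def)
      finally show ?thesis .
    qed
    have D: "(\<Sum>k<m. ?H (D (2 * k + j))) \<le> ?H (\<Union>k<m. D (2 * k + j))" for m j
    proof (induction m)
      case (Suc m)
      have "(\<Sum>k<Suc m. ?H (D (2 * k + j))) \<le> ?H (\<Union>k<m. D (2 * k + j)) + ?H (D (2 * m + j))"
        using Suc by (simp add: add_right_mono)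
      also have "\<dots> \<le> ?H ((\<Union>k<m. D (2 * k + j)) \<union> D (2 * m + j))"
      proof (cases "m = 0")
        case False
        show ?thesis
        proof (rule codim1_hausdorff_separated)
          let ?e = "1 / real (2 * m + j) - 1 / real (2 * m + j + 1)"
          show "0 < ?e"
            using False by (simp add: frac_less2)
          fix x y assume "x \<in> (\<Union>k<m. D (2 * k + j))" and y: "y \<in> D (2 * m + j)"
          then obtain k where k: "k < m" "x \<in> D (2 * k + j)" by blast
          have "1 / real (2 * m + j) \<le> 1 / real (2 * k + j + 2)"
            using k(1) by (intro divide_left_mono) auto
          also have "\<dots> \<le> infdist x F"
            using k(2) by (simp add: D_def)
          finally show "?e \<le> dist x y"
            using y infd[of x y] by (simp add: D_def)
        qed
      qed simp
      also have "(\<Union>k<m. D (2 * k + j)) \<union> D (2 * m + j) = (\<Union>k<Suc m. D (2 * k + j))"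
        by (auto simp: lessThan_Suc)
      finally show ?case .
    qed simp
    have Dle: "(\<Sum>k<m. ?H (D (2 * k + j))) \<le> ?H a" for m j
      by (rule order_trans[OF D codim1_hausdorff_mono]) (auto simp: D_def)
    have "(\<Sum>n<m. ?H (D n)) \<le> ?H a + ?H a" for m
    proof -
      have "(\<Sum>n<m. ?H (D n)) \<le> (\<Sum>n<2 * m. ?H (D n))"
        by (rule sum_mono2) auto
      also have "\<dots> = (\<Sum>k<m. ?H (D (2 * k + 0))) + (\<Sum>k<m. ?H (D (2 * k + 1)))"
        by (induction m) (auto simp: algebra_simps)
      also have "\<dots> \<le> ?H a + ?H a"
        by (intro add_mono Dle)
      finally show ?thesis .
    qed
    then have sum_le: "(\<Sum>n. ?H (D n)) \<le> ?H a + ?H a"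
      by (intro suminf_le_const summableI) auto
    then have sum_fin: "(\<Sum>n. ?H (D n)) < top"
      using fin by (meson ennreal_add_less_top order_le_less_trans)
    have tail: "(\<lambda>n. \<Sum>k. ?H (D (k + n))) \<longlonglongrightarrow> 0"
    proof -
      have Dfin: "?H (D k) < top" for k
        using sum_fin ennreal_suminf_lessD by blast
      define h where "h k = enn2real (?H (D k))" for k
      have h: "?H (D k) = ennreal (h k)" "0 \<le> h k" for k
        using Dfin[of k] by (auto simp: h_def)
      have summ: "summable h"
        using sum_fin h by (intro summable_suminf_not_top) auto
      have "(\<lambda>n. ennreal (\<Sum>k. h (k + n))) \<longlonglongrightarrow> ennreal 0"
        using suminf_exist_split2[OF summ] by (intro tendsto_ennrealI) simp
      moreover have "(\<Sum>k. ?H (D (k + n))) = ennreal (\<Sum>k. h (k + n))" for n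
        unfolding h(1) using h(2) summ by (intro suminf_ennreal2) (auto simp: summable_iff_shift)
      ultimately show ?thesis by simp
    qed
    have split: "?H ((UNIV - F) \<inter> a) \<le> ?H (T n) + (\<Sum>k. ?H (D (k + n)))" for n
    proof -
      have "(UNIV - F) \<inter> a \<subseteq> T n \<union> (\<Union>k. D (k + n))"
      proof
        fix x assume x: "x \<in> (UNIV - F) \<inter> a"
        have pos: "0 < infdist x F"
          using x F ne by (simp add: infdist_pos_not_in_closed)
        show "x \<in> T n \<union> (\<Union>k. D (k + n))"
        proof (cases "x \<in> T n")
          case False
          define m where "m = (LEAST m. 1 / real (m + 1) \<le> infdist x F)"
          have ex: "\<exists>m. 1 / real (m + 1) \<le> infdist x F"
            using pos nat_approx_posE[OF pos] by (metis Suc_eq_plus1 less_imp_le)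
          have m: "1 / real (m + 1) \<le> infdist x F"
            unfolding m_def by (rule LeastI_ex[OF ex])
          have below: "infdist x F < 1 / real (k + 1)" if "k < m" for k
            using not_less_Least[of k "\<lambda>m. 1 / real (m + 1) \<le> infdist x F"] that by (auto simp: m_def)
          have lt: "infdist x F < 1 / real (n + 1)"
            using False x by (auto simp: T_def)
          have "n < m"
          proof (rule ccontr)
            assume "\<not> n < m"
            then have "1 / real (n + 1) \<le> 1 / real (m + 1)"
              by (intro divide_left_mono) auto
            with m lt show False by linarith
          qed
          then obtain k where k: "m = Suc (k + n)"
            by (metis less_imp_Suc_add add.commute)
          have "x \<in> D (k + n)"
            using m below[of "k + n"] x by (simp add: D_def k add_ac)
          then show ?thesis by blast
        qed simp
      qed
      then have "?H ((UNIV - F) \<inter> a) \<le> ?H (T n \<union> (\<Union>k. D (k + n)))"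
        by (rule codim1_hausdorff_mono)
      also have "\<dots> \<le> ?H (T n) + ?H (\<Union>k. D (k + n))"
        by (rule codim1_hausdorff_Un_le)
      also have "\<dots> \<le> ?H (T n) + (\<Sum>k. ?H (D (k + n)))"
        by (intro add_left_mono codim1_hausdorff_UN_le)
      finally show ?thesis .
    qed
    have bound: "?H (F \<inter> a) + ?H ((UNIV - F) \<inter> a) \<le> ?H a + (\<Sum>k. ?H (D (k + n)))" for n
    proof -
      have "?H (F \<inter> a) + ?H ((UNIV - F) \<inter> a) \<le> (?H (F \<inter> a) + ?H (T n)) + (\<Sum>k. ?H (D (k + n)))"
        using add_left_mono[OF split] by (simp add: add.assoc)
      also have "\<dots> \<le> ?H a + (\<Sum>k. ?H (D (k + n)))"
        by (intro add_right_mono T)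
      finally show ?thesis .
    qed
    have "(\<lambda>n. ?H a + (\<Sum>k. ?H (D (k + n)))) \<longlonglongrightarrow> ?H a + 0"
      by (intro tendsto_intros tail)
    then show ?thesis
      using bound by (intro LIMSEQ_le_const[where X = "\<lambda>n. ?H a + (\<Sum>k. ?H (D (k + n)))"]) auto
  qed
  have "?H (F \<inter> a) + ?H ((UNIV - F) \<inter> a) = ?H a" for a
  proof (rule antisym)
    show "?H (F \<inter> a) + ?H ((UNIV - F) \<inter> a) \<le> ?H a"
      using main[of a] by (cases "F = {}"; cases "?H a = top") (auto simp: less_top)
    have "a = F \<inter> a \<union> (UNIV - F) \<inter> a" by blast
    then show "?H a \<le> ?H (F \<inter> a) + ?H ((UNIV - F) \<inter> a)"
      using codim1_hausdorff_Un_le[of M "F \<inter> a" "(UNIV - F) \<inter> a"] by simp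
  qed
  then show ?thesis
    by (simp add: lambda_system_def)
qed

lemma measure_space_codim1_hausdorff: "measure_space UNIV (sets borel) (codim1_hausdorff M)"
proof -
  interpret sigma_algebra "UNIV :: 'a set" "UNIV :: 'a set set"
    using sigma_algebra_Pow[of "UNIV :: 'a set"] by simp
  have ms: "measure_space UNIV (lambda_system UNIV UNIV (codim1_hausdorff M)) (codim1_hausdorff M)"
    by (rule caratheodory_lemma[OF outer_measure_space_codim1_hausdorff])
  then interpret L: sigma_algebra UNIV "lambda_system UNIV UNIV (codim1_hausdorff M)"
    by (simp add: measure_space_def)
  have "sets (borel :: 'a measure) = sigma_sets UNIV (Collect closed)"
    by (simp add: borel_eq_closed)
  also have "\<dots> \<subseteq> lambda_system UNIV UNIV (codim1_hausdorff M)"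
    by (rule L.sigma_sets_subset) (use closed_in_lambda_system_codim1_hausdorff in blast)
  finally have "sets (borel :: 'a measure) \<subseteq> lambda_system UNIV UNIV (codim1_hausdorff M)" .
  then show ?thesis
    using measure_down[OF ms] sets.sigma_algebra_axioms[of "borel :: 'a measure"] by simp
qed

lemma emeasure_boundary_measure:
  assumes "A \<in> sets borel" "A \<subseteq> frontier \<Omega>"
  shows "emeasure (boundary_measure M \<Omega>) A = codim1_hausdorff M A"
proof -
  have ms: "sigma_algebra UNIV (sets (borel :: 'a measure))"
    "positive (sets borel) (codim1_hausdorff M)" "countably_additive (sets borel) (codim1_hausdorff M)"
    using measure_space_codim1_hausdorff[of M] by (auto simp: measure_space_def)
  have sets: "sets (measure_of UNIV (sets borel) (codim1_hausdorff M)) = sets borel"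
    using sigma_algebra.sets_measure_of_eq[OF ms(1)] by blast
  have "emeasure (boundary_measure M \<Omega>) A = emeasure (measure_of UNIV (sets borel) (codim1_hausdorff M)) A"
    unfolding boundary_measure_def
    using assms borel_closed[OF frontier_closed, of \<Omega>] by (intro emeasure_restrict_space) (auto simp: sets)
  also have "\<dots> = codim1_hausdorff M A"
    using emeasure_measure_of_sigma[OF ms] assms by blast
  finally show ?thesis .
qed

definition codim1_ahlfors_regular_boundary :: "'a::metric_space measure \<Rightarrow> 'a set \<Rightarrow> bool" where
  "codim1_ahlfors_regular_boundary M \<Omega> \<longleftrightarrow>
     (\<exists>C::real. 1 \<le> C \<and>
       (\<forall>x\<in>frontier \<Omega>. \<forall>r. 0 < r \<and> r \<le> diameter \<Omega> \<longrightarrow>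
          ennreal (1 / C) * (emeasure M (ball x r) / ennreal r)
            \<le> codim1_hausdorff M (ball x r \<inter> frontier \<Omega>) \<and>
          codim1_hausdorff M (ball x r \<inter> frontier \<Omega>)
            \<le> ennreal C * (emeasure M (ball x r) / ennreal r)))"


section \<open>The Besov space on the boundary\<close>

text \<open>Elements of the Besov and BV spaces are represented by functions on the ambient space,
  of which only the values on \<^term>\<open>frontier \<Omega>\<close>, respectively on \<^term>\<open>\<Omega>\<close>, matter.\<close>

definition besov_norm :: "'a::metric_space measure \<Rightarrow> 'a set \<Rightarrow> real \<Rightarrow> ('a \<Rightarrow> real) \<Rightarrow> ennreal" where
  "besov_norm M \<Omega> R u =
     (\<integral>\<^sup>+x. ennreal \<bar>u x\<bar> \<partial>boundary_measure M \<Omega>) +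
     (\<integral>\<^sup>+t\<in>{0<..<R}.
        (\<integral>\<^sup>+x. (\<integral>\<^sup>+y\<in>ball x t. ennreal \<bar>u y - u x\<bar> \<partial>boundary_measure M \<Omega>)
                / codim1_hausdorff M (ball x t \<inter> frontier \<Omega>) \<partial>boundary_measure M \<Omega>)
        / ennreal t \<partial>lborel)"

definition besov_space :: "'a::metric_space measure \<Rightarrow> 'a set \<Rightarrow> real \<Rightarrow> ('a \<Rightarrow> real) set" where
  "besov_space M \<Omega> R = {u. integrable (boundary_measure M \<Omega>) u \<and> besov_norm M \<Omega> R u < \<infinity>}"


section \<open>Functions of bounded variation\<close>

definition curve_length :: "(real \<Rightarrow> 'a::metric_space) \<Rightarrow> real \<Rightarrow> real \<Rightarrow> ennreal" where
  "curve_length \<gamma> a b =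
     (SUP ts\<in>{ts. sorted ts \<and> set ts \<subseteq> {a..b}}.
        \<Sum>i<length ts - 1. ennreal (dist (\<gamma> (ts ! i)) (\<gamma> (ts ! Suc i))))"

definition rectifiable_curve :: "(real \<Rightarrow> 'a::metric_space) \<Rightarrow> bool" where
  "rectifiable_curve \<gamma> \<longleftrightarrow> path \<gamma> \<and> curve_length \<gamma> 0 1 < \<infinity>"

text \<open>The curve is constant between two parameters with the same accumulated length, so the
  choice made by \<^const>\<open>inv_into\<close> is immaterial.\<close>

definition arclength_param :: "(real \<Rightarrow> 'a::metric_space) \<Rightarrow> real \<Rightarrow> 'a" where
  "arclength_param \<gamma> s = \<gamma> (inv_into {0..1} (\<lambda>t. enn2real (curve_length \<gamma> 0 t)) s)"

definition curve_integral :: "('a::metric_space \<Rightarrow> ennreal) \<Rightarrow> (real \<Rightarrow> 'a) \<Rightarrow> ennreal" where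
  "curve_integral g \<gamma> =
     (\<integral>\<^sup>+s\<in>{0..enn2real (curve_length \<gamma> 0 1)}. g (arclength_param \<gamma> s) \<partial>lborel)"

text \<open>Upper gradients are only used for locally Lipschitz, hence real-valued, functions; the
  clause of the general definition about infinite values is therefore void.\<close>

definition upper_gradient :: "'a::metric_space set \<Rightarrow> ('a \<Rightarrow> real) \<Rightarrow> ('a \<Rightarrow> ennreal) \<Rightarrow> bool" where
  "upper_gradient U u g \<longleftrightarrow> g \<in> borel_measurable (restrict_space borel U) \<and>
     (\<forall>\<gamma>. rectifiable_curve \<gamma> \<and> path_image \<gamma> \<subseteq> U \<longrightarrow>
        ennreal \<bar>u (pathstart \<gamma>) - u (pathfinish \<gamma>)\<bar> \<le> curve_integral g \<gamma>)"

definition upper_gradient_energy :: "'a::metric_space measure \<Rightarrow> 'a set \<Rightarrow> ('a \<Rightarrow> real) \<Rightarrow> ennreal" where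
  "upper_gradient_energy M U u = (INF g\<in>{g. upper_gradient U u g}. \<integral>\<^sup>+x\<in>U. g x \<partial>M)"

definition locally_lipschitz_on :: "'a::metric_space set \<Rightarrow> ('a \<Rightarrow> real) \<Rightarrow> bool" where
  "locally_lipschitz_on U u \<longleftrightarrow> (\<forall>x\<in>U. \<exists>r>0. \<exists>L. L-lipschitz_on (ball x r \<inter> U) u)"

definition total_variation :: "'a::metric_space measure \<Rightarrow> 'a set \<Rightarrow> ('a \<Rightarrow> real) \<Rightarrow> ennreal" where
  "total_variation M U u =
     (INF v\<in>{v. (\<forall>i::nat. locally_lipschitz_on U (v i)) \<and>
                 (\<lambda>i. \<integral>\<^sup>+x\<in>U. ennreal \<bar>v i x - u x\<bar> \<partial>M) \<longlonglongrightarrow> 0}.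
        liminf (\<lambda>i. upper_gradient_energy M U (v i)))"

definition BV_norm :: "'a::metric_space measure \<Rightarrow> 'a set \<Rightarrow> ('a \<Rightarrow> real) \<Rightarrow> ennreal" where
  "BV_norm M \<Omega> u = (\<integral>\<^sup>+x\<in>\<Omega>. ennreal \<bar>u x\<bar> \<partial>M) + total_variation M \<Omega> u"

definition BV_space :: "'a::metric_space measure \<Rightarrow> 'a set \<Rightarrow> ('a \<Rightarrow> real) set" where
  "BV_space M \<Omega> = {u. set_integrable M \<Omega> u \<and> BV_norm M \<Omega> u < \<infinity>}"


section \<open>Traces and extension operators\<close>

definition has_trace :: "'a::metric_space measure \<Rightarrow> 'a set \<Rightarrow> ('a \<Rightarrow> real) \<Rightarrow> 'a \<Rightarrow> real \<Rightarrow> bool" where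
  "has_trace M \<Omega> u z c \<longleftrightarrow>
     Limsup (at_right 0)
       (\<lambda>r. (\<integral>\<^sup>+y\<in>ball z r \<inter> \<Omega>. ennreal \<bar>u y - c\<bar> \<partial>M) / emeasure M (ball z r \<inter> \<Omega>)) = 0"

text \<open>Both spaces consist of almost-everywhere classes of functions. On representatives, an
  operator has to respect these classes and to be linear up to null sets.\<close>

definition bounded_linear_besov_BV ::
  "'a::metric_space measure \<Rightarrow> 'a set \<Rightarrow> real \<Rightarrow> (('a \<Rightarrow> real) \<Rightarrow> ('a \<Rightarrow> real)) \<Rightarrow> bool" where
  "bounded_linear_besov_BV M \<Omega> R E \<longleftrightarrow>
     (\<forall>f\<in>besov_space M \<Omega> R. E f \<in> BV_space M \<Omega>) \<and>
     (\<forall>f\<in>besov_space M \<Omega> R. \<forall>g\<in>besov_space M \<Omega> R.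
        (AE z in boundary_measure M \<Omega>. f z = g z) \<longrightarrow> (AE x in M. x \<in> \<Omega> \<longrightarrow> E f x = E g x)) \<and>
     (\<forall>f\<in>besov_space M \<Omega> R. \<forall>g\<in>besov_space M \<Omega> R. \<forall>a b::real.
        AE x in M. x \<in> \<Omega> \<longrightarrow> E (\<lambda>z. a * f z + b * g z) x = a * E f x + b * E g x) \<and>
     (\<exists>C::real. \<forall>f\<in>besov_space M \<Omega> R. BV_norm M \<Omega> (E f) \<le> ennreal C * besov_norm M \<Omega> R f)"

end

theory Submission
  imports Defs
begin

text \<open>
  For \<open>s > 0\<close> let \<open>S\<^sub>s f\<close> be the weighted average of \<open>f\<close> over the boundary points within distance \<open>s\<close>.
  It is Lipschitz near the boundary, with a constant that depends on \<open>s\<close> and is proportional to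
  \<open>\<parallel>f\<parallel>\<close> in \<open>L\<^sup>1\<close>. Choose scales \<open>s\<^sub>0, s\<^sub>1, \<dots>\<close> that decrease very fast, and let the extension
  be the average at scale \<open>s\<^sub>k\<close> at distances from the boundary between about \<open>s\<^sub>k\<^sub>+\<^sub>2\<close> and \<open>s\<^sub>k\<^sub>+\<^sub>1\<close>, gluing
  consecutive averages with cutoffs. The Lipschitz constants at scale \<open>s\<^sub>k\<close> are paid for by the
  smallness of the layer in which they are used, and by codimension one regularity each gluing costs
  at most the \<open>L\<^sup>1\<close> oscillation of \<open>f\<close> at the scales \<open>s\<^sub>k\<close> and \<open>s\<^sub>k\<^sub>+\<^sub>1\<close>; the sum of these
  oscillations is bounded by the Besov norm. Summability also makes the oscillations at \<open>z\<close>
  tend to \<open>0\<close> for almost every \<open>z\<close>, which gives the trace without a differentiation theorem.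
\<close>

section \<open>Arc length and upper gradients\<close>

text \<open>The scales are chosen before any f is given. This works because the Lipschitz constant
  of an average is a number depending only on its scale, times the L^1 norm of f, and it is the
  reason why the operator is linear. The averages use a tent weight, so they are explicit quotients
  of integrals and no Whitney covering enters.

  Sparse scales still see enough of the Besov integral: each scale s owns the interval (2s, 4s),
  whose mass for dt/t is at least 1/2, and these intervals are disjoint.

  The total variation is a relaxation of the upper gradient energy. The extension is locally
  Lipschitz, hence its own approximating sequence, and it has an explicit continuous upper gradient.

  For the trace at z, a ball B(z,r) meets layers much thinner than r, where the oscillation of f at
  z gives no information. Their contribution is bounded by an integral over all of \<Omega> that
  carries the next scale as a factor, and that scale is chosen small against the measure of the part
  of B(z,r) inside \<Omega>.

  Measurability needs care as well: the type of points is not second countable, so joint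
  measurability of the distance rests on total boundedness of the boundary.\<close>

definition curve_sum :: "(real \<Rightarrow> 'a::metric_space) \<Rightarrow> real list \<Rightarrow> ennreal" where
  "curve_sum \<gamma> ts = (\<Sum>i<length ts - 1. ennreal (dist (\<gamma> (ts ! i)) (\<gamma> (ts ! Suc i))))"

lemma curve_length_eq_SUP:
  "curve_length \<gamma> a b = (SUP ts\<in>{ts. sorted ts \<and> set ts \<subseteq> {a..b}}. curve_sum \<gamma> ts)"
  by (simp add: curve_length_def curve_sum_def)

lemma curve_sum_le_curve_length:
  "sorted ts \<Longrightarrow> set ts \<subseteq> {a..b} \<Longrightarrow> curve_sum \<gamma> ts \<le> curve_length \<gamma> a b"
  unfolding curve_length_eq_SUP by (rule SUP_upper) simp

lemma curve_sum_append_ge: "curve_sum \<gamma> ts + curve_sum \<gamma> us \<le> curve_sum \<gamma> (ts @ us)"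
proof (cases "us = []")
  case False
  define f where "f i = ennreal (dist (\<gamma> ((ts @ us) ! i)) (\<gamma> ((ts @ us) ! Suc i)))" for i
  have "curve_sum \<gamma> ts = (\<Sum>i<length ts - 1. f i)"
    unfolding curve_sum_def f_def by (intro sum.cong refl) (auto simp: nth_append)
  moreover have "curve_sum \<gamma> us = (\<Sum>i<length us - 1. f (i + length ts))"
    unfolding curve_sum_def f_def by (intro sum.cong refl) (auto simp: nth_append)
  moreover have "(\<Sum>i<length us - 1. f (i + length ts))
      = (\<Sum>i\<in>{length ts..<length us - 1 + length ts}. f i)"
    using sum.shift_bounds_nat_ivl[of f 0 "length ts" "length us - 1"]
    by (simp add: atLeast0LessThan)
  moreover have "(\<Sum>i<length ts - 1. f i) + (\<Sum>i\<in>{length ts..<length us - 1 + length ts}. f i)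
      = sum f ({..<length ts - 1} \<union> {length ts..<length us - 1 + length ts})"
    by (rule sum.union_disjoint[symmetric]) auto
  moreover have "sum f ({..<length ts - 1} \<union> {length ts..<length us - 1 + length ts})
      \<le> sum f {..<length (ts @ us) - 1}"
    by (rule sum_mono2) (use False in \<open>auto simp: neq_Nil_conv\<close>)
  ultimately show ?thesis
    unfolding curve_sum_def f_def by simp
qed (simp add: curve_sum_def)

lemma curve_length_superadditive:
  assumes "a \<le> b" "b \<le> c"
  shows "curve_length \<gamma> a b + curve_length \<gamma> b c \<le> curve_length \<gamma> a c"
proof -
  let ?S = "\<lambda>a b. {ts. sorted ts \<and> set ts \<subseteq> {a..b::real}}"
  have ne: "{ts. sorted ts \<and> set ts \<subseteq> {a..b::real}} \<noteq> {}" for a b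
    by (auto intro!: exI[of _ "[]"])
  have "curve_sum \<gamma> ts + curve_sum \<gamma> us \<le> curve_length \<gamma> a c" if "ts \<in> ?S a b" "us \<in> ?S b c" for ts us
  proof -
    have "sorted (ts @ us)"
      using that by (fastforce simp: sorted_append)
    moreover have "set (ts @ us) \<subseteq> {a..c}"
      using that assms by force
    ultimately show ?thesis
      using curve_sum_append_ge curve_sum_le_curve_length order_trans by blast
  qed
  then have "(SUP us\<in>?S b c. curve_sum \<gamma> ts + curve_sum \<gamma> us) \<le> curve_length \<gamma> a c" if "ts \<in> ?S a b" for ts
    using that by (intro SUP_least) simp
  moreover have "curve_sum \<gamma> ts + curve_length \<gamma> b c = (SUP us\<in>?S b c. curve_sum \<gamma> ts + curve_sum \<gamma> us)" for ts
    unfolding curve_length_eq_SUP[of \<gamma> b c] by (rule ennreal_SUP_add_right[OF ne])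
  ultimately have "curve_sum \<gamma> ts + curve_length \<gamma> b c \<le> curve_length \<gamma> a c" if "ts \<in> ?S a b" for ts
    using that by simp
  then have "(SUP ts\<in>?S a b. curve_sum \<gamma> ts + curve_length \<gamma> b c) \<le> curve_length \<gamma> a c"
    by (intro SUP_least) simp
  moreover have "(SUP ts\<in>?S a b. curve_sum \<gamma> ts + curve_length \<gamma> b c) = curve_length \<gamma> a b + curve_length \<gamma> b c"
    unfolding curve_length_eq_SUP[of \<gamma> a b] by (rule ennreal_SUP_add_left[OF ne])
  ultimately show ?thesis
    by simp
qed

lemma sorted_map_mono: "mono f \<Longrightarrow> sorted ts \<Longrightarrow> sorted (map f ts)"
  by (auto simp: sorted_iff_nth_mono monoD)

lemma mono_min_max: "mono (min (c::real))" "mono (max c)"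
  by (auto simp: mono_def min_def max_def)

text \<open>Clamping a partition at \<open>b\<close> from above and from below gives partitions of
  the two halves. A segment on one side of \<open>b\<close> has one degenerate clamped copy; a
  segment across \<open>b\<close> is cut there and the triangle inequality applies.\<close>

lemma curve_length_subadditive:
  assumes "a \<le> b" "b \<le> c"
  shows "curve_length \<gamma> a c \<le> curve_length \<gamma> a b + curve_length \<gamma> b c"
  unfolding curve_length_eq_SUP[of \<gamma> a c]
proof (rule SUP_least, clarify)
  fix ts assume ts: "sorted ts" "set ts \<subseteq> {a..c}"
  have "curve_sum \<gamma> ts \<le> curve_sum \<gamma> (map (min b) ts) + curve_sum \<gamma> (map (max b) ts)"
    unfolding curve_sum_def length_map sum.distrib[symmetric]
  proof (rule sum_mono)
    fix i assume i: "i \<in> {..<length ts - 1}"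
    then have "ts ! i \<le> ts ! Suc i"
      using ts(1) by (auto intro: sorted_nth_mono)
    then have "dist (\<gamma> (ts ! i)) (\<gamma> (ts ! Suc i)) \<le> dist (\<gamma> (min b (ts ! i))) (\<gamma> (min b (ts ! Suc i)))
        + dist (\<gamma> (max b (ts ! i))) (\<gamma> (max b (ts ! Suc i)))"
      by (auto simp: min_def max_def dist_triangle)
    then show "ennreal (dist (\<gamma> (ts ! i)) (\<gamma> (ts ! Suc i)))
        \<le> ennreal (dist (\<gamma> (map (min b) ts ! i)) (\<gamma> (map (min b) ts ! Suc i)))
          + ennreal (dist (\<gamma> (map (max b) ts ! i)) (\<gamma> (map (max b) ts ! Suc i)))"
      using i by (auto simp: ennreal_plus[symmetric] simp del: ennreal_plus intro!: ennreal_leI)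
  qed
  also have "\<dots> \<le> curve_length \<gamma> a b + curve_length \<gamma> b c"
  proof (intro add_mono curve_sum_le_curve_length)
    show "sorted (map (min b) ts)" "sorted (map (max b) ts)"
      using ts(1) by (simp_all add: sorted_map_mono mono_min_max)
    show "set (map (min b) ts) \<subseteq> {a..b}" "set (map (max b) ts) \<subseteq> {b..c}"
      using ts(2) assms by auto
  qed
  finally show "curve_sum \<gamma> ts \<le> curve_length \<gamma> a b + curve_length \<gamma> b c" .
qed

lemma dist_le_curve_length:
  assumes "a \<le> b"
  shows "ennreal (dist (\<gamma> a) (\<gamma> b)) \<le> curve_length \<gamma> a b"
  using curve_sum_le_curve_length[of "[a, b]" a b \<gamma>] assms by (simp add: curve_sum_def)

lemma tendsto_curve_sum_map:
  assumes "path \<gamma>" "set ts \<subseteq> {0..1}" "t \<in> {0..1}"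
    and h: "\<And>u. continuous_on UNIV (\<lambda>s. h s u)" "\<And>s u. s \<in> {0..1} \<Longrightarrow> u \<in> {0..1} \<Longrightarrow> h s u \<in> {0..1}"
  shows "((\<lambda>s. curve_sum \<gamma> (map (h s) ts)) \<longlongrightarrow> curve_sum \<gamma> (map (h t) ts)) (at t within {0..1})"
proof -
  have g: "((\<lambda>s. \<gamma> (h s u)) \<longlongrightarrow> \<gamma> (h t u)) (at t within {0..1})" if "u \<in> {0..1}" for u
  proof -
    have "continuous_on {0..1} (\<lambda>s. \<gamma> (h s u))"
      by (rule continuous_on_compose2[of "{0..1}" \<gamma>])
        (use assms(1) that h in \<open>auto simp: path_def intro: continuous_on_subset\<close>)
    then show ?thesis
      using assms(3) by (auto simp: continuous_on_def)
  qed
  have "((\<lambda>s. \<Sum>i<length ts - 1. ennreal (dist (\<gamma> (h s (ts ! i))) (\<gamma> (h s (ts ! Suc i)))))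
     \<longlongrightarrow> (\<Sum>i<length ts - 1. ennreal (dist (\<gamma> (h t (ts ! i))) (\<gamma> (h t (ts ! Suc i)))))) (at t within {0..1})"
  proof (intro tendsto_sum tendsto_ennrealI tendsto_dist g)
    fix i assume "i \<in> {..<length ts - 1}"
    then have "i < length ts" "Suc i < length ts" by auto
    then show "ts ! i \<in> {0..1}" "ts ! Suc i \<in> {0..1}"
      using assms(2) nth_mem by blast+
  qed
  then show ?thesis
    by (simp add: curve_sum_def)
qed

text \<open>A partition that nearly exhausts the length for the endpoint \<open>t\<close>, clamped
  at \<open>s\<close>, is a partition for the endpoint \<open>s\<close>, and its sum is continuous
  in \<open>s\<close>. The version for the remaining piece later provides upper semicontinuity of
  \<open>len\<close>.\<close>

lemma curve_length_lower_semicontinuous: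
  assumes "path \<gamma>" "t \<in> {0..1}"
  shows "y < curve_length \<gamma> 0 t \<Longrightarrow> \<forall>\<^sub>F s in at t within {0..1}. y < curve_length \<gamma> 0 s"
    and "y < curve_length \<gamma> t 1 \<Longrightarrow> \<forall>\<^sub>F s in at t within {0..1}. y < curve_length \<gamma> s 1"
proof -
  have ev: "\<forall>\<^sub>F s in at t within {0..1}. s \<in> {0..1}"
    by (simp add: eventually_at_filter)
  show "\<forall>\<^sub>F s in at t within {0..1}. y < curve_length \<gamma> 0 s" if "y < curve_length \<gamma> 0 t"
  proof -
    from that obtain ts where ts: "sorted ts" "set ts \<subseteq> {0..t}" "y < curve_sum \<gamma> ts"
      unfolding curve_length_eq_SUP by (auto simp: less_SUP_iff)
    have eq: "map (min t) ts = ts"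
      using ts(2) by (intro map_idI) auto
    have "((\<lambda>s. curve_sum \<gamma> (map (min s) ts)) \<longlongrightarrow> curve_sum \<gamma> (map (min t) ts)) (at t within {0..1})"
      by (rule tendsto_curve_sum_map) (use assms ts in \<open>auto intro!: continuous_intros\<close>)
    then have "\<forall>\<^sub>F s in at t within {0..1}. y < curve_sum \<gamma> (map (min s) ts)"
      by (rule order_tendstoD) (use ts(3) eq in simp)
    with ev show ?thesis
    proof eventually_elim
      case (elim s)
      have "curve_sum \<gamma> (map (min s) ts) \<le> curve_length \<gamma> 0 s"
        by (rule curve_sum_le_curve_length)
          (use ts elim in \<open>auto intro!: sorted_map_mono mono_min_max\<close>)
      with elim show ?case by simp
    qed
  qed
  show "\<forall>\<^sub>F s in at t within {0..1}. y < curve_length \<gamma> s 1" if "y < curve_length \<gamma> t 1"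
  proof -
    from that obtain ts where ts: "sorted ts" "set ts \<subseteq> {t..1}" "y < curve_sum \<gamma> ts"
      unfolding curve_length_eq_SUP by (auto simp: less_SUP_iff)
    have eq: "map (max t) ts = ts"
      using ts(2) by (intro map_idI) auto
    have "((\<lambda>s. curve_sum \<gamma> (map (max s) ts)) \<longlongrightarrow> curve_sum \<gamma> (map (max t) ts)) (at t within {0..1})"
      by (rule tendsto_curve_sum_map) (use assms ts in \<open>auto intro!: continuous_intros\<close>)
    then have "\<forall>\<^sub>F s in at t within {0..1}. y < curve_sum \<gamma> (map (max s) ts)"
      by (rule order_tendstoD) (use ts(3) eq in simp)
    with ev show ?thesis
    proof eventually_elim
      case (elim s)
      have "curve_sum \<gamma> (map (max s) ts) \<le> curve_length \<gamma> s 1"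
        by (rule curve_sum_le_curve_length)
          (use ts elim in \<open>auto intro!: sorted_map_mono mono_min_max\<close>)
      with elim show ?case by simp
    qed
  qed
qed

section \<open>Arc length parametrisation of a rectifiable curve\<close>

locale rectifiable =
  fixes \<gamma> :: "real \<Rightarrow> 'a::metric_space"
  assumes rect: "rectifiable_curve \<gamma>"
begin

definition len :: "real \<Rightarrow> real" where
  "len t = enn2real (curve_length \<gamma> 0 t)"

lemma path: "path \<gamma>"
  using rect by (simp add: rectifiable_curve_def)

lemma curve_length_finite: "0 \<le> a \<Longrightarrow> a \<le> b \<Longrightarrow> b \<le> 1 \<Longrightarrow> curve_length \<gamma> a b < top"
proof -
  assume ab: "0 \<le> a" "a \<le> b" "b \<le> 1"
  have "curve_length \<gamma> a b \<le> curve_length \<gamma> 0 1"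
    unfolding curve_length_eq_SUP by (rule SUP_subset_mono) (use ab in auto)
  with rect show ?thesis
    by (auto simp: rectifiable_curve_def)
qed

lemma ennreal_len: "t \<in> {0..1} \<Longrightarrow> ennreal (len t) = curve_length \<gamma> 0 t"
  unfolding len_def using curve_length_finite[of 0 t] by simp

lemma len_nonneg: "0 \<le> len t"
  by (simp add: len_def)

lemma curve_length_split:
  "0 \<le> s \<Longrightarrow> s \<le> t \<Longrightarrow> t \<le> 1 \<Longrightarrow> curve_length \<gamma> 0 t = curve_length \<gamma> 0 s + curve_length \<gamma> s t"
  by (intro antisym curve_length_superadditive curve_length_subadditive) auto

lemma dist_le_len_diff:
  assumes "0 \<le> s" "s \<le> t" "t \<le> 1"
  shows "dist (\<gamma> s) (\<gamma> t) \<le> len t - len s"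
proof -
  have "ennreal (len s + dist (\<gamma> s) (\<gamma> t)) = ennreal (len s) + ennreal (dist (\<gamma> s) (\<gamma> t))"
    by (simp add: len_nonneg)
  also have "\<dots> \<le> curve_length \<gamma> 0 s + curve_length \<gamma> s t"
    using assms by (intro add_mono dist_le_curve_length) (auto simp: ennreal_len)
  also have "\<dots> = ennreal (len t)"
    using assms curve_length_split[of s t] by (simp add: ennreal_len)
  finally have "len s + dist (\<gamma> s) (\<gamma> t) \<le> len t"
    by (simp only: ennreal_le_iff[OF len_nonneg])
  then show ?thesis
    by simp
qed

lemma dist_le_abs_len_diff:
  "s \<in> {0..1} \<Longrightarrow> t \<in> {0..1} \<Longrightarrow> dist (\<gamma> s) (\<gamma> t) \<le> \<bar>len s - len t\<bar>"
  using dist_le_len_diff[of s t] dist_le_len_diff[of t s] by (cases "s \<le> t") (auto simp: dist_commute)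

text \<open>Lower semicontinuity of the initial piece bounds \<open>len\<close> from below; that of
  the remaining piece, of length \<open>len 1 - len s\<close>, bounds it from above. Continuity
  makes \<open>len\<close> surjective onto \<open>{0..len 1}\<close>, so that
  \<open>inv_into\<close> in the arc length parametrisation meets a preimage for every
  parameter.\<close>

lemma continuous_len: "continuous_on {0..1} len"
  unfolding continuous_on_def
proof (intro ballI order_tendstoI)
  fix t :: real assume t: "t \<in> {0..1}"
  have ev: "\<forall>\<^sub>F s in at t within {0..1}. s \<in> {0..1}"
    by (simp add: eventually_at_filter)
  show "\<forall>\<^sub>F s in at t within {0..1}. y < len s" if "y < len t" for y
  \<comment> \<open>\<open>ennreal\<close> truncates negative numbers to 0, so they are treated
    apart.\<close>
  proof (cases "y < 0")
    case True
    then show ?thesis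
      using len_nonneg by (auto intro: always_eventually less_le_trans)
  next
    case False
    then have "ennreal y < curve_length \<gamma> 0 t"
      using that t by (simp add: ennreal_len[symmetric] ennreal_lessI)
    from curve_length_lower_semicontinuous(1)[OF path t this] ev show ?thesis
      by eventually_elim (use False in \<open>simp add: ennreal_len[symmetric] ennreal_less_iff\<close>)
  qed
  define r where "r s = len 1 - len s" for s
  have r: "ennreal (r s) = curve_length \<gamma> s 1" "0 \<le> r s" if "s \<in> {0..1}" for s
  proof -
    show *: "0 \<le> r s"
      using order_trans[OF zero_le_dist dist_le_len_diff[of s 1]] that by (simp add: r_def)
    have "ennreal (len s) + ennreal (r s) = ennreal (len 1)"
      using * len_nonneg by (simp add: r_def flip: ennreal_plus)
    also have "\<dots> = curve_length \<gamma> 0 1"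
      by (rule ennreal_len) simp
    also have "\<dots> = ennreal (len s) + curve_length \<gamma> s 1"
      using curve_length_split[of s 1] that by (simp only: ennreal_len atLeastAtMost_iff)
    finally show "ennreal (r s) = curve_length \<gamma> s 1"
      by (simp add: ennreal_add_left_cancel)
  qed
  show "\<forall>\<^sub>F s in at t within {0..1}. len s < y" if "len t < y" for y
  proof (cases "len 1 - y < 0")
    case True
    have "len s < y" if "s \<in> {0..1}" for s
      using r(2)[OF that] True by (simp add: r_def)
    with ev show ?thesis
      by (auto elim: eventually_mono)
  next
    case False
    then have "ennreal (len 1 - y) < curve_length \<gamma> t 1"
      using that t by (simp add: r(1)[symmetric] ennreal_lessI r_def)
    from curve_length_lower_semicontinuous(2)[OF path t this] ev show ?thesis
    proof eventually_elim
      case (elim s)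
      then have "len 1 - y < r s"
        using False by (simp add: r(1)[symmetric] ennreal_less_iff)
      then show ?case by (simp add: r_def)
    qed
  qed
qed

lemma len_image: "len ` {0..1} = {0..len 1}"
proof
  have "len s \<le> len 1" if "s \<in> {0..1}" for s
    using order_trans[OF zero_le_dist dist_le_len_diff[of s 1]] that by simp
  then show "len ` {0..1} \<subseteq> {0..len 1}"
    by (auto simp: len_nonneg)
  have len0: "len 0 = 0"
  proof -
    have "curve_length \<gamma> 0 0 \<le> 0"
      unfolding curve_length_eq_SUP
    proof (rule SUP_least, clarify)
      fix ts :: "real list" assume ts: "set ts \<subseteq> {0..0}"
      have "ts ! i = 0" if "i < length ts" for i
        using ts nth_mem[OF that] by auto
      then show "curve_sum \<gamma> ts \<le> 0"
        by (auto simp: curve_sum_def intro!: sum.neutral)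
    qed
    then show ?thesis by (simp add: len_def)
  qed
  show "{0..len 1} \<subseteq> len ` {0..1}"
    using IVT'[of len 0 _ 1] continuous_len len0 by force
qed

lemma arclength_param_len:
  assumes "t \<in> {0..1}"
  shows "arclength_param \<gamma> (len t) = \<gamma> t"
proof -
  define t' where "t' = inv_into {0..1} len (len t)"
  have "t' \<in> {0..1}" "len t' = len t"
    unfolding t'_def using assms by (auto intro: inv_into_into f_inv_into_f simp del: atLeastAtMost_iff)
  then have "dist (\<gamma> t') (\<gamma> t) \<le> 0"
    using dist_le_abs_len_diff[of t' t] assms by simp
  then show ?thesis
    unfolding arclength_param_def t'_def len_def[abs_def] by simp
qed

lemma arclength_param_lipschitz: "1-lipschitz_on {0..len 1} (arclength_param \<gamma>)"
proof (rule lipschitz_onI)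
  fix a b assume "a \<in> {0..len 1}" "b \<in> {0..len 1}"
  then obtain s t where "s \<in> {0..1}" "a = len s" "t \<in> {0..1}" "b = len t"
    unfolding len_image[symmetric] by blast
  then show "dist (arclength_param \<gamma> a) (arclength_param \<gamma> b) \<le> 1 * dist a b"
    using dist_le_abs_len_diff[of s t] by (simp add: arclength_param_len dist_real_def)
qed simp

lemma arclength_param_image: "arclength_param \<gamma> ` {0..len 1} = path_image \<gamma>"
  unfolding len_image[symmetric] path_image_def image_image
  by (rule image_cong) (auto simp: arclength_param_len)

lemma arclength_param_ends:
  "arclength_param \<gamma> 0 = pathstart \<gamma>" "arclength_param \<gamma> (len 1) = pathfinish \<gamma>"
proof -
  have "0 \<in> len ` {0..1}"
    unfolding len_image by (simp add: len_nonneg)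
  then obtain t where t: "t \<in> {0..1}" "len t = 0"
    by auto
  have "dist (\<gamma> 0) (\<gamma> t) \<le> len t - len 0"
    using t by (intro dist_le_len_diff) auto
  also have "\<dots> \<le> 0"
    using t(2) len_nonneg[of 0] by simp
  finally have "\<gamma> 0 = \<gamma> t"
    by simp
  then show "arclength_param \<gamma> 0 = pathstart \<gamma>"
    using arclength_param_len[of t] t by (simp add: pathstart_def)
  show "arclength_param \<gamma> (len 1) = pathfinish \<gamma>"
    by (simp add: arclength_param_len pathfinish_def)
qed

end

text \<open>Along the 1-Lipschitz arc length parametrisation the pointwise bound becomes an estimate
  on short parameter intervals around each parameter, and bisection assembles these into one for the
  whole curve. Continuity of \<open>g\<close> turns its value at the tag into an integral, with an
  error of \<open>e\<close> per unit length.\<close>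

lemma upper_gradientI_continuous:
  fixes g :: "'a::metric_space \<Rightarrow> real"
  assumes g: "continuous_on U g" "\<And>x. x \<in> U \<Longrightarrow> 0 \<le> g x"
    and u: "\<And>x. x \<in> U \<Longrightarrow> \<exists>r>0. \<forall>y\<in>ball x r \<inter> U. \<bar>u y - u x\<bar> \<le> g x * dist x y"
  shows "upper_gradient U u (\<lambda>x. ennreal (g x))"
  unfolding upper_gradient_def
proof (intro conjI allI impI)
  show "(\<lambda>x. ennreal (g x)) \<in> borel_measurable (restrict_space borel U)"
    using borel_measurable_continuous_on_restrict[OF g(1)] by simp
  fix \<gamma> assume \<gamma>: "rectifiable_curve \<gamma> \<and> path_image \<gamma> \<subseteq> U"
  interpret rectifiable \<gamma>
    by standard (use \<gamma> in blast)
  define \<sigma> where "\<sigma> = arclength_param \<gamma>"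
  define L where "L = len 1"
  have L: "0 \<le> L"
    by (simp add: L_def len_nonneg)
  have \<sigma>U: "\<sigma> t \<in> U" if "t \<in> {0..L}" for t
    using that \<gamma> arclength_param_image by (auto simp: \<sigma>_def L_def)
  have \<sigma>lip: "dist (\<sigma> s) (\<sigma> t) \<le> \<bar>s - t\<bar>" if "s \<in> {0..L}" "t \<in> {0..L}" for s t
    using arclength_param_lipschitz that by (auto simp: lipschitz_on_def \<sigma>_def L_def dist_real_def)
  have cont: "continuous_on {0..L} (\<lambda>t. g (\<sigma> t))"
    by (rule continuous_on_compose2[OF g(1), of _ \<sigma>])
      (use \<sigma>U arclength_param_lipschitz in \<open>auto intro: lipschitz_on_continuous_on simp: \<sigma>_def L_def\<close>)
  define I where "I a b = integral {a..b} (\<lambda>t. g (\<sigma> t))" for a b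
  have main: "\<bar>u (\<sigma> L) - u (\<sigma> 0)\<bar> \<le> I 0 L + e * L" if e: "0 < e" for e
  proof -
    \<comment> \<open>\<open>P\<close> is additive over adjacent intervals and holds on short
      intervals around each parameter, as \<open>Bolzano\<close> demands. The range of
      \<open>a\<close> and \<open>b\<close> is a premise inside \<open>P\<close> because such
      intervals may stick out of \<open>{0..L}\<close>.\<close>
    define P where "P a b \<longleftrightarrow> (0 \<le> a \<and> b \<le> L \<longrightarrow> \<bar>u (\<sigma> b) - u (\<sigma> a)\<bar> \<le> I a b + e * (b - a))" for a b
    have "P 0 L"
    proof (rule Bolzano[of 0 L P])
      fix a b c assume P: "P a b" "P b c" and abc: "a \<le> b" "b \<le> c"
      show "P a c"
        unfolding P_def
      proof
        assume ac: "0 \<le> a \<and> c \<le> L"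
        have "I a b + I b c = I a c"
          unfolding I_def
          by (rule Henstock_Kurzweil_Integration.integral_combine)
            (use abc ac in \<open>auto intro!: integrable_continuous_interval continuous_on_subset[OF cont]\<close>)
        moreover have "\<bar>u (\<sigma> b) - u (\<sigma> a)\<bar> \<le> I a b + e * (b - a)" "\<bar>u (\<sigma> c) - u (\<sigma> b)\<bar> \<le> I b c + e * (c - b)"
          using P ac abc by (auto simp: P_def)
        ultimately show "\<bar>u (\<sigma> c) - u (\<sigma> a)\<bar> \<le> I a c + e * (c - a)"
          by (simp add: algebra_simps)
      qed
    next
      fix t assume t: "0 \<le> t" "t \<le> L"
      then obtain r where r: "0 < r" "\<forall>y\<in>ball (\<sigma> t) r \<inter> U. \<bar>u y - u (\<sigma> t)\<bar> \<le> g (\<sigma> t) * dist (\<sigma> t) y"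
        using u[OF \<sigma>U[of t]] by auto
      obtain d where d: "0 < d" "\<And>s. s \<in> {0..L} \<Longrightarrow> dist s t < d \<Longrightarrow> dist (g (\<sigma> s)) (g (\<sigma> t)) < e"
        using cont t e unfolding continuous_on_iff by (metis atLeastAtMost_iff)
      show "\<exists>d>0. \<forall>a b. a \<le> t \<and> t \<le> b \<and> b - a < d \<longrightarrow> P a b"
      proof (intro exI[of _ "min r d"] conjI allI impI)
        fix a b assume ab: "a \<le> t \<and> t \<le> b \<and> b - a < min r d"
        show "P a b"
          unfolding P_def
        proof
          assume *: "0 \<le> a \<and> b \<le> L"
          have near: "\<bar>u (\<sigma> s) - u (\<sigma> t)\<bar> \<le> g (\<sigma> t) * \<bar>s - t\<bar>" if s: "a \<le> s" "s \<le> b" for s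
          proof -
            have "dist (\<sigma> t) (\<sigma> s) \<le> \<bar>s - t\<bar>"
              using \<sigma>lip[of t s] s * t by (simp add: abs_minus_commute)
            moreover from this have "\<sigma> s \<in> ball (\<sigma> t) r \<inter> U"
              using \<sigma>U[of s] s * ab by auto
            ultimately show ?thesis
              using r(2) g(2)[OF \<sigma>U[of t]] t by (meson atLeastAtMost_iff mult_left_mono order_trans)
          qed
          \<comment> \<open>The tag \<open>t\<close> lies between \<open>a\<close> and
            \<open>b\<close>, so the two distances to it add up to exactly
            \<open>b - a\<close>.\<close>
          have "\<bar>u (\<sigma> b) - u (\<sigma> a)\<bar> \<le> g (\<sigma> t) * (b - a)"
            using near[of a] near[of b] ab by (auto simp: algebra_simps abs_le_iff)
          also have "\<dots> = integral {a..b} (\<lambda>s. g (\<sigma> t) - e) + e * (b - a)"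
            using ab by (simp add: algebra_simps)
          also have "integral {a..b} (\<lambda>s. g (\<sigma> t) - e) \<le> I a b"
            unfolding I_def
          proof (rule integral_le)
            show "(\<lambda>s. g (\<sigma> s)) integrable_on {a..b}"
              using * by (intro integrable_continuous_interval continuous_on_subset[OF cont]) auto
            show "g (\<sigma> t) - e \<le> g (\<sigma> s)" if "s \<in> {a..b}" for s
              using d(2)[of s] that * ab t by (auto simp: dist_real_def abs_less_iff)
          qed (rule integrable_const_ivl)
          finally show "\<bar>u (\<sigma> b) - u (\<sigma> a)\<bar> \<le> I a b + e * (b - a)" by simp
        qed
      qed (use r d in auto)
    qed (use L in auto)
    then show ?thesis by (simp add: P_def L)
  qed
  have "\<bar>u (\<sigma> L) - u (\<sigma> 0)\<bar> \<le> I 0 L"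
  proof (rule field_le_epsilon)
    fix e :: real assume "0 < e"
    \<comment> \<open>The divisor is \<open>L + 1\<close> because a constant curve has
      \<open>L = 0\<close>.\<close>
    then have "\<bar>u (\<sigma> L) - u (\<sigma> 0)\<bar> \<le> I 0 L + e / (L + 1) * L"
      using L by (intro main) auto
    also have "e / (L + 1) * L \<le> e"
      using L \<open>0 < e\<close> by (simp add: field_simps)
    finally show "\<bar>u (\<sigma> L) - u (\<sigma> 0)\<bar> \<le> I 0 L + e" by simp
  qed
  also have "ennreal (I 0 L) = (\<integral>\<^sup>+t\<in>{0..L}. ennreal (g (\<sigma> t)) \<partial>lborel)"
  proof -
    define h where "h t = (if t \<in> {0..L} then g (\<sigma> t) else 0)" for t
    have "h \<in> borel_measurable borel"
      unfolding h_def
      by (rule borel_measurable_continuous_on_if) (use cont in auto)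
    moreover have "(h has_integral I 0 L) UNIV"
      unfolding h_def I_def using cont
      by (subst has_integral_restrict_UNIV) (auto intro!: integrable_integral integrable_continuous_interval)
    moreover have "0 \<le> h t" for t
      using g(2)[OF \<sigma>U] by (auto simp: h_def)
    ultimately have "(\<integral>\<^sup>+t. ennreal (h t) \<partial>lborel) = ennreal (I 0 L)"
      by (intro nn_integral_has_integral_lborel) auto
    also have "(\<integral>\<^sup>+t. ennreal (h t) \<partial>lborel) = (\<integral>\<^sup>+t\<in>{0..L}. ennreal (g (\<sigma> t)) \<partial>lborel)"
      by (intro nn_integral_cong) (auto simp: h_def indicator_def)
    finally show ?thesis by simp
  qed
  finally have "ennreal \<bar>u (\<sigma> L) - u (\<sigma> 0)\<bar> \<le> (\<integral>\<^sup>+t\<in>{0..L}. ennreal (g (\<sigma> t)) \<partial>lborel)"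
    by (simp add: ennreal_leI)
  then show "ennreal \<bar>u (pathstart \<gamma>) - u (pathfinish \<gamma>)\<bar> \<le> curve_integral (\<lambda>x. ennreal (g x)) \<gamma>"
    using arclength_param_ends
    by (simp add: curve_integral_def \<sigma>_def L_def len_def abs_minus_commute)
qed

section \<open>Doubling measures\<close>

locale doubling_space =
  fixes M :: "'a::metric_space measure" and CD :: real
  assumes sets_M: "sets M = sets borel"
    and CD: "1 \<le> CD"
    and ball_pos: "0 < r \<Longrightarrow> 0 < emeasure M (ball x r)"
    and ball_finite: "emeasure M (ball x r) < \<infinity>"
    and ball_doubling: "0 < r \<Longrightarrow> emeasure M (ball x (2 * r)) \<le> ennreal CD * emeasure M (ball x r)"
begin

abbreviation V :: "'a \<Rightarrow> real \<Rightarrow> real" where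
  "V x r \<equiv> measure M (ball x r)"

lemma space_M [simp]: "space M = UNIV"
  using sets_eq_imp_space_eq[OF sets_M] by simp

lemma measurable_id_M: "(\<lambda>x. x) \<in> measurable M borel"
  by (simp add: measurable_def sets_M)

lemma emeasure_ball: "emeasure M (ball x r) = ennreal (V x r)"
  using ball_finite[of x r] by (intro emeasure_eq_ennreal_measure) auto

lemma V_pos: "0 < r \<Longrightarrow> 0 < V x r"
  using ball_pos[of r x] by (simp add: emeasure_ball)

lemma V_doubling: "0 < r \<Longrightarrow> V x (2 * r) \<le> CD * V x r"
  using ball_doubling[of r x] CD by (simp add: emeasure_ball flip: ennreal_mult)

lemma V_doubling_power: "0 < r \<Longrightarrow> V x (2 ^ n * r) \<le> CD ^ n * V x r"
proof (induction n)
  case (Suc n)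
  have "V x (2 ^ Suc n * r) \<le> CD * V x (2 ^ n * r)"
    using V_doubling[of "2 ^ n * r" x] Suc by (simp add: mult.assoc)
  also have "\<dots> \<le> CD * (CD ^ n * V x r)"
    using Suc CD by (intro mult_left_mono) auto
  finally show ?case by simp
qed simp

lemma V_mono: "ball x r \<subseteq> ball y s \<Longrightarrow> V x r \<le> V y s"
  using ball_finite[of y s] by (intro measure_mono_fmeasurable) (auto simp: sets_M fmeasurable_def)

lemma V_compare:
  assumes "0 < s" "dist x y + r \<le> 2 ^ n * s"
  shows "V x r \<le> CD ^ n * V y s"
proof -
  have "ball x r \<subseteq> ball y (2 ^ n * s)"
    using assms(2) by (auto simp: subset_eq) (metis dist_commute dist_triangle add_strict_left_mono order_less_le_trans order_le_less_trans)
  then have "V x r \<le> V y (2 ^ n * s)"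
    by (rule V_mono)
  also have "\<dots> \<le> CD ^ n * V y s"
    by (rule V_doubling_power) fact
  finally show ?thesis .
qed

section \<open>Total boundedness and separability of bounded sets\<close>

lemma V_lower_bound:
  assumes "bounded A" "0 < r"
  obtains c where "0 < c" "\<And>x. x \<in> A \<Longrightarrow> c \<le> V x r"
proof (cases "A = {}")
  case False
  then obtain a where a: "a \<in> A" by blast
  obtain K where K: "\<And>x. x \<in> A \<Longrightarrow> dist a x \<le> K"
    using bounded_any_center[of A a] assms(1) by blast
  obtain n where n: "(K + r) / r < 2 ^ n"
    using real_arch_pow[of 2] by auto
  show ?thesis
  proof (rule that)
    show "0 < V a r / CD ^ n"
      using V_pos[OF assms(2)] CD by simp
    show "V a r / CD ^ n \<le> V x r" if "x \<in> A" for x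
      using V_compare[of r a x r n] K[OF that] n assms(2) CD by (simp add: field_simps)
  qed
qed (use that[of 1] in auto)

text \<open>A packing argument: the balls of radius \<open>r / 2\<close> around an
  \<open>r\<close>-separated set are disjoint, have mass at least \<open>c\<close> each and lie in
  one ball of finite mass, which bounds the number of points. A separated set of maximal size is a
  net.\<close>

lemma totally_bounded_if_bounded:
  fixes A :: "'a set"
  assumes "bounded A" "0 < r"
  obtains F where "finite F" "F \<subseteq> A" "A \<subseteq> (\<Union>x\<in>F. ball x r)"
proof (cases "A = {}")
  case False
  then obtain a where a: "a \<in> A" by blast
  obtain K where K: "\<And>x. x \<in> A \<Longrightarrow> dist a x \<le> K"
    using bounded_any_center[of A a] assms(1) by blast
  obtain c where c: "0 < c" "\<And>x. x \<in> A \<Longrightarrow> c \<le> V x (r / 2)"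
    using V_lower_bound[OF assms(1), of "r / 2"] assms(2) by auto
  define P where "P F \<longleftrightarrow> finite F \<and> F \<subseteq> A \<and> (\<forall>x\<in>F. \<forall>y\<in>F. x \<noteq> y \<longrightarrow> r \<le> dist x y)" for F
  have card_bound: "real (card F) * c \<le> V a (K + r)" if "P F" for F
  proof -
    have F: "finite F" "F \<subseteq> A" "\<And>x y. x \<in> F \<Longrightarrow> y \<in> F \<Longrightarrow> x \<noteq> y \<Longrightarrow> r \<le> dist x y"
      using that by (auto simp: P_def)
    have fm: "ball x s \<in> fmeasurable M" for x s
      using ball_finite[of x s] by (auto simp: fmeasurable_def sets_M)
    have "disjoint_family_on (\<lambda>x. ball x (r / 2)) F"
      unfolding disjoint_family_on_def
    proof (intro ballI impI)
      fix x y assume "x \<in> F" "y \<in> F" "x \<noteq> y"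
      then have "r \<le> dist x y"
        using F(3) by blast
      then show "ball x (r / 2) \<inter> ball y (r / 2) = {}"
        by (auto simp: disjoint_iff) (smt (verit) dist_commute dist_triangle field_sum_of_halves)
    qed
    have "real (card F) * c = (\<Sum>x\<in>F. c)"
      by simp
    also have "\<dots> \<le> (\<Sum>x\<in>F. V x (r / 2))"
      using F(2) c(2) by (intro sum_mono) auto
    also have "\<dots> = measure M (\<Union>x\<in>F. ball x (r / 2))"
      using \<open>disjoint_family_on _ F\<close> F(1) fm ball_finite
      by (intro measure_finite_Union[symmetric]) (auto simp: sets_M less_top)
    also have "\<dots> \<le> V a (K + r)"
    proof (rule measure_mono_fmeasurable)
      show "(\<Union>x\<in>F. ball x (r / 2)) \<subseteq> ball a (K + r)"
      proof
        fix y assume "y \<in> (\<Union>x\<in>F. ball x (r / 2))"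
        then obtain x where "x \<in> F" "dist x y < r / 2" by auto
        then show "y \<in> ball a (K + r)"
          using K[of x] F(2) dist_triangle[of a y x] assms(2) by auto
      qed
    qed (use fm in \<open>auto simp: sets_M intro!: borel_open\<close>)
    finally show ?thesis .
  qed
  obtain N :: nat where N: "V a (K + r) / c < real N"
    using reals_Archimedean2 by blast
  have "card F < N" if "P F" for F
  proof -
    have "real (card F) \<le> V a (K + r) / c"
      using card_bound[OF that] c(1) by (simp add: field_simps)
    with N show ?thesis by linarith
  qed
  moreover have "P {}"
    by (simp add: P_def)
  ultimately obtain F where F: "P F" "\<And>G. P G \<Longrightarrow> card G \<le> card F"
    using ex_has_greatest_nat[of P "{}" card N] by (metis less_imp_le)
  show ?thesis
  proof (rule that)
    show "finite F" "F \<subseteq> A"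
      using F(1) by (auto simp: P_def)
    show "A \<subseteq> (\<Union>x\<in>F. ball x r)"
    proof (rule ccontr)
      assume "\<not> A \<subseteq> (\<Union>x\<in>F. ball x r)"
      then obtain y where y: "y \<in> A" "\<And>x. x \<in> F \<Longrightarrow> r \<le> dist x y"
        by (auto simp: subset_eq not_less)
      then have "y \<notin> F"
        using assms(2) by force
      moreover have "P (insert y F)"
        using F(1) y by (auto simp: P_def dist_commute)
      then have "card (insert y F) \<le> card F"
        by (rule F(2))
      ultimately show False
        using F(1) by (simp add: P_def)
    qed
  qed
qed (use that[of "{}"] in auto)

text \<open>Supplies the countable dense subset of the boundary on which
  \<open>measurable_dist\<close> rests.\<close>

lemma separable_if_bounded:
  fixes A :: "'a set"
  assumes "bounded A"
  obtains D where "countable D" "D \<subseteq> A" "\<And>x e. x \<in> A \<Longrightarrow> 0 < e \<Longrightarrow> \<exists>q\<in>D. dist q x < e"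
proof -
  have "\<exists>F. finite F \<and> F \<subseteq> A \<and> A \<subseteq> (\<Union>x\<in>F. ball x (1 / real (Suc n)))" for n
    using totally_bounded_if_bounded[OF assms, of "1 / real (Suc n)"] by (metis of_nat_0_less_iff zero_less_Suc zero_less_divide_1_iff)
  then obtain F where F: "\<And>n. finite (F n)" "\<And>n. F n \<subseteq> A" "\<And>n. A \<subseteq> (\<Union>x\<in>F n. ball x (1 / real (Suc n)))"
    by metis
  show ?thesis
  proof (rule that)
    show "countable (\<Union>n. F n)"
      using F(1) by (auto intro: countable_finite)
    show "(\<Union>n. F n) \<subseteq> A"
      using F(2) by blast
    fix x and e :: real assume x: "x \<in> A" "0 < e"
    then obtain n where n: "1 / real (Suc n) < e"
      using nat_approx_posE by blast
    obtain q where "q \<in> F n" "dist q x < 1 / real (Suc n)"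
      using F(3)[of n] x(1) by auto
    with n show "\<exists>q\<in>(\<Union>n. F n). dist q x < e"
      by (meson UN_I UNIV_I less_trans)
  qed
qed

lemma sigma_finite_M: "sigma_finite_measure M"
proof
  fix a :: 'a
  have "\<exists>A. countable A \<and> A \<subseteq> sets M \<and> \<Union> A = space M \<and> (\<forall>a\<in>A. emeasure M a \<noteq> \<infinity>)"
  proof (intro exI[of _ "range (\<lambda>n. ball a (real n))"] conjI)
    show "\<Union> (range (\<lambda>n. ball a (real n))) = space M"
      using reals_Archimedean2 by auto
  qed (use ball_finite in \<open>auto simp: sets_M less_top\<close>)
  then show "\<exists>A. countable A \<and> A \<subseteq> sets M \<and> \<Union> A = space M \<and> (\<forall>a\<in>A. emeasure M a \<noteq> \<infinity>)" .
qed

end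

lemma doubling_measure_imp_doubling_space:
  assumes "doubling_measure M"
  obtains CD where "doubling_space M CD"
proof -
  obtain C :: real where C: "sets M = sets borel"
    "\<And>x r. 0 < r \<Longrightarrow> 0 < emeasure M (ball x (2 * r))"
    "\<And>x r. 0 < r \<Longrightarrow> emeasure M (ball x (2 * r)) \<le> ennreal C * emeasure M (ball x r)"
    "\<And>x r. 0 < r \<Longrightarrow> ennreal C * emeasure M (ball x r) < \<infinity>"
    using assms unfolding doubling_measure_def by blast
  have "doubling_space M (max 1 C)"
  proof
    fix x :: 'a and r :: real
    \<comment> \<open>At radius \<open>r / 2\<close> the right hand side of the doubling inequality
      is finite by hypothesis, and the left hand side is the ball of radius
      \<open>r\<close>.\<close>
    have fin: "emeasure M (ball x r) < \<infinity>" if "0 < r"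
      using C(3,4)[of "r / 2" x] that by (auto simp: less_top elim: order_le_less_trans)
    then show "emeasure M (ball x r) < \<infinity>"
      by (cases "0 < r") (auto simp: ball_empty)
    show "0 < emeasure M (ball x r)" if "0 < r"
      using C(2)[of "r / 2" x] that by simp
    show "emeasure M (ball x (2 * r)) \<le> ennreal (max 1 C) * emeasure M (ball x r)" if "0 < r"
      using C(3)[OF that, of x] by (rule order_trans) (auto intro!: mult_right_mono ennreal_leI)
  qed (use C in auto)
  then show ?thesis
    by (rule that)
qed

section \<open>Domains with codimension one regular boundary\<close>

text \<open>\<open>infdist\<close> to the empty set is 0, so \<delta> would measure nothing for an
  empty boundary; the theorem treats that case separately.\<close>

locale codim1_domain = doubling_space +
  fixes \<Omega> :: "'a set" and CA :: real
  assumes open_domain: "open \<Omega>" and domain_ne: "\<Omega> \<noteq> {}" and bounded_domain: "bounded \<Omega>"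
    and frontier_ne: "frontier \<Omega> \<noteq> {}"
    and CA: "1 \<le> CA"
    and regular: "x \<in> frontier \<Omega> \<Longrightarrow> 0 < r \<Longrightarrow> r \<le> diameter \<Omega> \<Longrightarrow>
        ennreal (1 / CA) * (emeasure M (ball x r) / ennreal r) \<le> codim1_hausdorff M (ball x r \<inter> frontier \<Omega>) \<and>
        codim1_hausdorff M (ball x r \<inter> frontier \<Omega>) \<le> ennreal CA * (emeasure M (ball x r) / ennreal r)"
begin

abbreviation bd :: "'a set" where "bd \<equiv> frontier \<Omega>"
abbreviation B :: "'a measure" where "B \<equiv> boundary_measure M \<Omega>"
abbreviation H :: "'a \<Rightarrow> real \<Rightarrow> real" where "H x r \<equiv> measure B (ball x r \<inter> bd)"
abbreviation \<delta> :: "'a \<Rightarrow> real" where "\<delta> x \<equiv> infdist x bd"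

definition layer :: "real \<Rightarrow> 'a set" where
  "layer r = {x\<in>\<Omega>. \<delta> x < r}"

lemma bounded_frontier_domain: "bounded bd"
  by (rule bounded_subset[OF bounded_closure[OF bounded_domain]]) (auto simp: frontier_def)

lemma domain_Int_frontier: "x \<in> \<Omega> \<Longrightarrow> x \<notin> bd"
  using open_domain by (simp add: frontier_def interior_open)

lemma \<delta>_pos: "x \<in> \<Omega> \<Longrightarrow> 0 < \<delta> x"
  using infdist_pos_not_in_closed[OF frontier_closed frontier_ne] domain_Int_frontier by blast

lemma \<delta>_less_iff: "\<delta> x < r \<longleftrightarrow> (\<exists>z\<in>bd. dist x z < r)"
  using infdist_le[of _ bd x] frontier_ne
  by (auto simp: infdist_notempty[OF frontier_ne] cINF_less_iff intro: order_le_less_trans)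

lemma \<delta>_triangle: "\<delta> x \<le> \<delta> y + dist x y"
  by (rule infdist_triangle)

text \<open>With diameter 0 the domain would be a single point, hence open and closed, with empty
  frontier.\<close>

lemma diameter_pos: "0 < diameter \<Omega>"
proof (rule ccontr)
  assume "\<not> 0 < diameter \<Omega>"
  then have "dist x y \<le> 0" if "x \<in> \<Omega>" "y \<in> \<Omega>" for x y
    using diameter_bounded_bound[OF bounded_domain that] by linarith
  then obtain a where "\<Omega> = {a}"
    using domain_ne by fastforce
  then have "frontier \<Omega> = {}"
    using open_domain by (simp add: frontier_def interior_open)
  with frontier_ne show False by blast
qed

lemma space_B [simp]: "space B = bd"
proof -
  have "sigma_algebra UNIV (sets (borel :: 'a measure))"
    using sets.sigma_algebra_axioms[of "borel :: 'a measure"] by simp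
  then show ?thesis
    by (simp add: boundary_measure_def space_restrict_space sigma_algebra.space_measure_of_eq)
qed

lemma sets_B: "sets B = sets (restrict_space borel bd)"
proof -
  have "sigma_algebra UNIV (sets (borel :: 'a measure))"
    using sets.sigma_algebra_axioms[of "borel :: 'a measure"] by simp
  then show ?thesis
    by (simp add: boundary_measure_def sets_restrict_space sigma_algebra.sets_measure_of_eq
        sigma_algebra.sigma_sets_eq)
qed

lemma measurable_id_B: "(\<lambda>x. x) \<in> measurable B borel"
  by (simp add: measurable_cong_sets[OF sets_B refl] measurable_restrict_space1)

lemma measurable_B_if_borel: "f \<in> measurable borel N \<Longrightarrow> f \<in> measurable B N"
  by (simp add: measurable_cong_sets[OF sets_B refl] measurable_restrict_space1)

lemma ball_in_sets_B [measurable]: "ball x r \<inter> bd \<in> sets B"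
  by (auto simp: sets_B sets_restrict_space)

lemma emeasure_B_ball: "emeasure B (ball x r \<inter> bd) = codim1_hausdorff M (ball x r \<inter> bd)"
  by (rule emeasure_boundary_measure) (auto intro!: borel_closed sets.Int)

text \<open>Finitely many balls centred on the boundary cover it, and upper regularity bounds each
  of them. The radius \<open>diameter \<Omega>\<close> is the largest to which regularity
  applies.\<close>

lemma finite_B: "finite_measure B"
proof
  obtain F where F: "finite F" "F \<subseteq> bd" "bd \<subseteq> (\<Union>x\<in>F. ball x (diameter \<Omega>))"
    using totally_bounded_if_bounded[OF bounded_frontier_domain diameter_pos] by blast
  have "emeasure B bd \<le> emeasure B (\<Union>x\<in>F. ball x (diameter \<Omega>) \<inter> bd)"
    using F by (intro emeasure_mono sets.finite_UN) auto
  also have "\<dots> \<le> (\<Sum>x\<in>F. emeasure B (ball x (diameter \<Omega>) \<inter> bd))"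
    using F by (intro emeasure_subadditive_finite) auto
  also have "\<dots> < \<infinity>"
  proof -
    have "emeasure B (ball x (diameter \<Omega>) \<inter> bd) < \<infinity>" if "x \<in> F" for x
    proof -
      have "emeasure B (ball x (diameter \<Omega>) \<inter> bd)
          \<le> ennreal CA * (emeasure M (ball x (diameter \<Omega>)) / ennreal (diameter \<Omega>))"
        using regular[of x "diameter \<Omega>"] diameter_pos that F(2) by (auto simp: emeasure_B_ball)
      also have "\<dots> = ennreal (CA * (V x (diameter \<Omega>) / diameter \<Omega>))"
        using CA diameter_pos by (simp add: emeasure_ball divide_ennreal flip: ennreal_mult)
      finally show ?thesis
        by (rule order_le_less_trans) simp
    qed
    then show ?thesis
      using F(1) by (simp add: less_top)
  qed
  finally show "emeasure B (space B) \<noteq> \<infinity>"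
    by simp
qed

sublocale B: finite_measure B
  by (rule finite_B)

sublocale M: sigma_finite_measure M
  by (rule sigma_finite_M)

sublocale MB: pair_sigma_finite M B ..

sublocale BB: pair_sigma_finite B B ..

section \<open>Volume of balls against their boundary measure\<close>

lemma V_le_H:
  assumes "x \<in> bd" "0 < r" "r \<le> diameter \<Omega>"
  shows "V x r \<le> CA * (r * H x r)"
proof -
  have "ennreal (1 / CA * (V x r / r)) = ennreal (1 / CA) * (emeasure M (ball x r) / ennreal r)"
    using assms(2) CA by (simp add: emeasure_ball divide_ennreal del: times_divide_eq_left flip: ennreal_mult)
  also have "\<dots> \<le> ennreal (H x r)"
    using regular[OF assms] by (simp flip: emeasure_B_ball B.emeasure_eq_measure)
  finally have "1 / CA * (V x r / r) \<le> H x r"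
    by simp
  then show ?thesis
    using assms(2) CA by (simp add: field_simps)
qed

lemma H_le_V:
  assumes "x \<in> bd" "0 < r" "r \<le> diameter \<Omega>"
  shows "r * H x r \<le> CA * V x r"
proof -
  have "ennreal (H x r) \<le> ennreal CA * (emeasure M (ball x r) / ennreal r)"
    using regular[OF assms] by (simp flip: emeasure_B_ball B.emeasure_eq_measure)
  also have "\<dots> = ennreal (CA * (V x r / r))"
    using assms(2) CA by (simp add: emeasure_ball divide_ennreal flip: ennreal_mult)
  finally have "H x r \<le> CA * (V x r / r)"
    using assms(2) CA by simp
  then show ?thesis
    using assms(2) by (simp add: field_simps)
qed

lemma H_pos:
  assumes "x \<in> bd" "0 < r"
  shows "0 < H x r"
proof -
  define s where "s = min r (diameter \<Omega>)"
  have s: "0 < s" "s \<le> r" "s \<le> diameter \<Omega>"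
    using assms(2) diameter_pos by (auto simp: s_def)
  have "0 < H x s"
  proof (rule ccontr)
    assume "\<not> 0 < H x s"
    then have "H x s = 0"
      by (simp add: less_le)
    with V_le_H[OF assms(1) s(1,3)] V_pos[OF s(1), of x] show False
      by simp
  qed
  also have "H x s \<le> H x r"
    using s(2) by (intro B.finite_measure_mono) auto
  finally show ?thesis .
qed

text \<open>Passing to volume and back costs \<open>CA\<close> twice, and the ratio 16 of the radii
  costs \<open>CD ^ 4\<close>. This ratio leads from \<open>s / 4\<close>, the radius on which the
  tent weight is bounded below, to \<open>4 * s\<close>, the radius that normalises
  \<open>osc\<close>.\<close>

definition CH :: real where
  "CH = CA * CD ^ 4 * CA"

lemma CH: "1 \<le> CH"
  unfolding CH_def using CA CD by (intro mult_ge1_I one_le_power) auto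

lemma H_doubling:
  assumes "x \<in> bd" "0 < r" "16 * r \<le> diameter \<Omega>"
  shows "H x (16 * r) \<le> CH * H x r"
proof -
  have "16 * r * H x (16 * r) \<le> CA * V x (16 * r)"
    using assms by (intro H_le_V) auto
  also have "\<dots> \<le> CA * (CD ^ 4 * V x r)"
    using V_doubling_power[OF assms(2), of x 4] CA by simp
  also have "\<dots> \<le> CA * (CD ^ 4 * (CA * (r * H x r)))"
    using V_le_H[of x r] assms CA CD by (intro mult_left_mono) auto
  also have "\<dots> = r * (CH * H x r)"
    by (simp add: CH_def)
  finally have "16 * H x (16 * r) \<le> CH * H x r"
    using assms(2) by (simp add: mult.assoc mult.left_commute[of 16])
  then show ?thesis
    using measure_nonneg[of B "ball x (16 * r) \<inter> bd"] by linarith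
qed

text \<open>Without second countability, continuity of \<open>dist\<close> on the product does not
  give measurability for the product of the Borel algebras. Here the second point lies on the
  separable boundary, so the distance is a countable infimum of sums of functions of one variable,
  over a dense set of intermediate points. Stated for \<open>N\<close>, it serves both
  \<open>M\<close> and \<open>B\<close>.\<close>

lemma measurable_dist:
  assumes id: "(\<lambda>x. x) \<in> measurable N borel"
  shows "(\<lambda>p. dist (fst p) (snd p)) \<in> borel_measurable (N \<Otimes>\<^sub>M B)"
proof -
  obtain D where D: "countable D" "D \<subseteq> bd" "\<And>x e. x \<in> bd \<Longrightarrow> 0 < e \<Longrightarrow> \<exists>q\<in>D. dist q x < e"
    using separable_if_bounded[OF bounded_frontier_domain] by blast
  have ne: "D \<noteq> {}"
    using D(3)[of _ 1] frontier_ne by auto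
  have d: "(\<lambda>x. dist x q) \<in> borel_measurable L" if "(\<lambda>x. x) \<in> measurable L borel" for L :: "'a measure" and q
    by (rule measurable_compose[OF that]) (intro borel_measurable_continuous_onI continuous_intros)
  have "(\<lambda>p. INF q\<in>D. dist (fst p) q + dist (snd p) q) \<in> borel_measurable (N \<Otimes>\<^sub>M B)"
    using D(1) by (intro borel_measurable_cINF_real borel_measurable_add
        measurable_compose[OF measurable_fst d[OF id]] measurable_compose[OF measurable_snd d[OF measurable_id_B]])
  moreover have "(INF q\<in>D. dist (fst p) q + dist (snd p) q) = dist (fst p) (snd p)"
    if "p \<in> space (N \<Otimes>\<^sub>M B)" for p
  proof (rule antisym)
    have "snd p \<in> bd"
      using that by (auto simp: space_pair_measure)
    show "(INF q\<in>D. dist (fst p) q + dist (snd p) q) \<le> dist (fst p) (snd p)"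
    proof (rule field_le_epsilon)
      fix e :: real assume "0 < e"
      then obtain q where q: "q \<in> D" "dist q (snd p) < e / 2"
        using D(3)[OF \<open>snd p \<in> bd\<close>, of "e / 2"] by auto
      have "(INF q\<in>D. dist (fst p) q + dist (snd p) q) \<le> dist (fst p) q + dist (snd p) q"
        by (rule cINF_lower[OF _ q(1)]) (auto intro!: bdd_belowI[of _ 0])
      also have "\<dots> \<le> dist (fst p) (snd p) + e"
        using q(2) dist_triangle[of "fst p" q "snd p"] by (simp add: dist_commute)
      finally show "(INF q\<in>D. dist (fst p) q + dist (snd p) q) \<le> dist (fst p) (snd p) + e" .
    qed
    show "dist (fst p) (snd p) \<le> (INF q\<in>D. dist (fst p) q + dist (snd p) q)"
      by (rule cINF_greatest[OF ne]) (metis dist_commute dist_triangle)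
  qed
  ultimately show ?thesis
    by (simp cong: measurable_cong)
qed

lemma measurable_dist_MB [measurable]: "(\<lambda>p. dist (fst p) (snd p)) \<in> borel_measurable (M \<Otimes>\<^sub>M B)"
  by (rule measurable_dist[OF measurable_id_M])

lemma measurable_dist_BB [measurable]: "(\<lambda>p. dist (fst p) (snd p)) \<in> borel_measurable (B \<Otimes>\<^sub>M B)"
  by (rule measurable_dist[OF measurable_id_B])

lemma measurable_dist_BM [measurable]: "(\<lambda>p. dist (fst p) (snd p)) \<in> borel_measurable (B \<Otimes>\<^sub>M M)"
  using measurable_compose[OF measurable_pair_swap' measurable_dist_MB]
  by (simp add: case_prod_beta dist_commute)

text \<open>A ball is a section of the jointly measurable set where the distance is below
  \<open>r\<close>, so measurability in the centre comes from integrating out the other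
  variable.\<close>

lemma measurable_V [measurable]: "(\<lambda>z. V z r) \<in> borel_measurable B"
proof -
  have "(\<lambda>z. \<integral>\<^sup>+x. indicator {..<r} (dist z x) \<partial>M) \<in> borel_measurable B"
    by (intro M.borel_measurable_nn_integral) (auto simp: case_prod_beta)
  also have "(\<lambda>z. \<integral>\<^sup>+x. indicator {..<r} (dist z x) \<partial>M) = (\<lambda>z. emeasure M (ball z r))"
  proof
    fix z
    have "(\<integral>\<^sup>+x. indicator {..<r} (dist z x) \<partial>M) = (\<integral>\<^sup>+x. indicator (ball z r) x \<partial>M)"
      by (intro nn_integral_cong) (auto simp: indicator_def)
    also have "\<dots> = emeasure M (ball z r)"
      by (simp add: sets_M)
    finally show "(\<integral>\<^sup>+x. indicator {..<r} (dist z x) \<partial>M) = emeasure M (ball z r)" .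
  qed
  finally show ?thesis
    unfolding measure_def by measurable
qed

text \<open>At each \<open>x\<close> the value \<open>u x\<close> is at most the mean of
  \<open>h\<close> over the boundary points near \<open>x\<close>. Exchanging the integrals leaves,
  at each \<open>z\<close>, the volume of a ball of radius comparable to \<rho> divided by its
  boundary measure, which is comparable to \<rho> by codimension one regularity. This factor later
  cancels the slope of a cutoff.\<close>

lemma layer_integral_le:
  fixes u :: "'a \<Rightarrow> ennreal"
  assumes rho: "0 < \<rho>" "\<rho> \<le> diameter \<Omega>" and h [measurable]: "h \<in> borel_measurable B"
    and u: "\<And>x z. x \<in> layer \<rho> \<Longrightarrow> z \<in> bd \<Longrightarrow> dist x z < 2 * \<rho> \<Longrightarrow> u x \<le> h z"
  shows "(\<integral>\<^sup>+x\<in>layer \<rho>. u x \<partial>M) \<le> ennreal (CA * CD ^ 3 * \<rho>) * (\<integral>\<^sup>+z. h z \<partial>B)"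
proof -
  define K where "K = CA * CD ^ 3 * \<rho>"
  have K: "0 < K"
    using CA CD rho by (simp add: K_def)
  \<comment> \<open>The normalisation by \<open>V z (2 * \<rho>)\<close> depends on \<open>z\<close>
    only, so the integral in \<open>x\<close> is exactly \<open>K * h z\<close>; the fact
    \<open>le\<close> below shows that the kernel still dominates the one of the mean over
    \<open>A\<close>.\<close>
  define k where "k x z = indicator {..<2 * \<rho>} (dist x z) * (h z * ennreal (K / V z (2 * \<rho>)))" for x z
  have k [measurable]: "case_prod k \<in> borel_measurable (M \<Otimes>\<^sub>M B)"
    unfolding k_def case_prod_beta by measurable
  have "u x * indicator (layer \<rho>) x \<le> (\<integral>\<^sup>+z. k x z \<partial>B)" for x
  proof (cases "x \<in> layer \<rho>")
    case True
    then obtain y where y: "y \<in> bd" "dist x y < \<rho>"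
      by (auto simp: layer_def \<delta>_less_iff)
    define A where "A = ball x (2 * \<rho>) \<inter> bd"
    have A [measurable]: "A \<in> sets B"
      by (simp add: A_def)
    define a where "a = measure B A"
    have sub: "ball y \<rho> \<inter> bd \<subseteq> A"
    proof
      fix z assume "z \<in> ball y \<rho> \<inter> bd"
      then show "z \<in> A"
        using y(2) dist_triangle[of x z y] by (auto simp: A_def)
    qed
    have "V y \<rho> \<le> CA * (\<rho> * H y \<rho>)"
      using y rho by (intro V_le_H) auto
    also have "\<dots> \<le> CA * (\<rho> * a)"
      unfolding a_def using sub rho CA by (intro mult_left_mono B.finite_measure_mono) auto
    finally have Va: "V y \<rho> \<le> CA * (\<rho> * a)" .
    have a: "0 < a"
    proof -
      have "0 < CA * (\<rho> * a)"
        using Va V_pos[OF rho(1), of y] by linarith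
      then show ?thesis
        using CA rho by (simp add: zero_less_mult_iff)
    qed
    have le: "1 / a \<le> K / V z (2 * \<rho>)" if z: "z \<in> A" for z
    proof -
      have "dist z y \<le> dist x z + dist x y"
        by (metis dist_commute dist_triangle)
      \<comment> \<open>The distance from \<open>z\<close> to \<open>y\<close> is below 3\<rho>, and
        3\<rho> + 2\<rho> is at most 2 ^ 3 times \<rho>.\<close>
      then have "V z (2 * \<rho>) \<le> CD ^ 3 * V y \<rho>"
        using z y rho by (intro V_compare) (auto simp: A_def)
      also have "\<dots> \<le> K * a"
        using Va CD by (simp add: K_def mult.assoc mult.left_commute[of CA])
      finally show ?thesis
        using a V_pos[of "2 * \<rho>" z] rho by (simp add: field_simps)
    qed
    have "u x * indicator (layer \<rho>) x = u x * (ennreal (1 / a) * emeasure B A)"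
      using True a by (simp add: B.emeasure_eq_measure a_def flip: ennreal_mult)
    also have "\<dots> = (\<integral>\<^sup>+z. (u x * ennreal (1 / a)) * indicator A z \<partial>B)"
      by (subst nn_integral_cmult_indicator) (auto simp: mult.assoc)
    also have "\<dots> \<le> (\<integral>\<^sup>+z. k x z \<partial>B)"
    proof (rule nn_integral_mono)
      fix z assume "z \<in> space B"
      show "(u x * ennreal (1 / a)) * indicator A z \<le> k x z"
      proof (cases "z \<in> A")
        case True': True
        then show ?thesis
          using u[OF True] le[OF True'] \<open>z \<in> space B\<close> by (auto simp: k_def A_def intro!: mult_mono ennreal_leI)
      qed simp
    qed
    finally show ?thesis .
  qed simp
  then have "(\<integral>\<^sup>+x\<in>layer \<rho>. u x \<partial>M) \<le> (\<integral>\<^sup>+x. \<integral>\<^sup>+z. k x z \<partial>B \<partial>M)"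
    by (rule nn_integral_mono)
  also have "\<dots> = (\<integral>\<^sup>+z. \<integral>\<^sup>+x. k x z \<partial>M \<partial>B)"
    using MB.Fubini[OF k] by simp
  also have "\<dots> = (\<integral>\<^sup>+z. ennreal K * h z \<partial>B)"
  proof (rule nn_integral_cong)
    fix z
    have "(\<integral>\<^sup>+x. k x z \<partial>M) = (\<integral>\<^sup>+x. (h z * ennreal (K / V z (2 * \<rho>))) * indicator (ball z (2 * \<rho>)) x \<partial>M)"
      by (intro nn_integral_cong) (auto simp: k_def indicator_def dist_commute)
    also have "\<dots> = h z * (ennreal (K / V z (2 * \<rho>)) * ennreal (V z (2 * \<rho>)))"
      by (subst nn_integral_cmult_indicator) (auto simp: sets_M emeasure_ball mult.assoc)
    also have "\<dots> = ennreal K * h z"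
      using V_pos[of "2 * \<rho>" z] rho K by (simp add: mult.commute flip: ennreal_mult)
    finally show "(\<integral>\<^sup>+x. k x z \<partial>M) = ennreal K * h z" .
  qed
  also have "\<dots> = ennreal K * (\<integral>\<^sup>+z. h z \<partial>B)"
    by (rule nn_integral_cmult) simp
  finally show ?thesis
    by (simp add: K_def)
qed

end

section \<open>Averages of boundary functions\<close>

context codim1_domain
begin

text \<open>A tent and not an indicator: it is 1-Lipschitz in \<open>x\<close> uniformly in
  \<open>y\<close>, and this regularity passes to the averages.\<close>

definition hat :: "real \<Rightarrow> 'a \<Rightarrow> 'a \<Rightarrow> real" where
  "hat s x y = max 0 (s - dist x y)"

text \<open>Where the weight vanishes on the whole boundary, the quotient is 0 by the convention for
  division. The estimates all concern points with \<open>\<delta> x < s / 2\<close>, where the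
  denominator is bounded below.\<close>

definition avg :: "real \<Rightarrow> ('a \<Rightarrow> real) \<Rightarrow> 'a \<Rightarrow> real" where
  "avg s f x = (\<integral>y. f y * hat s x y \<partial>B) / (\<integral>y. hat s x y \<partial>B)"

text \<open>The two radii differ on purpose: for every t between \<open>2 * s\<close> and
  \<open>4 * s\<close> the numerator is over a smaller ball and the denominator over a larger one
  than in the Besov integrand at t, so \<open>osc\<close> lies below that integrand on the whole
  interval.\<close>

definition osc :: "real \<Rightarrow> ('a \<Rightarrow> real) \<Rightarrow> 'a \<Rightarrow> ennreal" where
  "osc s f z = (\<integral>\<^sup>+y\<in>ball z (2 * s). ennreal \<bar>f y - f z\<bar> \<partial>B) / ennreal (H z (4 * s))"

abbreviation L1 :: "('a \<Rightarrow> real) \<Rightarrow> real" where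
  "L1 f \<equiv> \<integral>y. \<bar>f y\<bar> \<partial>B"

lemma hat_nonneg: "0 \<le> hat s x y"
  by (simp add: hat_def)

lemma hat_le: "0 < s \<Longrightarrow> hat s x y \<le> s"
  by (simp add: hat_def)

lemma hat_lipschitz: "\<bar>hat s x y - hat s x' y\<bar> \<le> dist x x'"
  using dist_triangle[of x y x'] dist_triangle[of x' y x] by (auto simp: hat_def dist_commute max_def abs_le_iff)

lemma measurable_hat [measurable]: "hat s x \<in> borel_measurable B"
  unfolding hat_def
  by (intro measurable_B_if_borel borel_measurable_continuous_onI continuous_intros)

lemma integrable_mult_hat:
  assumes "integrable B f" "0 < s"
  shows "integrable B (\<lambda>y. f y * hat s x y)"
proof (rule Bochner_Integration.integrable_bound)
  show "integrable B (\<lambda>y. s * f y)"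
    using assms by simp
  show "AE y in B. norm (f y * hat s x y) \<le> norm (s * f y)"
    using hat_le[OF assms(2)] hat_nonneg assms(2)
    by (auto simp: abs_mult mult.commute[of _ "\<bar>f _\<bar>"] intro!: mult_left_mono AE_I2)
qed (use assms in measurable)

lemma integrable_hat: "0 < s \<Longrightarrow> integrable B (hat s x)"
  using integrable_mult_hat[of "\<lambda>_. 1" s x] by simp

lemma abs_integral_mult_hat_le:
  assumes "integrable B f" "0 < s"
  shows "\<bar>\<integral>y. f y * hat s x y \<partial>B\<bar> \<le> s * L1 f"
proof -
  have "\<bar>\<integral>y. f y * hat s x y \<partial>B\<bar> \<le> (\<integral>y. \<bar>f y * hat s x y\<bar> \<partial>B)"
    by (rule integral_abs_bound)
  also have "\<dots> \<le> (\<integral>y. s * \<bar>f y\<bar> \<partial>B)"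
    using hat_le[OF assms(2)] hat_nonneg assms
    by (intro integral_mono integrable_abs integrable_mult_hat)
      (auto simp: abs_mult mult.commute[of s] intro!: mult_left_mono)
  finally show ?thesis by simp
qed

lemma abs_integral_mult_hat_diff_le:
  assumes "integrable B f" "0 < s"
  shows "\<bar>(\<integral>y. f y * hat s x y \<partial>B) - (\<integral>y. f y * hat s x' y \<partial>B)\<bar> \<le> L1 f * dist x x'"
proof -
  have "(\<integral>y. f y * hat s x y \<partial>B) - (\<integral>y. f y * hat s x' y \<partial>B)
      = (\<integral>y. f y * hat s x y - f y * hat s x' y \<partial>B)"
    by (rule Bochner_Integration.integral_diff[symmetric]) (intro integrable_mult_hat assms)+
  also have "\<bar>\<dots>\<bar> \<le> (\<integral>y. \<bar>f y * hat s x y - f y * hat s x' y\<bar> \<partial>B)"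
    by (rule integral_abs_bound)
  also have "\<dots> \<le> (\<integral>y. \<bar>f y\<bar> * dist x x' \<partial>B)"
  proof (intro integral_mono integrable_abs Bochner_Integration.integrable_diff integrable_mult_hat assms)
    show "\<bar>f y * hat s x y - f y * hat s x' y\<bar> \<le> \<bar>f y\<bar> * dist x x'" for y
      using hat_lipschitz[of s x y x']
      by (auto simp: abs_mult intro!: mult_left_mono simp flip: right_diff_distrib)
  qed (use assms in simp)
  finally show ?thesis by simp
qed

text \<open>Points within \<open>s / 4\<close> of \<open>z\<close> are within
  \<open>3 * s / 4\<close> of \<open>x\<close>, and there the weight is at least
  \<open>s / 4\<close>.\<close>

lemma integral_hat_ge:
  assumes "0 < s" "z \<in> bd" "dist x z < s / 2"
  shows "s / 4 * H z (s / 4) \<le> (\<integral>y. hat s x y \<partial>B)"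
proof -
  have "s / 4 * H z (s / 4) = (\<integral>y. s / 4 * indicator (ball z (s / 4) \<inter> bd) y \<partial>B)"
    by simp
  also have "\<dots> \<le> (\<integral>y. hat s x y \<partial>B)"
  proof (intro integral_mono integrable_hat integrable_mult_right assms)
    show "s / 4 * indicator (ball z (s / 4) \<inter> bd) y \<le> hat s x y" for y
      using dist_triangle[of x y z] assms by (auto simp: hat_def indicator_def)
  qed (auto intro!: integrable_real_indicator simp: B.emeasure_finite less_top[symmetric])
  finally show ?thesis .
qed

lemma H_lower_bound:
  assumes "0 < r"
  obtains c where "0 < c" "\<And>z. z \<in> bd \<Longrightarrow> c \<le> H z r"
proof -
  define q where "q = min r (diameter \<Omega>)"
  have q: "0 < q" "q \<le> r" "q \<le> diameter \<Omega>"
    using assms diameter_pos by (auto simp: q_def)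
  obtain c where c: "0 < c" "\<And>z. z \<in> bd \<Longrightarrow> c \<le> V z q"
    using V_lower_bound[OF bounded_frontier_domain q(1)] by blast
  show ?thesis
  proof (rule that)
    show "0 < c / (CA * q)"
      using c(1) q CA by simp
    show "c / (CA * q) \<le> H z r" if z: "z \<in> bd" for z
    proof -
      have "c \<le> CA * (q * H z q)"
        using c(2)[OF z] V_le_H[OF z q(1,3)] by linarith
      then have "c / (CA * q) \<le> H z q"
        using q CA by (simp add: field_simps)
      also have "\<dots> \<le> H z r"
        using q by (intro B.finite_measure_mono) auto
      finally show ?thesis .
    qed
  qed
qed

text \<open>The average is a quotient of Lipschitz functions whose denominator is bounded below near
  the boundary, by a uniform lower bound on \<open>H\<close>. What matters is the order of
  quantifiers: \<open>L\<close> is obtained before \<open>f\<close>, so that the scales can be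
  chosen once for all \<open>f\<close>.\<close>

lemma avg_bounds:
  assumes s: "0 < s"
  obtains L where "0 < L"
    "\<And>f x. integrable B f \<Longrightarrow> \<delta> x < s / 2 \<Longrightarrow> \<bar>avg s f x\<bar> \<le> L * L1 f"
    "\<And>f x y. integrable B f \<Longrightarrow> \<delta> x < s / 2 \<Longrightarrow> \<delta> y < s / 2 \<Longrightarrow>
       \<bar>avg s f x - avg s f y\<bar> \<le> L * L1 f * dist x y"
proof -
  obtain c0 where c0: "0 < c0" "\<And>z. z \<in> bd \<Longrightarrow> c0 \<le> H z (s / 4)"
    using H_lower_bound[of "s / 4"] s by auto
  define c where "c = s / 4 * c0"
  have c: "0 < c"
    using c0 s by (simp add: c_def)
  define D where "D x = (\<integral>y. hat s x y \<partial>B)" for x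
  have D: "c \<le> D x" if x: "\<delta> x < s / 2" for x
  proof -
    obtain z where z: "z \<in> bd" "dist x z < s / 2"
      using x unfolding \<delta>_less_iff by blast
    have "c \<le> s / 4 * H z (s / 4)"
      unfolding c_def using c0(2)[OF z(1)] s by (intro mult_left_mono) auto
    with integral_hat_ge[OF s z] show ?thesis
      unfolding D_def by linarith
  qed
  define m where "m = measure B bd"
  have Dlip: "\<bar>D x - D y\<bar> \<le> m * dist x y" for x y
    using abs_integral_mult_hat_diff_le[of "\<lambda>_. 1" s x y] s by (simp add: D_def m_def)
  \<comment> \<open>\<open>s / c\<close> bounds the quotient itself; \<open>1 / c\<close> and
    \<open>s * m / (c * c)\<close> account for the variation of its numerator and of its
    denominator.\<close>
  define L where "L = 1 / c + s / c + s * m / (c * c)"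
  have m: "0 \<le> m"
    by (simp add: m_def)
  show ?thesis
  proof (rule that)
    show "0 < L"
      unfolding L_def using c s m by (intro add_pos_nonneg) auto
    fix f :: "'a \<Rightarrow> real" assume f: "integrable B f"
    define N where "N x = (\<integral>y. f y * hat s x y \<partial>B)" for x
    have avg: "avg s f x = N x / D x" for x
      by (simp add: avg_def N_def D_def)
    have N: "\<bar>N x\<bar> \<le> s * L1 f" for x
      unfolding N_def by (rule abs_integral_mult_hat_le[OF f s])
    have Nlip: "\<bar>N x - N y\<bar> \<le> L1 f * dist x y" for x y
      unfolding N_def by (rule abs_integral_mult_hat_diff_le[OF f s])
    have nn: "0 \<le> L1 f"
      by simp
    show "\<bar>avg s f x\<bar> \<le> L * L1 f" if x: "\<delta> x < s / 2" for x
    proof -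
      have "\<bar>N x / D x\<bar> \<le> (s * L1 f) / c"
        unfolding abs_divide using N[of x] D[OF x] c by (intro frac_le) auto
      also have "\<dots> = s / c * L1 f"
        by simp
      also have "\<dots> \<le> L * L1 f"
        unfolding L_def using c s m nn by (intro mult_right_mono) auto
      finally show ?thesis
        by (simp add: avg)
    qed
    show "\<bar>avg s f x - avg s f y\<bar> \<le> L * L1 f * dist x y" if x: "\<delta> x < s / 2" and y: "\<delta> y < s / 2" for x y
    proof -
      have pos: "0 < D x" "0 < D y"
        using D[OF x] D[OF y] c by auto
      have "N x / D x - N y / D y = (N x - N y) / D x + N y * (D y - D x) / (D x * D y)"
        using pos by (simp add: field_simps)
      also have "\<bar>\<dots>\<bar> \<le> \<bar>(N x - N y) / D x\<bar> + \<bar>N y * (D y - D x) / (D x * D y)\<bar>"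
        by (rule abs_triangle_ineq)
      also have "\<bar>(N x - N y) / D x\<bar> \<le> (L1 f * dist x y) / c"
        unfolding abs_divide using Nlip[of x y] D[OF x] c by (intro frac_le) auto
      also have "\<bar>N y * (D y - D x) / (D x * D y)\<bar> \<le> (s * L1 f * (m * dist x y)) / (c * c)"
        unfolding abs_divide abs_mult using N[of y] Dlip[of y x] D[OF x] D[OF y] c m nn s
        by (intro frac_le mult_mono) (auto simp: dist_commute)
      also have "(L1 f * dist x y) / c + (s * L1 f * (m * dist x y)) / (c * c)
          = (1 / c + s * m / (c * c)) * (L1 f * dist x y)"
        using c by (simp add: field_simps)
      also have "\<dots> \<le> L * (L1 f * dist x y)"
        unfolding L_def using c s nn by (intro mult_right_mono) auto
      finally show ?thesis
        by (simp add: avg mult.assoc)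
    qed
  qed
qed

lemma avg_linear:
  assumes "integrable B f" "integrable B g" "0 < s"
  shows "avg s (\<lambda>z. a * f z + b * g z) x = a * avg s f x + b * avg s g x"
proof -
  have "(\<integral>y. (a * f y + b * g y) * hat s x y \<partial>B) = (\<integral>y. a * (f y * hat s x y) + b * (g y * hat s x y) \<partial>B)"
    by (simp add: algebra_simps)
  also have "\<dots> = a * (\<integral>y. f y * hat s x y \<partial>B) + b * (\<integral>y. g y * hat s x y \<partial>B)"
    using integrable_mult_hat[OF assms(1,3)] integrable_mult_hat[OF assms(2,3)] by simp
  finally show ?thesis
    by (simp add: avg_def add_divide_distrib)
qed

lemma avg_cong_AE:
  assumes "integrable B f" "integrable B g" "AE z in B. f z = g z"
  shows "avg s f x = avg s g x"
proof -
  have "(\<integral>y. f y * hat s x y \<partial>B) = (\<integral>y. g y * hat s x y \<partial>B)"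
    using assms by (intro integral_cong_AE) auto
  then show ?thesis
    by (simp add: avg_def)
qed

text \<open>The left hand side is a weighted mean of \<open>f y - f z\<close>. The weight is at most
  \<open>s\<close> and vanishes off \<open>ball z (2 * s)\<close>, and its integral is at least
  \<open>s / 4 * H z (s / 4)\<close>: this gives the factor 4, and \<open>CH\<close> replaces the
  radius \<open>s / 4\<close> by \<open>4 * s\<close>.\<close>

lemma avg_osc:
  assumes f: "integrable B f" and s: "0 < s" "4 * s \<le> diameter \<Omega>" and z: "z \<in> bd" "dist x z < s / 2"
  shows "ennreal \<bar>avg s f x - f z\<bar> \<le> ennreal (4 * CH) * osc s f z"
proof -
  define D where "D = (\<integral>y. hat s x y \<partial>B)"
  define I where "I = (\<integral>y. \<bar>f y - f z\<bar> * indicator (ball z (2 * s)) y \<partial>B)"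
  have int: "integrable B (\<lambda>y. \<bar>f y - f z\<bar> * indicator (ball z (2 * s)) y)"
  proof -
    have "integrable B (\<lambda>y. \<bar>f y - f z\<bar> * indicator (ball z (2 * s) \<inter> bd) y)"
      using f by (intro integrable_real_mult_indicator) auto
    then show ?thesis
      by (subst Bochner_Integration.integrable_cong[OF refl]) (auto simp: indicator_def)
  qed
  have I: "0 \<le> I"
    unfolding I_def by (intro Bochner_Integration.integral_nonneg) auto
  have H: "0 < H z (s / 4)" "0 < H z (4 * s)" "H z (4 * s) \<le> CH * H z (s / 4)"
    using H_pos[OF z(1)] H_doubling[OF z(1), of "s / 4"] s by auto
  have D: "s / 4 * H z (s / 4) \<le> D"
    unfolding D_def by (rule integral_hat_ge[OF s(1) z])
  have Dpos: "0 < D"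
    using less_le_trans[OF mult_pos_pos D] H(1) s by simp
  have "avg s f x - f z = ((\<integral>y. f y * hat s x y \<partial>B) - f z * D) / D"
    using Dpos by (simp add: avg_def D_def diff_divide_distrib)
  also have "(\<integral>y. f y * hat s x y \<partial>B) - f z * D = (\<integral>y. (f y - f z) * hat s x y \<partial>B)"
    using integrable_mult_hat[OF f s(1), of x] integrable_hat[OF s(1), of x]
    by (simp add: D_def left_diff_distrib)
  also have "\<bar>(\<integral>y. (f y - f z) * hat s x y \<partial>B) / D\<bar> \<le> (s * I) / (s / 4 * H z (s / 4))"
  proof -
    have "\<bar>\<integral>y. (f y - f z) * hat s x y \<partial>B\<bar> \<le> (\<integral>y. \<bar>(f y - f z) * hat s x y\<bar> \<partial>B)"
      by (rule integral_abs_bound)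
    also have "\<dots> \<le> (\<integral>y. s * (\<bar>f y - f z\<bar> * indicator (ball z (2 * s)) y) \<partial>B)"
    proof (intro integral_mono integrable_abs integrable_mult_hat integrable_mult_right int s)
      show "\<bar>(f y - f z) * hat s x y\<bar> \<le> s * (\<bar>f y - f z\<bar> * indicator (ball z (2 * s)) y)" for y
      proof (cases "dist z y < 2 * s")
        case True
        then show ?thesis
          using hat_le[OF s(1), of x y] hat_nonneg[of s x y]
          by (auto simp: abs_mult mult.commute[of s] intro!: mult_left_mono)
      next
        case False
        then have "hat s x y = 0"
          using z(2) dist_triangle[of z y x] s(1) by (auto simp: hat_def dist_commute)
        then show ?thesis
          using s(1) by simp
      qed
    qed (use f in simp)
    also have "\<dots> = s * I"
      by (simp add: I_def)
    finally show ?thesis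
      unfolding abs_divide using D Dpos s(1) H(1) by (intro frac_le) auto
  qed
  also have "\<dots> = 4 * I / H z (s / 4)"
    using s(1) by simp
  also have "\<dots> \<le> 4 * CH * (I / H z (4 * s))"
  proof -
    have "I * H z (4 * s) \<le> I * (CH * H z (s / 4))"
      using H(3) I by (rule mult_left_mono)
    then show ?thesis
      using H(1,2) by (simp add: field_simps)
  qed
  finally have "ennreal \<bar>avg s f x - f z\<bar> \<le> ennreal (4 * CH * (I / H z (4 * s)))"
    by (rule ennreal_leI)
  also have "\<dots> = ennreal (4 * CH) * (ennreal I / ennreal (H z (4 * s)))"
    using I H(2) CH by (simp add: divide_ennreal ennreal_mult del: times_divide_eq_right)
  also have "ennreal I = (\<integral>\<^sup>+y. ennreal (\<bar>f y - f z\<bar> * indicator (ball z (2 * s)) y) \<partial>B)"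
    unfolding I_def by (rule nn_integral_eq_integral[symmetric]) (use int in auto)
  also have "\<dots> = (\<integral>\<^sup>+y\<in>ball z (2 * s). ennreal \<bar>f y - f z\<bar> \<partial>B)"
    by (intro nn_integral_cong) (auto simp: indicator_def)
  finally show ?thesis
    by (simp add: osc_def)
qed

lemma measurable_H [measurable]: "(\<lambda>z. H z r) \<in> borel_measurable B"
proof -
  have "(\<lambda>z. \<integral>\<^sup>+x. indicator {..<r} (dist z x) \<partial>B) \<in> borel_measurable B"
    by (intro B.borel_measurable_nn_integral) (auto simp: case_prod_beta)
  also have "(\<lambda>z. \<integral>\<^sup>+x. indicator {..<r} (dist z x) \<partial>B) = (\<lambda>z. emeasure B (ball z r \<inter> bd))"
  proof
    fix z
    have "(\<integral>\<^sup>+x. indicator {..<r} (dist z x) \<partial>B) = (\<integral>\<^sup>+x. indicator (ball z r \<inter> bd) x \<partial>B)"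
      by (intro nn_integral_cong) (auto simp: indicator_def)
    also have "\<dots> = emeasure B (ball z r \<inter> bd)"
      by simp
    finally show "(\<integral>\<^sup>+x. indicator {..<r} (dist z x) \<partial>B) = emeasure B (ball z r \<inter> bd)" .
  qed
  finally show ?thesis
    unfolding measure_def by measurable
qed

lemma measurable_osc:
  assumes [measurable]: "f \<in> borel_measurable B"
  shows "osc s f \<in> borel_measurable B"
proof -
  have [measurable]: "(\<lambda>z. \<integral>\<^sup>+y. ennreal \<bar>f y - f z\<bar> * indicator {..<2 * s} (dist z y) \<partial>B) \<in> borel_measurable B"
    by (intro B.borel_measurable_nn_integral) (auto simp: case_prod_beta)
  have "osc s f = (\<lambda>z. (\<integral>\<^sup>+y. ennreal \<bar>f y - f z\<bar> * indicator {..<2 * s} (dist z y) \<partial>B) / ennreal (H z (4 * s)))"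
    unfolding osc_def by (intro ext arg_cong2[where f = "(/)"] nn_integral_cong) (auto simp: indicator_def)
  also have "\<dots> \<in> borel_measurable B"
    by measurable
  finally show ?thesis .
qed

end

section \<open>Sparse scales and the extension operator\<close>

context codim1_domain
begin

lemma open_layer: "open (layer r)"
proof -
  have "layer r = \<Omega> \<inter> \<delta> -` {..<r}"
    by (auto simp: layer_def)
  moreover have "open (\<delta> -` {..<r})"
    by (intro open_vimage continuous_intros)
  ultimately show ?thesis
    using open_domain by (simp add: open_Int)
qed

lemma sets_layer [measurable]: "layer r \<in> sets M"
  using open_layer by (simp add: sets_M)

lemma sets_domain [measurable]: "\<Omega> \<in> sets M"
  using open_domain by (simp add: sets_M)

lemma emeasure_domain_finite: "emeasure M \<Omega> < \<infinity>"
proof -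
  obtain a r where "\<Omega> \<subseteq> ball a r"
    using bounded_subset_ballD[OF bounded_domain] by blast
  then have "emeasure M \<Omega> \<le> emeasure M (ball a r)"
    by (intro emeasure_mono) (auto simp: sets_M)
  then show ?thesis
    using ball_finite by (rule order_le_less_trans)
qed

lemma emeasure_subset_domain: "A \<subseteq> \<Omega> \<Longrightarrow> emeasure M A = ennreal (measure M A)"
  using emeasure_mono[of A \<Omega> M] emeasure_domain_finite
  by (intro emeasure_eq_ennreal_measure) (auto simp: top_unique sets_domain)

lemma emeasure_layer: "emeasure M (layer r) = ennreal (measure M (layer r))"
  by (rule emeasure_subset_domain) (auto simp: layer_def)

lemma layer_mono: "r \<le> r' \<Longrightarrow> layer r \<subseteq> layer r'"
  by (auto simp: layer_def)

lemma measure_layer_mono: "r \<le> r' \<Longrightarrow> measure M (layer r) \<le> measure M (layer r')"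
  by (intro measure_mono_fmeasurable layer_mono) (auto simp: fmeasurable_def emeasure_layer)

text \<open>The layers lie in the open set \<Omega>, where \<delta> is positive, so they decrease to
  the empty set; continuity from above applies because \<Omega> has finite measure.\<close>

lemma measure_layer_small:
  assumes "0 < e"
  obtains r0 where "0 < r0" "\<And>r. r \<le> r0 \<Longrightarrow> measure M (layer r) \<le> e"
proof -
  have "(\<lambda>n. emeasure M (layer (1 / real (Suc n)))) \<longlonglongrightarrow> emeasure M (\<Inter>n. layer (1 / real (Suc n)))"
    by (rule Lim_emeasure_decseq)
      (auto simp: decseq_def emeasure_layer divide_simps intro!: layer_mono)
  moreover have "(\<Inter>n. layer (1 / real (Suc n))) = {}"
  proof (rule ccontr)
    assume "(\<Inter>n. layer (1 / real (Suc n))) \<noteq> {}"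
    then obtain x where x: "\<And>n. x \<in> layer (1 / real (Suc n))"
      by blast
    then have "0 < \<delta> x"
      using \<delta>_pos by (auto simp: layer_def)
    then obtain n where "1 / real (Suc n) < \<delta> x"
      using nat_approx_posE by blast
    with x[of n] show False
      by (simp add: layer_def)
  qed
  ultimately have "(\<lambda>n. emeasure M (layer (1 / real (Suc n)))) \<longlonglongrightarrow> 0"
    by simp
  then have "\<forall>\<^sub>F n in sequentially. emeasure M (layer (1 / real (Suc n))) < ennreal e"
    using assms by (auto intro: order_tendstoD)
  then obtain n where "emeasure M (layer (1 / real (Suc n))) < ennreal e"
    by (auto simp: eventually_sequentially)
  then have n: "measure M (layer (1 / real (Suc n))) < e"
    by (simp add: emeasure_layer ennreal_less_iff)
  show ?thesis
    by (rule that[of "1 / real (Suc n)"]) (use n in \<open>auto intro: order_trans[OF measure_layer_mono]\<close>)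
qed

lemma measure_ball_Int_domain_pos:
  assumes "z \<in> bd" "0 < r"
  shows "0 < measure M (ball z r \<inter> \<Omega>)"
proof -
  have "z \<in> closure \<Omega>"
    using assms(1) by (simp add: frontier_def)
  then obtain x where x: "x \<in> \<Omega>" "dist x z < r"
    using assms(2) by (auto simp: closure_approachable)
  then have "open (ball z r \<inter> \<Omega>)" "x \<in> ball z r \<inter> \<Omega>"
    using open_domain by (auto simp: dist_commute)
  then obtain q where q: "0 < q" "ball x q \<subseteq> ball z r \<inter> \<Omega>"
    using open_contains_ball by blast
  have "V x q \<le> measure M (ball z r \<inter> \<Omega>)"
    using q(2) emeasure_domain_finite
    by (intro measure_mono_fmeasurable) (auto simp: fmeasurable_def sets_M open_domain emeasure_subset_domain)
  with V_pos[OF q(1)] show ?thesis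
    by (rule less_le_trans)
qed

lemma measure_ball_Int_domain_mono:
  assumes "ball y q \<subseteq> ball z r"
  shows "measure M (ball y q \<inter> \<Omega>) \<le> measure M (ball z r \<inter> \<Omega>)"
  using assms by (intro measure_mono_fmeasurable) (auto simp: fmeasurable_def sets_M open_domain emeasure_subset_domain)

text \<open>No density of \<Omega> at the boundary is available. At a fixed radius, however, each
  ball centred on the boundary contains one of finitely many balls of half that radius, all of which
  meet \<Omega> in positive measure.\<close>

lemma measure_ball_Int_domain_lower_bound:
  assumes "0 < r"
  obtains c where "0 < c" "\<And>z. z \<in> bd \<Longrightarrow> c \<le> measure M (ball z r \<inter> \<Omega>)"
proof -
  obtain F where F: "finite F" "F \<subseteq> bd" "bd \<subseteq> (\<Union>y\<in>F. ball y (r / 2))"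
    using totally_bounded_if_bounded[OF bounded_frontier_domain, of "r / 2"] assms by auto
  have ne: "F \<noteq> {}"
    using F(3) frontier_ne by auto
  define c where "c = Min ((\<lambda>y. measure M (ball y (r / 2) \<inter> \<Omega>)) ` F)"
  show ?thesis
  proof (rule that)
    show "0 < c"
      unfolding c_def using F ne assms measure_ball_Int_domain_pos[of _ "r / 2"] by (subst Min_gr_iff) auto
    fix z assume "z \<in> bd"
    then obtain y where y: "y \<in> F" "dist y z < r / 2"
      using F(3) by auto
    have "ball y (r / 2) \<subseteq> ball z r"
      using y(2) by (auto simp: subset_eq) (smt (verit) dist_commute dist_triangle field_sum_of_halves)
    then have "measure M (ball y (r / 2) \<inter> \<Omega>) \<le> measure M (ball z r \<inter> \<Omega>)"
      by (rule measure_ball_Int_domain_mono)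
    moreover have "c \<le> measure M (ball y (r / 2) \<inter> \<Omega>)"
      unfolding c_def using F y by (intro Min_le) auto
    ultimately show "c \<le> measure M (ball z r \<inter> \<Omega>)"
      by linarith
  qed
qed

end

text \<open>The scales decrease so fast that the layers in which consecutive averages are glued are
  negligible compared with everything attached to the previous scale. In particular the last
  condition makes the trace exist although \<open>\<Omega>\<close> may have density \<open>0\<close> at boundary points.\<close>

locale extension_scales = codim1_domain +
  fixes R :: real and L :: "real \<Rightarrow> real" and s :: "nat \<Rightarrow> real"
  assumes L_pos: "0 < r \<Longrightarrow> 0 < L r"
    and L_bound: "0 < r \<Longrightarrow> integrable B f \<Longrightarrow> \<delta> x < r / 2 \<Longrightarrow> \<bar>avg r f x\<bar> \<le> L r * L1 f"
    and L_lipschitz: "0 < r \<Longrightarrow> integrable B f \<Longrightarrow> \<delta> x < r / 2 \<Longrightarrow> \<delta> y < r / 2 \<Longrightarrow>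
       \<bar>avg r f x - avg r f y\<bar> \<le> L r * L1 f * dist x y"
    and s_pos: "0 < s k"
    and s_0: "4 * s 0 \<le> R" "4 * s 0 \<le> diameter \<Omega>"
    and s_Suc: "4 * s (Suc k) \<le> s k"
    and s_layer: "L (s k) * measure M (layer (s (Suc k))) \<le> (1 / 2) ^ k"
    and s_density: "z \<in> bd \<Longrightarrow> s (Suc k) \<le> (1 / 2) ^ k * measure M (ball z (s k / 2) \<inter> \<Omega>)"

text \<open>\<open>L\<close> is fixed first for all radii; then the scales come from dependent
  choice, since what is demanded of the next scale involves only the current one and its
  index.\<close>

lemma (in codim1_domain) extension_scales_exist:
  assumes "0 < R"
  obtains L s where "extension_scales M CD \<Omega> CA R L s"
proof -
  define P where "P r L \<longleftrightarrow> 0 < L \<and>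
    (\<forall>f x. integrable B f \<longrightarrow> \<delta> x < r / 2 \<longrightarrow> \<bar>avg r f x\<bar> \<le> L * L1 f) \<and>
    (\<forall>f x y. integrable B f \<longrightarrow> \<delta> x < r / 2 \<longrightarrow> \<delta> y < r / 2 \<longrightarrow>
       \<bar>avg r f x - avg r f y\<bar> \<le> L * L1 f * dist x y)" for r L :: real
  have "\<exists>L. P r L" if "0 < r" for r
    using avg_bounds[OF that] unfolding P_def by metis
  then obtain L where L: "\<And>r. 0 < r \<Longrightarrow> P r (L r)"
    by metis
  define Q where "Q k r r' \<longleftrightarrow> 4 * r' \<le> r \<and> L r * measure M (layer r') \<le> (1 / 2) ^ k \<and>
    (\<forall>z\<in>bd. r' \<le> (1 / 2) ^ k * measure M (ball z (r / 2) \<inter> \<Omega>))" for k :: nat and r r' :: real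
  have "\<exists>s. \<forall>k. (0 < s k \<and> (k = 0 \<longrightarrow> 4 * s k \<le> R \<and> 4 * s k \<le> diameter \<Omega>)) \<and> Q k (s k) (s (Suc k))"
  proof (rule dependent_nat_choice)
    show "\<exists>r. 0 < r \<and> ((0::nat) = 0 \<longrightarrow> 4 * r \<le> R \<and> 4 * r \<le> diameter \<Omega>)"
      using assms diameter_pos by (intro exI[of _ "min R (diameter \<Omega>) / 4"]) auto
    fix r :: real and k :: nat
    assume "0 < r \<and> (k = 0 \<longrightarrow> 4 * r \<le> R \<and> 4 * r \<le> diameter \<Omega>)"
    then have r: "0 < r" by blast
    have Lr: "0 < L r"
      using L[OF r] by (simp add: P_def)
    obtain r0 where r0: "0 < r0" "\<And>q. q \<le> r0 \<Longrightarrow> measure M (layer q) \<le> (1 / 2) ^ k / L r"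
      using measure_layer_small[of "(1 / 2) ^ k / L r"] Lr by auto
    obtain c where c: "0 < c" "\<And>z. z \<in> bd \<Longrightarrow> c \<le> measure M (ball z (r / 2) \<inter> \<Omega>)"
      using measure_ball_Int_domain_lower_bound[of "r / 2"] r by auto
    \<comment> \<open>One entry for each of \<open>s_Suc\<close>, \<open>s_layer\<close> and
      \<open>s_density\<close>.\<close>
    define r' where "r' = min (r / 4) (min r0 ((1 / 2) ^ k * c))"
    have "0 < r'"
      using r r0(1) c(1) by (simp add: r'_def)
    moreover have "4 * r' \<le> r"
      by (simp add: r'_def)
    moreover have "L r * measure M (layer r') \<le> (1 / 2) ^ k"
      using r0(2)[of r'] Lr by (simp add: r'_def field_simps)
    moreover have "r' \<le> (1 / 2) ^ k * measure M (ball z (r / 2) \<inter> \<Omega>)" if "z \<in> bd" for z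
    proof -
      have "r' \<le> (1 / 2) ^ k * c"
        by (simp add: r'_def)
      also have "\<dots> \<le> (1 / 2) ^ k * measure M (ball z (r / 2) \<inter> \<Omega>)"
        using c(2)[OF that] by (intro mult_left_mono) auto
      finally show ?thesis .
    qed
    ultimately show "\<exists>r'. (0 < r' \<and> (Suc k = 0 \<longrightarrow> 4 * r' \<le> R \<and> 4 * r' \<le> diameter \<Omega>)) \<and> Q k r r'"
      by (auto simp: Q_def)
  qed
  then obtain s where s: "\<And>k. 0 < s k" "4 * s 0 \<le> R" "4 * s 0 \<le> diameter \<Omega>" "\<And>k. Q k (s k) (s (Suc k))"
    by metis
  have "extension_scales M CD \<Omega> CA R L s"
    by unfold_locales (use s L in \<open>auto simp: P_def Q_def\<close>)
  then show ?thesis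
    by (rule that)
qed

context extension_scales
begin

definition cutoff :: "real \<Rightarrow> real" where
  "cutoff t = max 0 (min 1 t)"

definition \<eta> :: "nat \<Rightarrow> 'a \<Rightarrow> real" where
  "\<eta> k x = cutoff (2 - 4 * \<delta> x / s (Suc k))"

text \<open>Equal to 1 on the whole region where \<eta> may be nonzero, with support still in the
  region where \<open>jump k f\<close> is Lipschitz. It replaces the indicator of the support of
  \<eta>, because \<open>upper_gradientI_continuous\<close> asks for a continuous gradient.\<close>

definition \<theta> :: "nat \<Rightarrow> 'a \<Rightarrow> real" where
  "\<theta> k x = cutoff (2 - 2 * \<delta> x / s (Suc k))"

text \<open>The index is shifted by one to put the zero function in front, so that the telescoping
  sum of the jumps starts at 0.\<close>

definition level :: "nat \<Rightarrow> ('a \<Rightarrow> real) \<Rightarrow> 'a \<Rightarrow> real" where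
  "level k f x = (if k = 0 then 0 else avg (s (k - 1)) f x)"

definition lip :: "nat \<Rightarrow> real" where
  "lip k = (if k = 0 then 0 else L (s (k - 1)))"

definition jump :: "nat \<Rightarrow> ('a \<Rightarrow> real) \<Rightarrow> 'a \<Rightarrow> real" where
  "jump k f x = level (Suc k) f x - level k f x"

text \<open>Where \<delta> lies between \<open>s (k + 2) / 2\<close> and
  \<open>s (k + 1) / 4\<close>, the cutoffs up to index k are 1 and the later ones 0, so the sum
  telescopes to the average at scale \<open>s k\<close>. In between, one cutoff interpolates two
  consecutive averages.\<close>

definition ext :: "('a \<Rightarrow> real) \<Rightarrow> 'a \<Rightarrow> real" where
  "ext f x = (\<Sum>k. \<eta> k x * jump k f x)"

text \<open>\<open>gluing\<close> and \<open>drift\<close> are the two halves of the product rule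
  for \<open>\<eta> k x * jump k f x\<close>: the jump times the slope \<open>4 / s (Suc k)\<close>
  of the cutoff, and the Lipschitz constant of the jump.\<close>

definition gluing :: "nat \<Rightarrow> ('a \<Rightarrow> real) \<Rightarrow> 'a \<Rightarrow> real" where
  "gluing k f x = \<theta> k x * (4 * \<bar>jump k f x\<bar> / s (Suc k))"

definition drift :: "nat \<Rightarrow> ('a \<Rightarrow> real) \<Rightarrow> 'a \<Rightarrow> real" where
  "drift k f x = \<theta> k x * ((lip k + lip (Suc k)) * L1 f)"

definition grad :: "('a \<Rightarrow> real) \<Rightarrow> 'a \<Rightarrow> real" where
  "grad f x = (\<Sum>k. gluing k f x + drift k f x)"

section \<open>Scales, cutoffs and single terms of the series\<close>

lemma s_antimono: "j \<le> k \<Longrightarrow> s k \<le> s j"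
  by (rule lift_Suc_antimono_le[of s]) (use s_Suc s_pos in \<open>auto intro: order_trans[OF _ s_Suc] simp: less_imp_le\<close>)

lemma s_le_power: "s k \<le> s 0 * (1 / 4) ^ k"
proof (induction k)
  case (Suc k)
  then show ?case
    using s_Suc[of k] by simp
qed simp

lemma s_small: "0 < e \<Longrightarrow> \<exists>N. \<forall>k\<ge>N. s k < e"
proof -
  assume e: "0 < e"
  obtain N where N: "(1 / 4 :: real) ^ N < e / s 0"
    using real_arch_pow_inv[of "e / s 0" "1 / 4"] e s_pos[of 0] by auto
  have "s k < e" if "N \<le> k" for k
  proof -
    have "s k \<le> s 0 * (1 / 4) ^ N"
      using s_antimono[OF that] s_le_power[of N] by linarith
    also have "\<dots> < e"
      using N s_pos[of 0] by (simp add: field_simps)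
    finally show ?thesis .
  qed
  then show ?thesis by blast
qed

lemma four_s_le_diameter: "4 * s k \<le> diameter \<Omega>"
  using s_antimono[of 0 k] s_0 by simp

lemma cutoff_bounds: "0 \<le> cutoff t" "cutoff t \<le> 1"
  by (auto simp: cutoff_def)

lemma cutoff_lipschitz: "\<bar>cutoff t - cutoff u\<bar> \<le> \<bar>t - u\<bar>"
  by (auto simp: cutoff_def max_def min_def abs_if)

lemma \<eta>_bounds: "0 \<le> \<eta> k x" "\<eta> k x \<le> 1" and \<theta>_bounds: "0 \<le> \<theta> k x" "\<theta> k x \<le> 1"
  by (auto simp: \<eta>_def \<theta>_def cutoff_bounds)

lemma \<eta>_eq_0: "s (Suc k) / 2 \<le> \<delta> x \<Longrightarrow> \<eta> k x = 0"
  and \<eta>_eq_1: "\<delta> x \<le> s (Suc k) / 4 \<Longrightarrow> \<eta> k x = 1"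
  and \<theta>_eq_0: "s (Suc k) \<le> \<delta> x \<Longrightarrow> \<theta> k x = 0"
  and \<theta>_eq_1: "\<delta> x \<le> s (Suc k) / 2 \<Longrightarrow> \<theta> k x = 1"
  using s_pos[of "Suc k"] by (auto simp: \<eta>_def \<theta>_def cutoff_def field_simps)

lemma \<eta>_lipschitz: "\<bar>\<eta> k x - \<eta> k y\<bar> \<le> 4 / s (Suc k) * dist x y"
proof -
  have "\<bar>\<eta> k x - \<eta> k y\<bar> \<le> \<bar>(2 - 4 * \<delta> x / s (Suc k)) - (2 - 4 * \<delta> y / s (Suc k))\<bar>"
    unfolding \<eta>_def by (rule cutoff_lipschitz)
  also have "\<dots> = 4 / s (Suc k) * \<bar>\<delta> x - \<delta> y\<bar>"
    using s_pos[of "Suc k"] by (auto simp: abs_if field_simps)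
  also have "\<dots> \<le> 4 / s (Suc k) * dist x y"
    using s_pos[of "Suc k"] infdist_triangle_abs by (intro mult_left_mono) auto
  finally show ?thesis .
qed

lemma \<eta>_le_\<theta>: "\<eta> k x \<le> \<theta> k x"
  using \<eta>_bounds[of k x] \<theta>_bounds[of k x] \<eta>_eq_0[of k x] \<theta>_eq_1[of x k] by linarith

lemma lip_nonneg: "0 \<le> lip k"
  using L_pos[OF s_pos[of "k - 1"]] by (simp add: lip_def)

lemma level_bound:
  assumes "integrable B f" "\<delta> x < s k / 2" "j \<le> Suc k"
  shows "\<bar>level j f x\<bar> \<le> lip j * L1 f"
proof (cases "j = 0")
  case False
  then have "s k \<le> s (j - 1)"
    using assms(3) by (intro s_antimono) auto
  with False assms L_bound[OF s_pos[of "j - 1"], of f x] show ?thesis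
    by (simp add: level_def lip_def)
qed (simp add: level_def lip_def)

lemma level_lipschitz:
  assumes "integrable B f" "\<delta> x < s k / 2" "\<delta> y < s k / 2" "j \<le> Suc k"
  shows "\<bar>level j f x - level j f y\<bar> \<le> lip j * L1 f * dist x y"
proof (cases "j = 0")
  case False
  then have "s k \<le> s (j - 1)"
    using assms(4) by (intro s_antimono) auto
  with False assms L_lipschitz[OF s_pos[of "j - 1"], of f x y] show ?thesis
    by (simp add: level_def lip_def)
qed (simp add: level_def lip_def)

lemma jump_bound:
  assumes "integrable B f" "\<delta> x < s k / 2"
  shows "\<bar>jump k f x\<bar> \<le> (lip k + lip (Suc k)) * L1 f"
  using level_bound[OF assms, of k] level_bound[OF assms, of "Suc k"] by (simp add: jump_def distrib_right)

lemma jump_lipschitz: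
  assumes "integrable B f" "\<delta> x < s k / 2" "\<delta> y < s k / 2"
  shows "\<bar>jump k f x - jump k f y\<bar> \<le> (lip k + lip (Suc k)) * L1 f * dist x y"
  using level_lipschitz[OF assms, of k] level_lipschitz[OF assms, of "Suc k"] by (simp add: jump_def distrib_right)

lemma jump_linear:
  assumes "integrable B f" "integrable B g"
  shows "jump k (\<lambda>z. a * f z + b * g z) x = a * jump k f x + b * jump k g x"
  by (simp add: jump_def level_def avg_linear[OF assms s_pos] algebra_simps)

lemma jump_cong_AE:
  "integrable B f \<Longrightarrow> integrable B g \<Longrightarrow> AE z in B. f z = g z \<Longrightarrow> jump k f x = jump k g x"
  by (simp add: jump_def level_def avg_cong_AE[of f g])

lemma gluing_nonneg: "0 \<le> gluing k f x"
  using s_pos[of "Suc k"] \<theta>_bounds by (simp add: gluing_def)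

lemma drift_nonneg: "0 \<le> drift k f x"
  using \<theta>_bounds lip_nonneg by (simp add: drift_def)

lemma \<eta>_jump_le_gluing: "\<eta> k x * \<bar>jump k f x\<bar> \<le> s (Suc k) / 4 * gluing k f x"
  using mult_right_mono[OF \<eta>_le_\<theta>, of "\<bar>jump k f x\<bar>" k x] s_pos[of "Suc k"] by (simp add: gluing_def)

lemma continuous_jump: "integrable B f \<Longrightarrow> continuous_on {x. \<delta> x < s k / 2} (jump k f)"
proof (rule lipschitz_on_continuous_on, rule lipschitz_onI)
  assume f: "integrable B f"
  show "dist (jump k f x) (jump k f y) \<le> (lip k + lip (Suc k)) * L1 f * dist x y"
    if "x \<in> {x. \<delta> x < s k / 2}" "y \<in> {x. \<delta> x < s k / 2}" for x y
    using jump_lipschitz[OF f] that by (simp add: dist_real_def)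
qed (use lip_nonneg in auto)

lemma continuous_\<theta>: "continuous_on U (\<theta> k)"
  unfolding \<theta>_def cutoff_def using s_pos[of "Suc k"] by (intro continuous_intros) auto

text \<open>The jump is controlled only near the boundary, and \<theta> vanishes away from it. Since
  \<open>s (Suc k)\<close> is below \<open>s k / 2\<close>, the two open regions cover the
  space.\<close>

lemma continuous_gluing:
  assumes f: "integrable B f"
  shows "continuous_on UNIV (gluing k f)"
proof -
  define U W where "U = {x. \<delta> x < s k / 2}" and "W = {x. s (Suc k) < \<delta> x}"
  have "U = \<delta> -` {..<s k / 2}" "W = \<delta> -` {s (Suc k)<..}"
    by (auto simp: U_def W_def)
  then have "open U" "open W"
    by (auto intro!: open_vimage continuous_intros)
  moreover have "continuous_on U (gluing k f)"
    unfolding gluing_def U_def using s_pos[of "Suc k"]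
    by (intro continuous_intros continuous_\<theta> continuous_jump f) auto
  moreover have "continuous_on W (gluing k f)"
    by (rule continuous_on_eq[OF continuous_on_const[of _ 0]]) (auto simp: W_def gluing_def \<theta>_eq_0)
  ultimately have "continuous_on (U \<union> W) (gluing k f)"
    by (rule continuous_on_open_Un)
  moreover have "U \<union> W = UNIV"
    using s_Suc[of k] s_pos[of "Suc k"] s_pos[of k] by (fastforce simp: U_def W_def)
  ultimately show ?thesis by simp
qed

lemma continuous_drift: "continuous_on UNIV (drift k f)"
  unfolding drift_def by (intro continuous_intros continuous_\<theta>)

lemma term_pointwise_lipschitz:
  assumes f: "integrable B f"
  shows "\<exists>r>0. \<forall>y\<in>ball x r. \<bar>\<eta> k y * jump k f y - \<eta> k x * jump k f x\<bar> \<le> (gluing k f x + drift k f x) * dist x y"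
proof (cases "\<delta> x \<le> s (Suc k) / 2")
  case True
  show ?thesis
  proof (intro exI[of _ "s (Suc k)"] conjI ballI)
    fix y assume "y \<in> ball x (s (Suc k))"
    then have "\<delta> x < s k / 2" "\<delta> y < s k / 2"
      using True \<delta>_triangle[of y x] s_Suc[of k] s_pos[of "Suc k"] by (auto simp: dist_commute)
    note lip = jump_lipschitz[OF f this(2) this(1)]
    \<comment> \<open>In the product rule the jump is frozen at the centre \<open>x\<close>, which
      makes its factor the one in \<open>gluing k f x\<close>.\<close>
    have "\<eta> k y * jump k f y - \<eta> k x * jump k f x = jump k f x * (\<eta> k y - \<eta> k x) + \<eta> k y * (jump k f y - jump k f x)"
      by (simp add: algebra_simps)
    also have "\<bar>\<dots>\<bar> \<le> \<bar>jump k f x\<bar> * \<bar>\<eta> k y - \<eta> k x\<bar> + \<eta> k y * \<bar>jump k f y - jump k f x\<bar>"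
      using abs_triangle_ineq \<eta>_bounds(1)[of k y] by (metis abs_mult abs_of_nonneg)
    also have "\<dots> \<le> \<bar>jump k f x\<bar> * (4 / s (Suc k) * dist y x) + 1 * ((lip k + lip (Suc k)) * L1 f * dist y x)"
      using \<eta>_lipschitz[of k y x] lip \<eta>_bounds[of k y] by (intro add_mono mult_mono) auto
    also have "\<dots> = (gluing k f x + drift k f x) * dist x y"
      using True by (simp add: gluing_def drift_def \<theta>_eq_1 dist_commute algebra_simps)
    finally show "\<bar>\<eta> k y * jump k f y - \<eta> k x * jump k f x\<bar> \<le> (gluing k f x + drift k f x) * dist x y" .
  qed (rule s_pos)
next
  case False
  show ?thesis
  proof (intro exI[of _ "\<delta> x - s (Suc k) / 2"] conjI ballI)
    fix y assume "y \<in> ball x (\<delta> x - s (Suc k) / 2)"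
    then have "s (Suc k) / 2 \<le> \<delta> y"
      using \<delta>_triangle[of x y] by auto
    then show "\<bar>\<eta> k y * jump k f y - \<eta> k x * jump k f x\<bar> \<le> (gluing k f x + drift k f x) * dist x y"
      using False gluing_nonneg drift_nonneg by (simp add: \<eta>_eq_0)
  qed (use False in simp)
qed

text \<open>A bound centred at one point, as in \<open>term_pointwise_lipschitz\<close>, is not a
  Lipschitz bound on a ball of a general metric space. Here both points vary, and the jump is
  estimated by its supremum near the boundary.\<close>

lemma term_locally_lipschitz:
  assumes f: "integrable B f"
  shows "\<exists>r>0. \<exists>C. C-lipschitz_on (ball x r) (\<lambda>y. \<eta> k y * jump k f y)"
proof (cases "\<delta> x < s (Suc k)")
  case True
  define K where "K = (lip k + lip (Suc k)) * L1 f"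
  have K: "0 \<le> K"
    using lip_nonneg by (simp add: K_def)
  have near: "\<delta> y < s k / 2" if "y \<in> ball x (s k / 4)" for y
    using that True \<delta>_triangle[of y x] s_Suc[of k] by (auto simp: dist_commute)
  have "(K * (4 / s (Suc k)) + K)-lipschitz_on (ball x (s k / 4)) (\<lambda>y. \<eta> k y * jump k f y)"
  proof (rule lipschitz_onI)
    fix y z assume yz: "y \<in> ball x (s k / 4)" "z \<in> ball x (s k / 4)"
    have "\<eta> k y * jump k f y - \<eta> k z * jump k f z = jump k f y * (\<eta> k y - \<eta> k z) + \<eta> k z * (jump k f y - jump k f z)"
      by (simp add: algebra_simps)
    also have "\<bar>\<dots>\<bar> \<le> \<bar>jump k f y\<bar> * \<bar>\<eta> k y - \<eta> k z\<bar> + \<eta> k z * \<bar>jump k f y - jump k f z\<bar>"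
      using abs_triangle_ineq \<eta>_bounds(1)[of k z] by (metis abs_mult abs_of_nonneg)
    also have "\<dots> \<le> K * (4 / s (Suc k) * dist y z) + 1 * (K * dist y z)"
      using \<eta>_lipschitz[of k y z] jump_lipschitz[OF f near near, OF yz] jump_bound[OF f near, OF yz(1)]
        \<eta>_bounds[of k z] K
      by (intro add_mono mult_mono) (auto simp: K_def)
    finally show "dist (\<eta> k y * jump k f y) (\<eta> k z * jump k f z) \<le> (K * (4 / s (Suc k)) + K) * dist y z"
      by (simp add: dist_real_def algebra_simps)
  qed (use K s_pos[of "Suc k"] in simp)
  then show ?thesis
    using s_pos[of k] by (intro exI[of _ "s k / 4"]) auto
next
  case False
  have "\<eta> k y * jump k f y = 0" if "y \<in> ball x (s (Suc k) / 2)" for y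
    using that False \<delta>_triangle[of x y] by (simp add: \<eta>_eq_0)
  then have "0-lipschitz_on (ball x (s (Suc k) / 2)) (\<lambda>y. \<eta> k y * jump k f y)"
    by (intro lipschitz_on_transform[OF lipschitz_on_constant[of _ 0]])
  then show ?thesis
    using s_pos[of "Suc k"] by (intro exI[of _ "s (Suc k) / 2"]) auto
qed

section \<open>Local finiteness and the upper gradient of the extension\<close>

definition depth :: "'a \<Rightarrow> nat" where
  "depth x = (SOME N. \<forall>k\<ge>N. s k < \<delta> x / 2)"

text \<open>On the half ball around \<open>x\<close> the distance to the boundary stays above
  \<open>\<delta> x / 2\<close>, hence above every scale from index \<open>depth x\<close> on. All
  infinite sums thus become finite ones with a common range near \<open>x\<close>.\<close>

lemma locally_finite:
  assumes "x \<in> \<Omega>" "y \<in> ball x (\<delta> x / 2)" "depth x \<le> k"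
  shows "\<eta> k y = 0" "\<theta> k y = 0"
proof -
  have "\<exists>N. \<forall>k\<ge>N. s k < \<delta> x / 2"
    using s_small[of "\<delta> x / 2"] \<delta>_pos[OF assms(1)] by simp
  then have "\<forall>k\<ge>depth x. s k < \<delta> x / 2"
    unfolding depth_def by (rule someI_ex)
  then have "s (Suc k) < \<delta> x / 2"
    using assms(3) by simp
  moreover have "\<delta> x / 2 < \<delta> y"
    using assms(2) \<delta>_triangle[of x y] by simp
  ultimately show "\<eta> k y = 0" "\<theta> k y = 0"
    using s_pos[of "Suc k"] by (simp_all add: \<eta>_eq_0 \<theta>_eq_0)
qed

lemma ext_eq_sum:
  "x \<in> \<Omega> \<Longrightarrow> y \<in> ball x (\<delta> x / 2) \<Longrightarrow> ext f y = (\<Sum>k<depth x. \<eta> k y * jump k f y)"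
  unfolding ext_def by (rule suminf_finite) (auto simp: locally_finite)

lemma grad_eq_sum:
  "x \<in> \<Omega> \<Longrightarrow> y \<in> ball x (\<delta> x / 2) \<Longrightarrow> grad f y = (\<Sum>k<depth x. gluing k f y + drift k f y)"
  unfolding grad_def by (rule suminf_finite) (auto simp: locally_finite gluing_def drift_def)

lemma mem_half_ball: "x \<in> \<Omega> \<Longrightarrow> x \<in> ball x (\<delta> x / 2)"
  using \<delta>_pos by simp

lemma ext_linear:
  assumes "integrable B f" "integrable B g" "x \<in> \<Omega>"
  shows "ext (\<lambda>z. a * f z + b * g z) x = a * ext f x + b * ext g x"
  by (simp add: ext_eq_sum[OF assms(3) mem_half_ball[OF assms(3)]] jump_linear[OF assms(1,2)]
      sum_distrib_left flip: sum.distrib)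
    (simp add: algebra_simps)

lemma ext_cong_AE:
  "integrable B f \<Longrightarrow> integrable B g \<Longrightarrow> AE z in B. f z = g z \<Longrightarrow> ext f x = ext g x"
  by (simp add: ext_def jump_cong_AE[of f g])

lemma ext_locally_lipschitz:
  assumes f: "integrable B f"
  shows "locally_lipschitz_on \<Omega> (ext f)"
  unfolding locally_lipschitz_on_def
proof
  fix x assume x: "x \<in> \<Omega>"
  have "\<exists>r>0. \<exists>C. C-lipschitz_on (ball x r) (\<lambda>y. \<Sum>k<n. \<eta> k y * jump k f y)" for n
  proof (induction n)
    case 0
    have "0-lipschitz_on (ball x 1) (\<lambda>y. \<Sum>k<0. \<eta> k y * jump k f y)"
      by (simp add: lipschitz_on_constant)
    then show ?case
      using zero_less_one by blast
  next
    case (Suc n)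
    then obtain r C where r: "0 < r" "C-lipschitz_on (ball x r) (\<lambda>y. \<Sum>k<n. \<eta> k y * jump k f y)"
      by blast
    obtain q D where q: "0 < q" "D-lipschitz_on (ball x q) (\<lambda>y. \<eta> n y * jump n f y)"
      using term_locally_lipschitz[OF f] by blast
    have "(C + D)-lipschitz_on (ball x (min r q)) (\<lambda>y. (\<Sum>k<n. \<eta> k y * jump k f y) + \<eta> n y * jump n f y)"
      by (intro lipschitz_on_add lipschitz_on_subset[OF r(2)] lipschitz_on_subset[OF q(2)]) auto
    then show ?case
      using r(1) q(1) by (intro exI[of _ "min r q"]) auto
  qed
  then obtain r C where r: "0 < r" "C-lipschitz_on (ball x r) (\<lambda>y. \<Sum>k<depth x. \<eta> k y * jump k f y)"
    by blast
  have "C-lipschitz_on (ball x (min r (\<delta> x / 2)) \<inter> \<Omega>) (ext f)"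
    by (rule lipschitz_on_transform[OF lipschitz_on_subset[OF r(2)]]) (auto simp: ext_eq_sum[OF x])
  then show "\<exists>r>0. \<exists>L. L-lipschitz_on (ball x r \<inter> \<Omega>) (ext f)"
    using r(1) \<delta>_pos[OF x] by (intro exI[of _ "min r (\<delta> x / 2)"]) auto
qed

lemma eventually_nhds_half_ball: "x \<in> \<Omega> \<Longrightarrow> \<forall>\<^sub>F y in nhds x. y \<in> ball x (\<delta> x / 2)"
  using \<delta>_pos by (intro eventually_nhds_in_open) auto

lemma continuous_grad:
  assumes f: "integrable B f"
  shows "continuous_on \<Omega> (grad f)"
proof (rule continuous_at_imp_continuous_on, rule ballI)
  fix x assume x: "x \<in> \<Omega>"
  have "isCont (grad f) x \<longleftrightarrow> isCont (\<lambda>y. \<Sum>k<depth x. gluing k f y + drift k f y) x"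
    by (rule isCont_cong) (use eventually_nhds_half_ball[OF x] grad_eq_sum[OF x] in \<open>auto elim: eventually_mono\<close>)
  moreover have "continuous_on UNIV (\<lambda>y. \<Sum>k<depth x. gluing k f y + drift k f y)"
    by (intro continuous_intros continuous_gluing continuous_drift f)
  ultimately show "isCont (grad f) x"
    by (simp add: continuous_on_eq_continuous_at)
qed

lemma grad_nonneg:
  assumes "x \<in> \<Omega>"
  shows "0 \<le> grad f x"
proof -
  show ?thesis
    using gluing_nonneg drift_nonneg by (simp add: grad_eq_sum[OF assms mem_half_ball[OF assms]] sum_nonneg)
qed

lemma upper_gradient_ext:
  assumes f: "integrable B f"
  shows "upper_gradient \<Omega> (ext f) (\<lambda>x. ennreal (grad f x))"
proof (rule upper_gradientI_continuous)
  show "continuous_on \<Omega> (grad f)"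
    by (rule continuous_grad[OF f])
  show "0 \<le> grad f x" if "x \<in> \<Omega>" for x
    by (rule grad_nonneg[OF that])
  fix x assume x: "x \<in> \<Omega>"
  note x' = mem_half_ball[OF x]
  have "\<forall>\<^sub>F y in nhds x. \<bar>\<eta> k y * jump k f y - \<eta> k x * jump k f x\<bar> \<le> (gluing k f x + drift k f x) * dist x y" for k
    using term_pointwise_lipschitz[OF f, of x k] by (auto simp: eventually_nhds_metric dist_commute)
  then have "\<forall>\<^sub>F y in nhds x. \<forall>k\<in>{..<depth x}. \<bar>\<eta> k y * jump k f y - \<eta> k x * jump k f x\<bar> \<le> (gluing k f x + drift k f x) * dist x y"
    by (intro eventually_ball_finite) auto
  with eventually_nhds_half_ball[OF x]
  have "\<forall>\<^sub>F y in nhds x. \<bar>ext f y - ext f x\<bar> \<le> grad f x * dist x y"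
  proof eventually_elim
    case (elim y)
    have "ext f y - ext f x = (\<Sum>k<depth x. \<eta> k y * jump k f y - \<eta> k x * jump k f x)"
      using ext_eq_sum[OF x elim(1)] ext_eq_sum[OF x x'] by (simp add: sum_subtractf)
    also have "\<bar>\<dots>\<bar> \<le> (\<Sum>k<depth x. (gluing k f x + drift k f x) * dist x y)"
      using elim(2) by (intro order_trans[OF sum_abs] sum_mono) auto
    finally show ?case
      using grad_eq_sum[OF x x'] by (simp add: sum_distrib_right)
  qed
  then show "\<exists>r>0. \<forall>y\<in>ball x r \<inter> \<Omega>. \<bar>ext f y - ext f x\<bar> \<le> grad f x * dist x y"
    by (auto simp: eventually_nhds_metric dist_commute)
qed

text \<open>A cutoff costs its slope, so each term is at most its scale times its own gluing
  gradient. The L^1 bound of the extension therefore follows from the energy bound.\<close>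

lemma abs_ext_le_grad:
  assumes x: "x \<in> \<Omega>"
  shows "\<bar>ext f x\<bar> \<le> s 1 * grad f x"
proof -
  note x' = mem_half_ball[OF x]
  have "\<bar>\<eta> k x * jump k f x\<bar> \<le> s 1 * (gluing k f x + drift k f x)" for k
  proof -
    have "\<bar>\<eta> k x * jump k f x\<bar> \<le> s (Suc k) / 4 * gluing k f x"
      using \<eta>_jump_le_gluing \<eta>_bounds(1) by (simp add: abs_mult)
    also have "\<dots> \<le> s 1 * gluing k f x"
      using s_antimono[of 1 "Suc k"] s_pos[of "Suc k"] gluing_nonneg by (intro mult_right_mono) auto
    also have "\<dots> \<le> s 1 * (gluing k f x + drift k f x)"
      using drift_nonneg s_pos[of 1] by (intro mult_left_mono) auto
    finally show ?thesis .
  qed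
  then have "(\<Sum>k<depth x. \<bar>\<eta> k x * jump k f x\<bar>) \<le> (\<Sum>k<depth x. s 1 * (gluing k f x + drift k f x))"
    by (intro sum_mono)
  then have "\<bar>\<Sum>k<depth x. \<eta> k x * jump k f x\<bar> \<le> s 1 * (\<Sum>k<depth x. gluing k f x + drift k f x)"
    unfolding sum_distrib_left by (intro order_trans[OF sum_abs])
  then show ?thesis
    using ext_eq_sum[OF x x'] grad_eq_sum[OF x x'] by simp
qed

end

section \<open>Energy of the extension\<close>

context codim1_domain
begin

lemma codim1_hausdorff_ball: "codim1_hausdorff M (ball x t \<inter> bd) = ennreal (H x t)"
  by (simp add: B.emeasure_eq_measure flip: emeasure_B_ball)

lemma osc_le_besov_integrand:
  assumes "x \<in> bd" "0 < r" "2 * r < t" "t < 4 * r"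
  shows "osc r f x \<le> (\<integral>\<^sup>+y\<in>ball x t. ennreal \<bar>f y - f x\<bar> \<partial>B) / codim1_hausdorff M (ball x t \<inter> bd)"
proof -
  have pos: "0 < H x t" "0 < H x (4 * r)"
    using assms by (auto intro!: H_pos)
  have "H x t \<le> H x (4 * r)"
    using assms by (intro B.finite_measure_mono) auto
  then have "inverse (ennreal (H x (4 * r))) \<le> inverse (ennreal (H x t))"
    using pos by (simp add: inverse_ennreal)
  moreover have "(\<integral>\<^sup>+y\<in>ball x (2 * r). ennreal \<bar>f y - f x\<bar> \<partial>B) \<le> (\<integral>\<^sup>+y\<in>ball x t. ennreal \<bar>f y - f x\<bar> \<partial>B)"
    using assms by (intro nn_integral_mono) (auto simp: indicator_def)
  ultimately show ?thesis
    unfolding osc_def codim1_hausdorff_ball divide_ennreal_def by (intro mult_mono) auto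
qed

end

context extension_scales
begin

definition En :: "nat \<Rightarrow> ('a \<Rightarrow> real) \<Rightarrow> ennreal" where
  "En k f = (\<integral>\<^sup>+z. osc (s k) f z \<partial>B)"

text \<open>16 is the slope factor 4 of the cutoff times the 4 in \<open>avg_osc\<close>, which also
  contributes \<open>CH\<close>; \<open>CA * CD ^ 3\<close> comes from
  \<open>layer_integral_le\<close>.\<close>

definition C1 :: real where
  "C1 = 16 * CA * CD ^ 3 * CH"

lemma C1_nonneg: "0 \<le> C1"
  using CA CD CH by (simp add: C1_def)

text \<open>The intervals from \<open>2 * s k\<close> to \<open>4 * s k\<close> are disjoint and lie
  below \<open>R\<close>. On each of them the inner Besov integral is at least \<open>En k f\<close>
  and 1/t exceeds \<open>1 / (4 * s k)\<close>; the length \<open>2 * s k\<close> then leaves half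
  of \<open>En k f\<close>.\<close>

lemma suminf_En_le: "(\<Sum>k. En k f) \<le> 2 * besov_norm M \<Omega> R f"
proof -
  define c where "c k = En k f * ennreal (1 / (4 * s k))" for k
  define I where "I k = {2 * s k<..<4 * s k}" for k
  define G where "G t = (\<integral>\<^sup>+x. (\<integral>\<^sup>+y\<in>ball x t. ennreal \<bar>f y - f x\<bar> \<partial>B)
                / codim1_hausdorff M (ball x t \<inter> bd) \<partial>B)" for t
  have disj: "k = j" if "t \<in> I k" "t \<in> I j" for t k j
  proof (rule ccontr)
    assume "k \<noteq> j"
    moreover have False if "t \<in> I k" "t \<in> I j" "k < j" for k j
    proof -
      have "4 * s j \<le> s k"
        using s_antimono[of "Suc k" j] s_Suc[of k] that(3) by simp
      then show False
        using that(1,2) s_pos[of k] by (simp add: I_def)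
    qed
    ultimately show False
      using that by (meson nat_neq_iff)
  qed
  have point: "(\<Sum>k. c k * indicator (I k) t) \<le> G t / ennreal t * indicator {0<..<R} t" for t
  proof (cases "\<exists>j. t \<in> I j")
    case True
    then obtain j where j: "t \<in> I j" by blast
    then have t: "2 * s j < t" "t < 4 * s j"
      by (auto simp: I_def)
    have tR: "0 < t" "t < R"
      using t s_pos[of j] s_antimono[of 0 j] s_0(1) by auto
    have "(\<Sum>k. c k * indicator (I k) t) = (\<Sum>k\<in>{j}. c k * indicator (I k) t)"
      by (rule suminf_finite) (use disj[OF _ j] in \<open>auto simp: indicator_def\<close>)
    also have "\<dots> = En j f * ennreal (1 / (4 * s j))"
      using j by (simp add: c_def)
    also have "\<dots> \<le> G t * inverse (ennreal t)"
    proof (rule mult_mono)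
      show "En j f \<le> G t"
        unfolding En_def G_def using t s_pos[of j]
        by (intro nn_integral_mono osc_le_besov_integrand) auto
      show "ennreal (1 / (4 * s j)) \<le> inverse (ennreal t)"
        using t tR by (simp add: inverse_ennreal field_simps)
    qed auto
    finally show ?thesis
      using tR by (simp add: divide_ennreal_def)
  qed (simp add: indicator_def)
  have "(\<Sum>k. En k f) = (\<Sum>k. 2 * (c k * ennreal (2 * s k)))"
  proof (rule suminf_cong)
    fix k
    have "2 * (c k * ennreal (2 * s k)) = En k f * (2 * (ennreal (1 / (4 * s k)) * ennreal (2 * s k)))"
      by (simp add: c_def mult_ac)
    also have "ennreal (1 / (4 * s k)) * ennreal (2 * s k) = ennreal (1 / 2)"
      using s_pos[of k] by (simp flip: ennreal_mult)
    also have "2 * ennreal (1 / 2) = 1"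
      using ennreal_mult[of 2 "1 / 2"] by simp
    finally show "En k f = 2 * (c k * ennreal (2 * s k))" by simp
  qed
  also have "\<dots> = 2 * (\<Sum>k. c k * ennreal (2 * s k))"
    by simp
  also have "(\<Sum>k. c k * ennreal (2 * s k)) = (\<Sum>k. \<integral>\<^sup>+t. c k * indicator (I k) t \<partial>lborel)"
    using s_pos by (intro suminf_cong) (simp add: I_def nn_integral_cmult_indicator less_imp_le)
  also have "\<dots> = (\<integral>\<^sup>+t. (\<Sum>k. c k * indicator (I k) t) \<partial>lborel)"
    by (rule nn_integral_suminf[symmetric]) (simp add: I_def)
  also have "\<dots> \<le> (\<integral>\<^sup>+t. G t / ennreal t * indicator {0<..<R} t \<partial>lborel)"
    by (rule nn_integral_mono) (rule point)
  also have "\<dots> \<le> besov_norm M \<Omega> R f"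
    unfolding besov_norm_def G_def by simp
  finally show ?thesis
    by (simp add: mult_left_mono)
qed

lemma L1_le_besov: "integrable B f \<Longrightarrow> ennreal (L1 f) \<le> besov_norm M \<Omega> R f"
proof -
  assume f: "integrable B f"
  have "ennreal (L1 f) = (\<integral>\<^sup>+x. ennreal \<bar>f x\<bar> \<partial>B)"
    by (rule nn_integral_eq_integral[symmetric]) (use f in auto)
  then show ?thesis
    by (simp add: besov_norm_def)
qed

section \<open>Integrals of the gluing and drift terms\<close>

lemma measurable_gluing: "integrable B f \<Longrightarrow> gluing k f \<in> borel_measurable M"
  using borel_measurable_continuous_onI[OF continuous_gluing] by (simp add: measurable_cong_sets[OF sets_M refl])

lemma measurable_drift: "drift k f \<in> borel_measurable M"
  using borel_measurable_continuous_onI[OF continuous_drift] by (simp add: measurable_cong_sets[OF sets_M refl])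

text \<open>Both averages in the jump are compared with the same value \<open>f z\<close> at a
  nearby boundary point, which \<open>layer_integral_le\<close> then averages out. The slope, of
  order \<open>1 / q\<close>, cancels against the width \<open>q\<close> of the layer. Sparsity
  ensures that \<open>2 * q\<close> is at most half of either scale, as \<open>avg_osc\<close>
  requires.\<close>

lemma gluing_integral_Suc:
  assumes f: "integrable B f"
  shows "(\<integral>\<^sup>+x\<in>\<Omega>. ennreal (gluing (Suc k) f x) \<partial>M) \<le> ennreal C1 * (En (Suc k) f + En k f)"
proof -
  define q where "q = s (Suc (Suc k))"
  have q: "0 < q" "4 * q \<le> s (Suc k)" "4 * s (Suc k) \<le> s k" "q \<le> diameter \<Omega>"
    using s_pos[of "Suc (Suc k)"] s_Suc[of k] s_Suc[of "Suc k"] four_s_le_diameter[of "Suc (Suc k)"]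
    by (auto simp: q_def)
  have [measurable]: "osc r f \<in> borel_measurable B" for r
    using f by (intro measurable_osc) simp
  define h where "h z = ennreal (16 * CH / q) * (osc (s (Suc k)) f z + osc (s k) f z)" for z
  have [measurable]: "h \<in> borel_measurable B"
    unfolding h_def by measurable
  have "(\<integral>\<^sup>+x\<in>\<Omega>. ennreal (gluing (Suc k) f x) \<partial>M) \<le> (\<integral>\<^sup>+x\<in>layer q. ennreal (gluing (Suc k) f x) \<partial>M)"
    by (intro nn_integral_mono) (auto simp: layer_def q_def indicator_def gluing_def \<theta>_eq_0)
  also have "\<dots> \<le> ennreal (CA * CD ^ 3 * q) * (\<integral>\<^sup>+z. h z \<partial>B)"
  proof (rule layer_integral_le)
    fix x z assume x: "x \<in> layer q" and z: "z \<in> bd" "dist x z < 2 * q"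
    define a b where "a = \<bar>avg (s (Suc k)) f x - f z\<bar>" and "b = \<bar>avg (s k) f x - f z\<bar>"
    have ab: "ennreal a \<le> ennreal (4 * CH) * osc (s (Suc k)) f z" "ennreal b \<le> ennreal (4 * CH) * osc (s k) f z"
      unfolding a_def b_def using q z s_pos[of k] s_pos[of "Suc k"] four_s_le_diameter
      by (intro avg_osc f; auto)+
    have "gluing (Suc k) f x \<le> 1 * (4 * \<bar>jump (Suc k) f x\<bar> / q)"
      unfolding gluing_def q_def using \<theta>_bounds[of "Suc k" x] s_pos[of "Suc (Suc k)"] by (intro mult_right_mono) auto
    also have "\<dots> \<le> 4 / q * (a + b)"
    proof -
      have "\<bar>jump (Suc k) f x\<bar> \<le> a + b"
        by (simp add: jump_def level_def a_def b_def)
      then show ?thesis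
        using q(1) by (simp add: divide_right_mono)
    qed
    finally have "ennreal (gluing (Suc k) f x) \<le> ennreal (4 / q * (a + b))"
      by (rule ennreal_leI)
    also have "\<dots> = ennreal (4 / q) * (ennreal a + ennreal b)"
      using q(1) by (subst ennreal_mult) (auto simp: a_def b_def)
    also have "\<dots> \<le> ennreal (4 / q) * (ennreal (4 * CH) * osc (s (Suc k)) f z + ennreal (4 * CH) * osc (s k) f z)"
      by (intro mult_left_mono add_mono ab) auto
    also have "\<dots> = (ennreal (4 / q) * ennreal (4 * CH)) * (osc (s (Suc k)) f z + osc (s k) f z)"
      by (simp add: algebra_simps)
    also have "ennreal (4 / q) * ennreal (4 * CH) = ennreal (16 * CH / q)"
      using q(1) CH by (subst ennreal_mult[symmetric]) auto
    finally show "ennreal (gluing (Suc k) f x) \<le> h z"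
      by (simp add: h_def)
  qed (use q in auto)
  also have "(\<integral>\<^sup>+z. h z \<partial>B) = ennreal (16 * CH / q) * (En (Suc k) f + En k f)"
    unfolding h_def En_def by (simp add: nn_integral_cmult nn_integral_add)
  also have "ennreal (CA * CD ^ 3 * q) * (ennreal (16 * CH / q) * (En (Suc k) f + En k f))
      = (ennreal (CA * CD ^ 3 * q) * ennreal (16 * CH / q)) * (En (Suc k) f + En k f)"
    by (simp add: mult.assoc)
  also have "ennreal (CA * CD ^ 3 * q) * ennreal (16 * CH / q) = ennreal C1"
    using q(1) CH CA CD by (subst ennreal_mult[symmetric]) (auto simp: C1_def)
  finally show ?thesis .
qed

lemma set_integral_layer_const_le:
  assumes "\<And>x. x \<in> \<Omega> \<Longrightarrow> u x \<le> c * indicator (layer r) x" "0 \<le> c" "c * measure M (layer r) \<le> e"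
  shows "(\<integral>\<^sup>+x\<in>\<Omega>. ennreal (u x) \<partial>M) \<le> ennreal e"
proof -
  have "(\<integral>\<^sup>+x\<in>\<Omega>. ennreal (u x) \<partial>M) \<le> (\<integral>\<^sup>+x. ennreal c * indicator (layer r) x \<partial>M)"
  proof (rule nn_integral_mono)
    fix x
    show "ennreal (u x) * indicator \<Omega> x \<le> ennreal c * indicator (layer r) x"
      using assms(1)[of x] by (auto simp: indicator_def ennreal_leI ennreal_neg split: if_splits)
  qed
  also have "\<dots> = ennreal (c * measure M (layer r))"
    using assms(2) by (simp add: nn_integral_cmult_indicator emeasure_layer ennreal_mult)
  also have "\<dots> \<le> ennreal e"
    using assms(3) by (rule ennreal_leI)
  finally show ?thesis .
qed

text \<open>The first jump starts from the zero function, so no oscillation bounds it. Its size is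
  at most \<open>L (s 0) * L1 f\<close>, and \<open>s_layer\<close> at index 0 absorbs
  \<open>L (s 0)\<close>.\<close>

lemma gluing_integral_0:
  assumes f: "integrable B f"
  shows "(\<integral>\<^sup>+x\<in>\<Omega>. ennreal (gluing 0 f x) \<partial>M) \<le> ennreal (4 / s 1 * L1 f)"
proof (rule set_integral_layer_const_le)
  show "0 \<le> 4 * (L (s 0) * L1 f) / s 1"
    using L_pos[OF s_pos[of 0]] s_pos[of 1] by simp
  show "gluing 0 f x \<le> 4 * (L (s 0) * L1 f) / s 1 * indicator (layer (s 1)) x" if "x \<in> \<Omega>" for x
  proof (cases "x \<in> layer (s 1)")
    case True
    then have "\<delta> x < s 0 / 2"
      using s_Suc[of 0] s_pos[of 0] by (simp add: layer_def)
    then have "\<bar>jump 0 f x\<bar> \<le> L (s 0) * L1 f"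
      using jump_bound[OF f, of x 0] by (simp add: lip_def)
    then have "\<theta> 0 x * (4 * \<bar>jump 0 f x\<bar> / s 1) \<le> 1 * (4 * (L (s 0) * L1 f) / s 1)"
      using \<theta>_bounds[of 0 x] s_pos[of 1] by (intro mult_mono divide_right_mono) auto
    then show ?thesis
      using True by (simp add: gluing_def)
  next
    case False
    then show ?thesis
      using that by (simp add: layer_def gluing_def \<theta>_eq_0)
  qed
  have "L (s 0) * measure M (layer (s 1)) * (4 / s 1 * L1 f) \<le> 1 * (4 / s 1 * L1 f)"
    using s_layer[of 0] s_pos[of 1] by (intro mult_right_mono) auto
  then show "4 * (L (s 0) * L1 f) / s 1 * measure M (layer (s 1)) \<le> 4 / s 1 * L1 f"
    by (simp add: mult_ac)
qed

text \<open>Here the thinness of the layers pays for the Lipschitz constants.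
  \<open>lip (Suc k)\<close> meets exactly its own layer condition. \<open>lip k\<close> belongs to
  the condition of index \<open>k - 1\<close>, which is weaker by a factor 2, whence 1 + 2 =
  3.\<close>

lemma drift_integral:
  "(\<integral>\<^sup>+x\<in>\<Omega>. ennreal (drift k f x) \<partial>M) \<le> ennreal (3 * (1 / 2) ^ k * L1 f)"
proof (rule set_integral_layer_const_le)
  show "0 \<le> (lip k + lip (Suc k)) * L1 f"
    using lip_nonneg by simp
  show "drift k f x \<le> (lip k + lip (Suc k)) * L1 f * indicator (layer (s (Suc k))) x" if "x \<in> \<Omega>" for x
  proof (cases "x \<in> layer (s (Suc k))")
    case True
    have "drift k f x \<le> 1 * ((lip k + lip (Suc k)) * L1 f)"
      unfolding drift_def using \<theta>_bounds lip_nonneg by (intro mult_right_mono) auto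
    with True show ?thesis by simp
  next
    case False
    then show ?thesis
      using that by (simp add: layer_def drift_def \<theta>_eq_0)
  qed
  have "lip k * measure M (layer (s (Suc k))) \<le> 2 * (1 / 2) ^ k"
  proof (cases k)
    case (Suc j)
    have "L (s j) * measure M (layer (s (Suc k))) \<le> L (s j) * measure M (layer (s (Suc j)))"
      using L_pos[OF s_pos[of j]] Suc by (intro mult_left_mono measure_layer_mono s_antimono) auto
    also have "\<dots> \<le> (1 / 2) ^ j"
      by (rule s_layer)
    finally show ?thesis
      using Suc by (simp add: lip_def)
  qed (simp add: lip_def)
  moreover have "lip (Suc k) * measure M (layer (s (Suc k))) \<le> (1 / 2) ^ k"
    using s_layer[of k] by (simp add: lip_def)
  ultimately have "(lip k + lip (Suc k)) * measure M (layer (s (Suc k))) \<le> 3 * (1 / 2) ^ k"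
    by (simp add: distrib_right)
  then have "(lip k + lip (Suc k)) * measure M (layer (s (Suc k))) * L1 f \<le> 3 * (1 / 2) ^ k * L1 f"
    by (rule mult_right_mono) simp
  then show "(lip k + lip (Suc k)) * L1 f * measure M (layer (s (Suc k))) \<le> 3 * (1 / 2) ^ k * L1 f"
    by (simp add: mult_ac)
qed

lemma suminf_En_shift_le: "(\<Sum>k. En (k + n) f) \<le> (\<Sum>k. En k f)"
  by (subst (2) suminf_offset[of _ n]) auto

lemma gluing_integral_sum:
  assumes f: "integrable B f"
  shows "(\<Sum>k. \<integral>\<^sup>+x\<in>\<Omega>. ennreal (gluing (Suc k) f x) \<partial>M) \<le> ennreal (2 * C1) * (\<Sum>k. En k f)"
proof -
  have "(\<Sum>k. \<integral>\<^sup>+x\<in>\<Omega>. ennreal (gluing (Suc k) f x) \<partial>M) \<le> (\<Sum>k. ennreal C1 * (En (Suc k) f + En k f))"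
    by (intro suminf_le gluing_integral_Suc f) auto
  also have "\<dots> = ennreal C1 * ((\<Sum>k. En (Suc k) f) + (\<Sum>k. En k f))"
    by (simp add: suminf_add)
  also have "\<dots> \<le> ennreal C1 * ((\<Sum>k. En k f) + (\<Sum>k. En k f))"
    using suminf_En_shift_le[of 1 f] by (intro mult_left_mono add_mono) auto
  also have "\<dots> = ennreal (2 * C1) * (\<Sum>k. En k f)"
    using C1_nonneg by (simp add: ennreal_mult mult_ac flip: mult_2)
  finally show ?thesis .
qed

text \<open>\<open>4 / s 1\<close> is the first gluing, 6 the geometric sum of the drifts.
  \<open>4 * C1\<close> arises because every \<open>En k f\<close> bounds parts of two consecutive
  gluings and \<open>suminf_En_le\<close> has another factor 2.\<close>

lemma grad_integral_le:
  assumes f: "integrable B f"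
  shows "(\<integral>\<^sup>+x\<in>\<Omega>. ennreal (grad f x) \<partial>M) \<le> ennreal (4 / s 1 + 6 + 4 * C1) * besov_norm M \<Omega> R f"
proof -
  let ?N = "besov_norm M \<Omega> R f"
  have [measurable]: "gluing k f \<in> borel_measurable M" "drift k f \<in> borel_measurable M" for k
    using measurable_gluing[OF f] measurable_drift by auto
  have "(\<integral>\<^sup>+x\<in>\<Omega>. ennreal (grad f x) \<partial>M)
      = (\<integral>\<^sup>+x. (\<Sum>k. ennreal (gluing k f x) * indicator \<Omega> x + ennreal (drift k f x) * indicator \<Omega> x) \<partial>M)"
  proof (rule nn_integral_cong)
    fix x
    show "ennreal (grad f x) * indicator \<Omega> x
        = (\<Sum>k. ennreal (gluing k f x) * indicator \<Omega> x + ennreal (drift k f x) * indicator \<Omega> x)"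
    proof (cases "x \<in> \<Omega>")
      case True
      have "summable (\<lambda>k. gluing k f x + drift k f x)"
        by (rule summable_finite[of "{..<depth x}"])
          (use locally_finite[OF True mem_half_ball[OF True]] in \<open>auto simp: gluing_def drift_def\<close>)
      then have "ennreal (grad f x) = (\<Sum>k. ennreal (gluing k f x + drift k f x))"
        unfolding grad_def using gluing_nonneg drift_nonneg by (intro suminf_ennreal2[symmetric]) auto
      then show ?thesis
        using True gluing_nonneg drift_nonneg by simp
    qed simp
  qed
  also have "\<dots> = (\<Sum>k. (\<integral>\<^sup>+x\<in>\<Omega>. ennreal (gluing k f x) \<partial>M) + (\<integral>\<^sup>+x\<in>\<Omega>. ennreal (drift k f x) \<partial>M))"
    by (subst nn_integral_suminf) (auto simp: nn_integral_add)
  also have "\<dots> = (\<Sum>k. \<integral>\<^sup>+x\<in>\<Omega>. ennreal (gluing k f x) \<partial>M) + (\<Sum>k. \<integral>\<^sup>+x\<in>\<Omega>. ennreal (drift k f x) \<partial>M)"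
    by (rule suminf_add[symmetric]) auto
  also have "\<dots> \<le> (ennreal (2 * C1) * (2 * ?N) + ennreal (4 / s 1) * ?N) + ennreal 6 * ?N"
  proof (rule add_mono)
    have "(\<Sum>k. \<integral>\<^sup>+x\<in>\<Omega>. ennreal (gluing k f x) \<partial>M)
        = (\<Sum>k. \<integral>\<^sup>+x\<in>\<Omega>. ennreal (gluing (Suc k) f x) \<partial>M) + (\<integral>\<^sup>+x\<in>\<Omega>. ennreal (gluing 0 f x) \<partial>M)"
      by (subst suminf_offset[of _ 1]) auto
    also have "\<dots> \<le> ennreal (2 * C1) * (2 * ?N) + ennreal (4 / s 1) * ?N"
    proof (rule add_mono)
      show "(\<Sum>k. \<integral>\<^sup>+x\<in>\<Omega>. ennreal (gluing (Suc k) f x) \<partial>M) \<le> ennreal (2 * C1) * (2 * ?N)"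
        using gluing_integral_sum[OF f] suminf_En_le[of f] by (meson mult_left_mono order_trans zero_le)
      have "(\<integral>\<^sup>+x\<in>\<Omega>. ennreal (gluing 0 f x) \<partial>M) \<le> ennreal (4 / s 1) * ennreal (L1 f)"
        using gluing_integral_0[OF f] s_pos[of 1] by (subst ennreal_mult[symmetric]) auto
      also have "\<dots> \<le> ennreal (4 / s 1) * ?N"
        using L1_le_besov[OF f] by (rule mult_left_mono) auto
      finally show "(\<integral>\<^sup>+x\<in>\<Omega>. ennreal (gluing 0 f x) \<partial>M) \<le> ennreal (4 / s 1) * ?N" .
    qed
    finally show "(\<Sum>k. \<integral>\<^sup>+x\<in>\<Omega>. ennreal (gluing k f x) \<partial>M) \<le> ennreal (2 * C1) * (2 * ?N) + ennreal (4 / s 1) * ?N" .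
    have "(\<Sum>k. \<integral>\<^sup>+x\<in>\<Omega>. ennreal (drift k f x) \<partial>M) \<le> (\<Sum>k. ennreal (3 * (1 / 2) ^ k * L1 f))"
      by (intro suminf_le drift_integral) auto
    also have "\<dots> = ennreal (6 * L1 f)"
    proof (rule suminf_ennreal_eq)
      show "(\<lambda>k. 3 * (1 / 2) ^ k * L1 f) sums (6 * L1 f)"
        using sums_mult2[OF sums_mult[OF geometric_sums[of "1 / 2 :: real"], of 3], of "L1 f"] by simp
    qed simp
    also have "\<dots> = ennreal 6 * ennreal (L1 f)"
      by (subst ennreal_mult) auto
    also have "\<dots> \<le> ennreal 6 * ?N"
      using L1_le_besov[OF f] by (rule mult_left_mono) auto
    finally show "(\<Sum>k. \<integral>\<^sup>+x\<in>\<Omega>. ennreal (drift k f x) \<partial>M) \<le> ennreal 6 * ?N" .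
  qed
  also have "ennreal (2 * C1) * (2 * ?N) = ennreal (4 * C1) * ?N"
  proof -
    have "ennreal (2 * C1) * (2 * ?N) = (ennreal (2 * C1) * ennreal 2) * ?N"
      by (simp add: mult.assoc)
    also have "ennreal (2 * C1) * ennreal 2 = ennreal (4 * C1)"
      using C1_nonneg by (subst ennreal_mult[symmetric]) auto
    finally show ?thesis .
  qed
  also have "(ennreal (4 * C1) * ?N + ennreal (4 / s 1) * ?N) + ennreal 6 * ?N
      = (ennreal (4 * C1) + ennreal (4 / s 1) + ennreal 6) * ?N"
    by (simp add: distrib_right)
  also have "ennreal (4 * C1) + ennreal (4 / s 1) + ennreal 6 = ennreal (4 / s 1 + 6 + 4 * C1)"
  proof -
    have "ennreal a + ennreal b + ennreal c = ennreal (b + c + a)" if "0 \<le> a" "0 \<le> b" "0 \<le> c" for a b c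
      using that by (simp add: ac_simps flip: ennreal_plus)
    then show ?thesis
      using C1_nonneg s_pos[of 1] by simp
  qed
  finally show ?thesis .
qed

text \<open>Being locally Lipschitz, the extension competes in the relaxation as a constant
  sequence.\<close>

lemma total_variation_ext_le:
  assumes f: "integrable B f"
  shows "total_variation M \<Omega> (ext f) \<le> (\<integral>\<^sup>+x\<in>\<Omega>. ennreal (grad f x) \<partial>M)"
proof -
  have "total_variation M \<Omega> (ext f) \<le> liminf (\<lambda>i::nat. upper_gradient_energy M \<Omega> (ext f))"
    unfolding total_variation_def
    by (rule INF_lower2[of "\<lambda>_. ext f"]) (auto simp: ext_locally_lipschitz[OF f])
  also have "\<dots> = upper_gradient_energy M \<Omega> (ext f)"
    by (simp add: Liminf_const)
  also have "\<dots> \<le> (\<integral>\<^sup>+x\<in>\<Omega>. ennreal (grad f x) \<partial>M)"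
    unfolding upper_gradient_energy_def by (rule INF_lower) (simp add: upper_gradient_ext[OF f])
  finally show ?thesis .
qed

lemma BV_norm_ext_le:
  assumes f: "integrable B f"
  shows "BV_norm M \<Omega> (ext f) \<le> ennreal ((s 1 + 1) * (4 / s 1 + 6 + 4 * C1)) * besov_norm M \<Omega> R f"
proof -
  let ?G = "\<integral>\<^sup>+x\<in>\<Omega>. ennreal (grad f x) \<partial>M"
  have [measurable]: "(\<lambda>x. ennreal (grad f x) * indicator \<Omega> x) \<in> borel_measurable M"
  proof -
    have "(\<lambda>x. indicator \<Omega> x *\<^sub>R grad f x) \<in> borel_measurable M"
      using borel_measurable_continuous_on_indicator[OF _ continuous_grad[OF f]] open_domain
      by (simp add: measurable_cong_sets[OF sets_M refl])
    then have "(\<lambda>x. ennreal (indicator \<Omega> x *\<^sub>R grad f x)) \<in> borel_measurable M"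
      by measurable
    also have "(\<lambda>x. ennreal (indicator \<Omega> x *\<^sub>R grad f x)) = (\<lambda>x. ennreal (grad f x) * indicator \<Omega> x)"
      by (auto simp: indicator_def)
    finally show ?thesis .
  qed
  have "(\<integral>\<^sup>+x\<in>\<Omega>. ennreal \<bar>ext f x\<bar> \<partial>M) \<le> (\<integral>\<^sup>+x. ennreal (s 1) * (ennreal (grad f x) * indicator \<Omega> x) \<partial>M)"
  proof (rule nn_integral_mono)
    fix x
    show "ennreal \<bar>ext f x\<bar> * indicator \<Omega> x \<le> ennreal (s 1) * (ennreal (grad f x) * indicator \<Omega> x)"
      using abs_ext_le_grad[of x f] grad_nonneg[of x f] s_pos[of 1]
      by (auto simp: indicator_def ennreal_leI simp flip: ennreal_mult)
  qed
  also have "\<dots> = ennreal (s 1) * ?G"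
    by (rule nn_integral_cmult) measurable
  finally have "BV_norm M \<Omega> (ext f) \<le> ennreal (s 1) * ?G + ?G"
    unfolding BV_norm_def by (rule add_mono[OF _ total_variation_ext_le[OF f]])
  also have "\<dots> = ennreal (s 1 + 1) * ?G"
    using s_pos[of 1] by (simp add: distrib_right less_imp_le)
  also have "\<dots> \<le> ennreal (s 1 + 1) * (ennreal (4 / s 1 + 6 + 4 * C1) * besov_norm M \<Omega> R f)"
    by (rule mult_left_mono[OF grad_integral_le[OF f]]) simp
  also have "\<dots> = ennreal ((s 1 + 1) * (4 / s 1 + 6 + 4 * C1)) * besov_norm M \<Omega> R f"
    using s_pos[of 1] C1_nonneg by (subst ennreal_mult) (auto simp: mult.assoc)
  finally show ?thesis .
qed

lemma continuous_ext:
  assumes f: "integrable B f"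
  shows "continuous_on \<Omega> (ext f)"
proof (rule continuous_at_imp_continuous_on, rule ballI)
  fix x assume x: "x \<in> \<Omega>"
  then obtain r C where r: "0 < r" "C-lipschitz_on (ball x r \<inter> \<Omega>) (ext f)"
    using ext_locally_lipschitz[OF f] unfolding locally_lipschitz_on_def by blast
  then have "continuous_on (ball x r \<inter> \<Omega>) (ext f)"
    by (intro lipschitz_on_continuous_on)
  then show "isCont (ext f) x"
    using r(1) x open_domain by (subst (asm) continuous_on_eq_continuous_at) auto
qed

lemma ext_in_BV_space:
  assumes "f \<in> besov_space M \<Omega> R"
  shows "ext f \<in> BV_space M \<Omega>"
proof -
  have f: "integrable B f" and fin: "besov_norm M \<Omega> R f < \<infinity>"
    using assms by (auto simp: besov_space_def)
  have BV: "BV_norm M \<Omega> (ext f) < \<infinity>"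
    using BV_norm_ext_le[OF f] fin by (auto simp: ennreal_mult_less_top elim: order_le_less_trans)
  have "integrable M (\<lambda>x. indicator \<Omega> x *\<^sub>R ext f x)"
  proof (rule integrableI_bounded)
    show "(\<lambda>x. indicator \<Omega> x *\<^sub>R ext f x) \<in> borel_measurable M"
      using borel_measurable_continuous_on_indicator[OF _ continuous_ext[OF f]] open_domain
      by (simp add: measurable_cong_sets[OF sets_M refl])
    have "(\<integral>\<^sup>+x. ennreal (norm (indicator \<Omega> x *\<^sub>R ext f x)) \<partial>M) = (\<integral>\<^sup>+x\<in>\<Omega>. ennreal \<bar>ext f x\<bar> \<partial>M)"
      by (intro nn_integral_cong) (auto simp: indicator_def)
    also have "\<dots> \<le> BV_norm M \<Omega> (ext f)"
      by (simp add: BV_norm_def)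
    finally show "(\<integral>\<^sup>+x. ennreal (norm (indicator \<Omega> x *\<^sub>R ext f x)) \<partial>M) < \<infinity>"
      using BV by (rule order_le_less_trans)
  qed
  with BV show ?thesis
    by (simp add: BV_space_def set_integrable_def)
qed

end

section \<open>The trace of the extension\<close>

context extension_scales
begin

text \<open>A majorant, not depending on a boundary point, for the terms of \<open>ext\<close> from
  index \<open>m\<close> on, by \<open>\<eta>_jump_le_gluing\<close>. It carries the layers that are
  too thin to be compared with \<open>f z\<close>.\<close>

definition tail :: "nat \<Rightarrow> ('a \<Rightarrow> real) \<Rightarrow> 'a \<Rightarrow> ennreal" where
  "tail m f x = (\<Sum>n. ennreal (s (Suc (n + m)) / 4 * gluing (n + m) f x))"

text \<open>The terms up to index \<open>j\<close> have cutoff 1 and telescope to the average at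
  \<open>s j\<close>. The next two may be partially cut off, but their averages still see
  \<open>z\<close> and are controlled by \<open>avg_osc\<close>. From index \<open>j + 3\<close> on
  the terms go into \<open>tail\<close>.\<close>

lemma ext_near_boundary:
  assumes f: "integrable B f" and x: "x \<in> \<Omega>" and z: "z \<in> bd" "dist x z < s (Suc (Suc j)) / 2"
  shows "ennreal \<bar>ext f x - f z\<bar>
    \<le> ennreal (8 * CH) * (osc (s j) f z + osc (s (Suc j)) f z + osc (s (Suc (Suc j))) f z)
      + tail (Suc (Suc (Suc j))) f x"
proof -
  define m where "m = Suc (Suc (Suc j))"
  have d: "\<delta> x < s (Suc (Suc j)) / 2"
    using z unfolding \<delta>_less_iff by blast
  have \<eta>1: "\<eta> i x = 1" if "i < Suc j" for i
  proof (rule \<eta>_eq_1)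
    have "s (Suc j) \<le> s (Suc i)"
      using that by (intro s_antimono) auto
    then show "\<delta> x \<le> s (Suc i) / 4"
      using d s_Suc[of "Suc j"] s_pos[of "Suc j"] by simp
  qed
  have lf: "\<eta> n x = 0" if "depth x \<le> n" for n
    using locally_finite(1)[OF x mem_half_ball[OF x] that] .
  have sum: "summable (\<lambda>n. \<eta> n x * jump n f x)"
    by (rule summable_finite[of "{..<depth x}"]) (use lf in auto)
  have sumt: "summable (\<lambda>n. \<bar>\<eta> (n + m) x * jump (n + m) f x\<bar>)"
    by (rule summable_finite[of "{..<depth x}"]) (use lf in auto)
  define t where "t = (\<Sum>n. \<eta> (n + m) x * jump (n + m) f x)"
  have t: "ennreal \<bar>t\<bar> \<le> tail m f x"
  proof -
    have "ennreal \<bar>t\<bar> \<le> ennreal (\<Sum>n. \<bar>\<eta> (n + m) x * jump (n + m) f x\<bar>)"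
      unfolding t_def by (intro ennreal_leI summable_rabs sumt)
    also have "\<dots> = (\<Sum>n. ennreal \<bar>\<eta> (n + m) x * jump (n + m) f x\<bar>)"
      by (rule suminf_ennreal2[symmetric]) (use sumt in auto)
    also have "\<dots> \<le> tail m f x"
      unfolding tail_def using \<eta>_jump_le_gluing \<eta>_bounds(1)
      by (intro suminf_le ennreal_leI) (auto simp: abs_mult)
    finally show ?thesis .
  qed
  have "ext f x = t + (\<Sum>n<m. \<eta> n x * jump n f x)"
    unfolding ext_def t_def by (rule suminf_split_initial_segment[OF sum])
  also have "(\<Sum>n<m. \<eta> n x * jump n f x) = (\<Sum>n<Suc j. jump n f x)
      + \<eta> (Suc j) x * jump (Suc j) f x + \<eta> (Suc (Suc j)) x * jump (Suc (Suc j)) f x"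
    by (simp add: m_def \<eta>1)
  also have "(\<Sum>n<Suc j. jump n f x) = avg (s j) f x"
    using sum_lessThan_telescope[of "\<lambda>n. level n f x" "Suc j"] by (simp add: jump_def level_def)
  finally have eq: "ext f x = t + (avg (s j) f x
      + \<eta> (Suc j) x * (avg (s (Suc j)) f x - avg (s j) f x)
      + \<eta> (Suc (Suc j)) x * (avg (s (Suc (Suc j))) f x - avg (s (Suc j)) f x))"
    by (simp add: jump_def level_def)
  define a where "a i = \<bar>avg (s i) f x - f z\<bar>" for i
  have a: "ennreal (a i) \<le> ennreal (4 * CH) * osc (s i) f z" if "i \<le> Suc (Suc j)" for i
    unfolding a_def using z s_antimono[OF that] four_s_le_diameter s_pos[of i] by (intro avg_osc f) auto
  have \<eta>mult: "\<bar>\<eta> k x * r\<bar> \<le> \<bar>r\<bar>" for k r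
    using mult_right_mono[OF \<eta>_bounds(2)[of k x], of "\<bar>r\<bar>"] \<eta>_bounds(1)[of k x] by (simp add: abs_mult)
  have "\<bar>ext f x - f z\<bar> \<le> 2 * (a j + a (Suc j) + a (Suc (Suc j))) + \<bar>t\<bar>"
  proof -
    \<comment> \<open>Inserting \<open>c\<close> into both differences makes the deviations of the
      two coarser averages occur twice.\<close>
    have "\<bar>t' + (a\<^sub>0 + u + v) - c\<bar> \<le> 2 * (\<bar>a\<^sub>0 - c\<bar> + \<bar>a\<^sub>1 - c\<bar> + \<bar>a\<^sub>2 - c\<bar>) + \<bar>t'\<bar>"
      if "\<bar>u\<bar> \<le> \<bar>a\<^sub>1 - a\<^sub>0\<bar>" "\<bar>v\<bar> \<le> \<bar>a\<^sub>2 - a\<^sub>1\<bar>" for t' a\<^sub>0 a\<^sub>1 a\<^sub>2 u v c :: real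
      using that by (smt (verit))
    then show ?thesis
      unfolding eq a_def using \<eta>mult by blast
  qed
  then have "ennreal \<bar>ext f x - f z\<bar> \<le> ennreal (2 * (a j + a (Suc j) + a (Suc (Suc j))) + \<bar>t\<bar>)"
    by (rule ennreal_leI)
  also have "\<dots> = 2 * (ennreal (a j) + ennreal (a (Suc j)) + ennreal (a (Suc (Suc j)))) + ennreal \<bar>t\<bar>"
    by (simp add: a_def ennreal_mult)
  also have "\<dots> \<le> 2 * (ennreal (4 * CH) * osc (s j) f z + ennreal (4 * CH) * osc (s (Suc j)) f z
      + ennreal (4 * CH) * osc (s (Suc (Suc j))) f z) + tail m f x"
    by (intro add_mono mult_left_mono a t) auto
  also have "2 * (ennreal (4 * CH) * osc (s j) f z + ennreal (4 * CH) * osc (s (Suc j)) f z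
      + ennreal (4 * CH) * osc (s (Suc (Suc j))) f z)
      = (2 * ennreal (4 * CH)) * (osc (s j) f z + osc (s (Suc j)) f z + osc (s (Suc (Suc j))) f z)"
    by (simp add: algebra_simps)
  also have "2 * ennreal (4 * CH) = ennreal (8 * CH)"
    using CH ennreal_mult[of 2 "4 * CH"] by simp
  finally show ?thesis
    by (simp add: m_def)
qed

lemma measurable_tail:
  assumes "integrable B f"
  shows "tail m f \<in> borel_measurable M"
proof -
  have [measurable]: "gluing k f \<in> borel_measurable M" for k
    by (rule measurable_gluing[OF assms])
  show ?thesis
    unfolding tail_def by measurable
qed

text \<open>Each term of \<open>tail\<close> carries its scale as a factor, and the scales are at
  most \<open>s (Suc (Suc m))\<close>. What remains is the summable gluing energy.\<close>

lemma tail_integral_le: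
  assumes f: "integrable B f"
  shows "(\<integral>\<^sup>+x\<in>\<Omega>. tail (Suc m) f x \<partial>M) \<le> ennreal (s (Suc (Suc m))) * (ennreal C1 * (\<Sum>k. En k f))"
proof -
  have [measurable]: "gluing k f \<in> borel_measurable M" for k
    by (rule measurable_gluing[OF f])
  define q where "q = s (Suc (Suc m))"
  have q: "0 < q"
    by (simp add: q_def s_pos)
  have "(\<integral>\<^sup>+x\<in>\<Omega>. tail (Suc m) f x \<partial>M)
      \<le> (\<integral>\<^sup>+x. (\<Sum>n. ennreal (q / 4) * (ennreal (gluing (Suc (n + m)) f x) * indicator \<Omega> x)) \<partial>M)"
  proof (rule nn_integral_mono)
    fix x
    have "tail (Suc m) f x \<le> (\<Sum>n. ennreal (q / 4) * ennreal (gluing (Suc (n + m)) f x))"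
      unfolding tail_def
    proof (intro suminf_le)
      fix n
      have "s (Suc (n + Suc m)) \<le> q"
        unfolding q_def by (rule s_antimono) simp
      then have "s (Suc (n + Suc m)) / 4 * gluing (Suc (n + m)) f x \<le> q / 4 * gluing (Suc (n + m)) f x"
        using gluing_nonneg by (intro mult_right_mono) auto
      then show "ennreal (s (Suc (n + Suc m)) / 4 * gluing (n + Suc m) f x) \<le> ennreal (q / 4) * ennreal (gluing (Suc (n + m)) f x)"
        using q by (simp add: ennreal_leI flip: ennreal_mult')
    qed auto
    then show "tail (Suc m) f x * indicator \<Omega> x
        \<le> (\<Sum>n. ennreal (q / 4) * (ennreal (gluing (Suc (n + m)) f x) * indicator \<Omega> x))"
      by (simp add: indicator_def)
  qed
  also have "\<dots> = (\<Sum>n. ennreal (q / 4) * (\<integral>\<^sup>+x\<in>\<Omega>. ennreal (gluing (Suc (n + m)) f x) \<partial>M))"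
    by (subst nn_integral_suminf) (auto simp: nn_integral_cmult)
  also have "\<dots> = ennreal (q / 4) * (\<Sum>n. \<integral>\<^sup>+x\<in>\<Omega>. ennreal (gluing (Suc (n + m)) f x) \<partial>M)"
    by simp
  also have "(\<Sum>n. \<integral>\<^sup>+x\<in>\<Omega>. ennreal (gluing (Suc (n + m)) f x) \<partial>M) \<le> (\<Sum>n. \<integral>\<^sup>+x\<in>\<Omega>. ennreal (gluing (Suc n) f x) \<partial>M)"
    by (subst (2) suminf_offset[of _ m]) auto
  also have "\<dots> \<le> ennreal (2 * C1) * (\<Sum>k. En k f)"
    by (rule gluing_integral_sum[OF f])
  also have "ennreal (q / 4) * (ennreal (2 * C1) * (\<Sum>k. En k f)) = ennreal (q / 2 * C1) * (\<Sum>k. En k f)"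
  proof -
    have "ennreal (q / 4) * ennreal (2 * C1) = ennreal (q / 2 * C1)"
      using q C1_nonneg by (subst ennreal_mult[symmetric]) auto
    then show ?thesis
      by (simp flip: mult.assoc)
  qed
  also have "\<dots> \<le> ennreal (q * C1) * (\<Sum>k. En k f)"
    using q C1_nonneg by (intro mult_right_mono ennreal_leI) auto
  also have "\<dots> = ennreal q * (ennreal C1 * (\<Sum>k. En k f))"
    using q C1_nonneg by (simp add: ennreal_mult mult.assoc)
  finally show ?thesis
    by (simp add: q_def mult_left_mono)
qed

lemma ext_mean_deviation_le:
  assumes f: "integrable B f" and z: "z \<in> bd"
    and r: "s (Suc (Suc (Suc j))) / 2 \<le> r" "r < s (Suc (Suc j)) / 2"
  shows "(\<integral>\<^sup>+y\<in>ball z r \<inter> \<Omega>. ennreal \<bar>ext f y - f z\<bar> \<partial>M) / emeasure M (ball z r \<inter> \<Omega>)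
    \<le> ennreal (8 * CH) * (osc (s j) f z + osc (s (Suc j)) f z + osc (s (Suc (Suc j))) f z)
      + ennreal C1 * (\<Sum>k. En k f) * ennreal ((1 / 2) ^ j)"
proof -
  define m where "m = Suc (Suc (Suc j))"
  define K where "K = ennreal (8 * CH) * (osc (s j) f z + osc (s (Suc j)) f z + osc (s (Suc (Suc j))) f z)"
  define S where "S = ennreal C1 * (\<Sum>k. En k f)"
  define D where "D = measure M (ball z r \<inter> \<Omega>)"
  have rpos: "0 < r"
    using r(1) s_pos[of "Suc (Suc (Suc j))"] by linarith
  have D: "0 < D" "emeasure M (ball z r \<inter> \<Omega>) = ennreal D"
    using measure_ball_Int_domain_pos[OF z rpos] by (auto simp: D_def emeasure_subset_domain)
  have [measurable]: "ball z r \<inter> \<Omega> \<in> sets M"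
    using open_domain by (auto simp: sets_M)
  note [measurable] = measurable_tail[OF f]
  \<comment> \<open>The tail is integrated over all of \<Omega> but divided by the measure of
    \<open>ball z r \<inter> \<Omega>\<close> only. The density condition at index \<open>m\<close>
    makes up for this, as \<open>r\<close> is at least \<open>s m / 2\<close>.\<close>
  have "s (Suc m) \<le> (1 / 2) ^ m * measure M (ball z (s m / 2) \<inter> \<Omega>)"
    by (rule s_density[OF z])
  also have "\<dots> \<le> (1 / 2) ^ j * D"
    unfolding D_def m_def
    by (intro mult_mono power_decreasing measure_ball_Int_domain_mono) (use r(1) in auto)
  finally have sm: "s (Suc m) \<le> (1 / 2) ^ j * D" .
  have "(\<integral>\<^sup>+y\<in>ball z r \<inter> \<Omega>. ennreal \<bar>ext f y - f z\<bar> \<partial>M)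
      \<le> (\<integral>\<^sup>+y. K * indicator (ball z r \<inter> \<Omega>) y + tail m f y * indicator \<Omega> y \<partial>M)"
  proof (rule nn_integral_mono)
    fix y
    show "ennreal \<bar>ext f y - f z\<bar> * indicator (ball z r \<inter> \<Omega>) y
        \<le> K * indicator (ball z r \<inter> \<Omega>) y + tail m f y * indicator \<Omega> y"
      using ext_near_boundary[OF f _ z, of y j] r(2)
      by (auto simp: indicator_def K_def m_def dist_commute)
  qed
  also have "\<dots> = K * ennreal D + (\<integral>\<^sup>+y\<in>\<Omega>. tail m f y \<partial>M)"
    by (subst nn_integral_add) (auto simp: nn_integral_cmult_indicator D(2))
  also have "\<dots> \<le> K * ennreal D + ennreal (s (Suc m)) * S"
    unfolding m_def S_def by (intro add_left_mono tail_integral_le f)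
  also have "\<dots> \<le> K * ennreal D + ennreal ((1 / 2) ^ j * D) * S"
    using sm by (intro add_left_mono mult_right_mono ennreal_leI) auto
  also have "\<dots> = (K + S * ennreal ((1 / 2) ^ j)) * ennreal D"
    using D(1) by (simp add: ennreal_mult algebra_simps)
  finally have "(\<integral>\<^sup>+y\<in>ball z r \<inter> \<Omega>. ennreal \<bar>ext f y - f z\<bar> \<partial>M) / ennreal D
      \<le> (K + S * ennreal ((1 / 2) ^ j)) * ennreal D / ennreal D"
    by (rule divide_right_mono_ennreal)
  also have "\<dots> = K + S * ennreal ((1 / 2) ^ j)"
    using D(1) by (simp add: ennreal_mult_divide_eq)
  finally show ?thesis
    by (simp add: D(2) K_def S_def)
qed

lemma has_trace_ext:
  assumes f: "integrable B f" and fin: "(\<Sum>k. En k f) < \<infinity>" and z: "z \<in> bd"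
    and osc0: "(\<lambda>k. osc (s k) f z) \<longlonglongrightarrow> 0"
  shows "has_trace M \<Omega> (ext f) z (f z)"
proof -
  define q where "q r = (\<integral>\<^sup>+y\<in>ball z r \<inter> \<Omega>. ennreal \<bar>ext f y - f z\<bar> \<partial>M) / emeasure M (ball z r \<inter> \<Omega>)" for r
  define \<beta> where "\<beta> j = ennreal (8 * CH) * (osc (s j) f z + osc (s (Suc j)) f z + osc (s (Suc (Suc j))) f z)
      + ennreal C1 * (\<Sum>k. En k f) * ennreal ((1 / 2) ^ j)" for j
  have "\<beta> \<longlonglongrightarrow> ennreal (8 * CH) * (0 + 0 + 0) + ennreal C1 * (\<Sum>k. En k f) * ennreal 0"
    unfolding \<beta>_def
  \<comment> \<open>Multiplication by a constant is continuous here only for a finite constant, so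
    \<open>fin\<close> is used for the sum of the energies.\<close>
  proof (intro tendsto_add ennreal_tendsto_cmult tendsto_ennrealI)
    show "(\<lambda>k. osc (s k) f z) \<longlonglongrightarrow> 0" "(\<lambda>k. osc (s (Suc k)) f z) \<longlonglongrightarrow> 0"
      "(\<lambda>k. osc (s (Suc (Suc k))) f z) \<longlonglongrightarrow> 0"
      using osc0 LIMSEQ_Suc[OF osc0] LIMSEQ_Suc[OF LIMSEQ_Suc[OF osc0]] by auto
    show "(\<lambda>j. (1 / 2) ^ j :: real) \<longlonglongrightarrow> 0"
      by (rule LIMSEQ_power_zero) simp
  qed (use fin in \<open>auto simp: ennreal_mult_less_top\<close>)
  then have \<beta>: "\<beta> \<longlonglongrightarrow> 0"
    by simp
  have "(q \<longlongrightarrow> 0) (at_right 0)"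
  proof (rule order_tendstoI)
    fix y :: ennreal assume "0 < y"
    then obtain J where J: "\<And>j. J \<le> j \<Longrightarrow> \<beta> j < y"
      using order_tendstoD(2)[OF \<beta>] by (auto simp: eventually_sequentially)
    have "\<forall>\<^sub>F r in at_right 0. r \<in> {0<..<s (Suc (Suc J)) / 2}"
      using s_pos[of "Suc (Suc J)"] by (intro eventually_at_right_real) simp
    then show "\<forall>\<^sub>F r in at_right 0. q r < y"
    proof eventually_elim
      case (elim r)
      then have r: "0 < r" "r < s (Suc (Suc J)) / 2"
        by auto
      \<comment> \<open>The least such index, shifted down by one, is the \<open>j\<close> whose
        interval in \<open>ext_mean_deviation_le\<close> contains \<open>r\<close>; minimality
        supplies the strict upper bound.\<close>
      define Pr where "Pr i \<longleftrightarrow> s (Suc (Suc i)) / 2 \<le> r" for i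
      obtain N where "\<And>k. N \<le> k \<Longrightarrow> s k < 2 * r"
        using s_small[of "2 * r"] r(1) by auto
      then have "Pr N"
        unfolding Pr_def using order.strict_implies_order[of "s (Suc (Suc N))" "2 * r"] by simp
      define i where "i = (LEAST i. Pr i)"
      have i: "Pr i" "\<And>k. k < i \<Longrightarrow> \<not> Pr k"
        unfolding i_def using \<open>Pr N\<close> by (auto intro: LeastI dest: not_less_Least)
      have "J < i"
      proof (rule ccontr)
        assume "\<not> J < i"
        then have "s (Suc (Suc J)) \<le> s (Suc (Suc i))"
          by (intro s_antimono) simp
        with i(1) r(2) show False
          by (simp add: Pr_def)
      qed
      then obtain j where j: "i = Suc j" "J \<le> j"
        by (cases i) auto
      have "s (Suc (Suc (Suc j))) / 2 \<le> r" "r < s (Suc (Suc j)) / 2"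
        using i(1) i(2)[of j] j by (auto simp: Pr_def)
      then have "q r \<le> \<beta> j"
        unfolding q_def \<beta>_def by (rule ext_mean_deviation_le[OF f z])
      with J[OF j(2)] show ?case by simp
    qed
  qed simp
  then show ?thesis
    unfolding has_trace_def q_def by (intro lim_imp_Limsup) auto
qed

lemma AE_has_trace_ext:
  assumes "f \<in> besov_space M \<Omega> R"
  shows "AE z in B. has_trace M \<Omega> (ext f) z (f z)"
proof -
  have f: "integrable B f" and b: "besov_norm M \<Omega> R f < \<infinity>"
    using assms by (auto simp: besov_space_def)
  have [measurable]: "osc r f \<in> borel_measurable B" for r
    using f by (intro measurable_osc) simp
  have fin: "(\<Sum>k. En k f) < \<infinity>"
    using suminf_En_le[of f] b by (auto simp: ennreal_mult_less_top elim: order_le_less_trans)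
  also have "(\<Sum>k. En k f) = (\<integral>\<^sup>+z. (\<Sum>k. osc (s k) f z) \<partial>B)"
    unfolding En_def by (rule nn_integral_suminf[symmetric]) simp
  finally have "AE z in B. (\<Sum>k. osc (s k) f z) \<noteq> \<infinity>"
    by (intro nn_integral_noteq_infinite) auto
  then show ?thesis
    using AE_space
  proof eventually_elim
    case (elim z)
    have "osc (s k) f z < top" for k
      using elim(1) ennreal_suminf_lessD[of "\<lambda>k. osc (s k) f z" top k] by (simp add: less_top)
    then have eq: "osc (s k) f z = ennreal (enn2real (osc (s k) f z))" for k
      by simp
    have "summable (\<lambda>k. enn2real (osc (s k) f z))"
      using elim(1) by (intro summable_suminf_not_top) (auto simp flip: eq)
    then have "(\<lambda>k. ennreal (enn2real (osc (s k) f z))) \<longlonglongrightarrow> ennreal 0"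
      by (intro tendsto_ennrealI summable_LIMSEQ_zero)
    then have "(\<lambda>k. osc (s k) f z) \<longlonglongrightarrow> 0"
      by (simp flip: eq)
    with elim(2) show ?case
      by (intro has_trace_ext f fin) auto
  qed
qed

lemma bounded_linear_ext: "bounded_linear_besov_BV M \<Omega> R ext"
  unfolding bounded_linear_besov_BV_def
proof (intro conjI ballI allI impI)
  show "ext f \<in> BV_space M \<Omega>" if "f \<in> besov_space M \<Omega> R" for f
    by (rule ext_in_BV_space[OF that])
  show "AE x in M. x \<in> \<Omega> \<longrightarrow> ext f x = ext g x"
    if "f \<in> besov_space M \<Omega> R" "g \<in> besov_space M \<Omega> R" "AE z in B. f z = g z" for f g
    using that ext_cong_AE[of f g] by (simp add: besov_space_def)
  show "AE x in M. x \<in> \<Omega> \<longrightarrow> ext (\<lambda>z. a * f z + b * g z) x = a * ext f x + b * ext g x"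
    if "f \<in> besov_space M \<Omega> R" "g \<in> besov_space M \<Omega> R" for f g a b
    using that ext_linear[of f g] by (simp add: besov_space_def)
  show "\<exists>C. \<forall>f\<in>besov_space M \<Omega> R. BV_norm M \<Omega> (ext f) \<le> ennreal C * besov_norm M \<Omega> R f"
    using BV_norm_ext_le by (auto simp: besov_space_def)
qed

end

section \<open>The zero operator, used when the boundary is empty\<close>

lemma upper_gradient_energy_zero: "upper_gradient_energy M \<Omega> (\<lambda>_. 0) = 0"
proof -
  have "upper_gradient_energy M \<Omega> (\<lambda>_. 0) \<le> (\<integral>\<^sup>+x\<in>\<Omega>. 0 \<partial>M)"
    unfolding upper_gradient_energy_def by (rule INF_lower) (simp add: upper_gradient_def)
  then show ?thesis by simp
qed

lemma BV_norm_zero: "BV_norm M \<Omega> (\<lambda>_. 0) = 0"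
proof -
  have "total_variation M \<Omega> (\<lambda>_. 0) \<le> liminf (\<lambda>i::nat. upper_gradient_energy M \<Omega> (\<lambda>_. 0))"
    unfolding total_variation_def
  proof (rule INF_lower2[of "\<lambda>_ _. 0"])
    have "locally_lipschitz_on \<Omega> (\<lambda>_. 0)"
      unfolding locally_lipschitz_on_def using lipschitz_on_constant zero_less_one by blast
    then show "(\<lambda>_ _. 0) \<in> {v. (\<forall>i::nat. locally_lipschitz_on \<Omega> (v i)) \<and>
        (\<lambda>i. \<integral>\<^sup>+x\<in>\<Omega>. ennreal \<bar>v i x - 0\<bar> \<partial>M) \<longlonglongrightarrow> 0}"
      by simp
  qed simp
  then show ?thesis
    by (simp add: BV_norm_def upper_gradient_energy_zero Liminf_const)
qed

theorem theorem1p1: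
  fixes M :: "'a::complete_space measure" and \<Omega> :: "'a set" and R :: real
  assumes "doubling_measure M"
    and "open \<Omega>" and "connected \<Omega>" and "\<Omega> \<noteq> {}" and "bounded \<Omega>"
    and "codim1_ahlfors_regular_boundary M \<Omega>"
    and "0 < R"
  shows "\<exists>E :: ('a \<Rightarrow> real) \<Rightarrow> ('a \<Rightarrow> real).
     bounded_linear_besov_BV M \<Omega> R E \<and>
     (\<forall>f\<in>besov_space M \<Omega> R. AE z in boundary_measure M \<Omega>. has_trace M \<Omega> (E f) z (f z))"
proof (cases "frontier \<Omega> = {}")
  \<comment> \<open>This happens, for instance, when \<Omega> is the whole space. Every trace
    condition is then vacuous, since the boundary measure lives on the empty set.\<close>
  case True
  have "space (boundary_measure M \<Omega>) = {}"
    by (simp add: boundary_measure_def space_restrict_space True)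
  then have "AE z in boundary_measure M \<Omega>. has_trace M \<Omega> (\<lambda>_. 0) z (f z)" for f
    by (intro AE_I2) simp
  moreover have "bounded_linear_besov_BV M \<Omega> R (\<lambda>_ _. 0)"
    by (simp add: bounded_linear_besov_BV_def BV_space_def BV_norm_zero set_integrable_def)
  ultimately show ?thesis
    by (intro exI[of _ "\<lambda>_ _. 0"]) simp
next
  case False
  obtain CD where "doubling_space M CD"
    using doubling_measure_imp_doubling_space[OF assms(1)] .
  then interpret doubling_space M CD .
  obtain CA :: real where CA: "1 \<le> CA" "\<forall>x\<in>frontier \<Omega>. \<forall>r. 0 < r \<and> r \<le> diameter \<Omega> \<longrightarrow>
      ennreal (1 / CA) * (emeasure M (ball x r) / ennreal r) \<le> codim1_hausdorff M (ball x r \<inter> frontier \<Omega>) \<and>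
      codim1_hausdorff M (ball x r \<inter> frontier \<Omega>) \<le> ennreal CA * (emeasure M (ball x r) / ennreal r)"
    using assms(6) unfolding codim1_ahlfors_regular_boundary_def by blast
  interpret codim1_domain M CD \<Omega> CA
    by unfold_locales (use assms False CA in auto)
  obtain L s where "extension_scales M CD \<Omega> CA R L s"
    using extension_scales_exist[OF assms(7)] .
  then interpret extension_scales M CD \<Omega> CA R L s .
  show ?thesis
    using bounded_linear_ext AE_has_trace_ext by blast
qed

end
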